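(* Let $G$ be a positive definite even integral symmetric $n\times n$ matrix ($n\ge1$), $D=\det G$, $N$ its level, $G^\perp=NG^{-1}$. Let $c$ be a positive integer with $N\mid c$, $a$ a nonzero integer with $\gcd(a,c)=1$, $\mathbf{w}\in\mathbb{Q}^n$ with $G\mathbf{w}\in\mathbb{Z}^n$, and $H$ a subgroup of $\mathbb{Z}^n/c\mathbb{Z}^n$. Let $a'$ be any integer with $aa'\equiv1\pmod{cN}$, and let $S=H^\perp\cap\{\mathbf{y}+c\mathbb{Z}^n:\mathbf{y}\in aG\mathbf{w}+G\mathbb{Z}^n\}$. Then $$\frac{1}{\sqrt{|H|}}\mathfrak{G}^H_G(a/c;\mathbf{w})=\gamma\cdot\frac{\sqrt D}{\sqrt{|H^\perp|}}\sum_{\mathbf{y}\in S}e\!\left(\frac{-a'}{Nc}\cdot\tfrac12(\mathbf{y}-aG\mathbf{w})^TG^\perp(\mathbf{y}-aG\mathbf{w})\right),$$ where in the last sum each element of $S$ is represented by some $\mathbf{y}\in aG\mathbf{w}+G\mathbb{Z}^n$ (the value is independent of the choice, and the sum is $0$ if $S=\emptyset$), and $\gamma=i^{n/2}\mu_G(a,c)\,e\!\left(\frac{a}{2c}\mathbf{w}^TG\mathbf{w}\right)$ with $$\mu_G(a,c)=\begin{cases}\left(\frac{-\mathrm{sgn}(a)\, c}{|a|}\right)_K^n\left(\frac{D}{a}\right)_K e\!\left(\frac{n\,\mathrm{sgn}(a)(1-a)}{8}\right)&2\nmid a,\\ \left(\frac{a}{D}\right)_K&2\mid a.\end{cases}$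$
   Context: $e(z)=\exp(2\pi i z)$; $i^{n/2}=e(n/8)$. Even integral: integer entries, even diagonal. Level: least positive $N$ with $NG^{-1}$ even integral. $\mathfrak{G}^H_G(a/c;\mathbf{w})=\sum_{\mathbf{v}\in H}e\big(\frac ac\cdot\frac12(\mathbf{v}+\mathbf{w})^TG(\mathbf{v}+\mathbf{w})\big)$, with $\mathbf{v}$ running over integer representatives (independent of choice). $H^\perp=\{\mathbf{v}\in\mathbb{Z}^n/c\mathbb{Z}^n:\mathbf{v}^T\mathbf{h}\equiv0\pmod c\ \forall \mathbf{h}\in H\}$. $(\frac{\cdot}{\cdot})_K$ is the Kronecker–Jacobi symbol. *)

theory Defs
  imports
    "HOL-Analysis.Analysis"
    "HOL-Algebra.Coset"
    "HOL-Number_Theory.Number_Theory"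
begin

definition e :: "complex \<Rightarrow> complex" where
  "e z = exp (2 * of_real pi * \<i> * z)"

subsection \<open>Integral matrices\<close>

abbreviation rvec :: "int ^ 'n \<Rightarrow> real ^ 'n" where
  "rvec v \<equiv> \<chi> i. real_of_int (v $ i)"

abbreviation rmat :: "int ^ 'n ^ 'n \<Rightarrow> real ^ 'n ^ 'n" where
  "rmat A \<equiv> map_matrix real_of_int A"

definition even_integral :: "real ^ 'n ^ 'n \<Rightarrow> bool" where
  "even_integral A \<longleftrightarrow> (\<forall>i j. A $ i $ j \<in> \<int>) \<and> (\<forall>i. \<exists>k::int. A $ i $ i = 2 * of_int k)"

definition pos_definite :: "real ^ 'n ^ 'n \<Rightarrow> bool" where
  "pos_definite A \<longleftrightarrow> (\<forall>x. x \<noteq> 0 \<longrightarrow> x \<bullet> (A *v x) > 0)"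

definition level :: "int ^ 'n ^ 'n \<Rightarrow> nat" where
  "level G = (LEAST N. N > 0 \<and> even_integral (real N *\<^sub>R matrix_inv (rmat G)))"

definition dual_matrix :: "int ^ 'n ^ 'n \<Rightarrow> real ^ 'n ^ 'n" where
  "dual_matrix G = real (level G) *\<^sub>R matrix_inv (rmat G)"

definition half_form :: "real ^ 'n ^ 'n \<Rightarrow> real ^ 'n \<Rightarrow> real" where
  "half_form A x = 1 / 2 * (x \<bullet> (A *v x))"

subsection \<open>The Kronecker--Jacobi symbol\<close>

text \<open>
  The library's \<^const>\<open>Legendre\<close> is only meaningful for odd primes, so the
  value at 2 is given separately. The sign of the lower argument contributes the factor
  $(\frac{m}{-1})$, which is $-1$ exactly for $m < 0$.
\<close>

definition kronecker_prime :: "int \<Rightarrow> nat \<Rightarrow> int" where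
  "kronecker_prime m p =
     (if p = 2 then (if even m then 0 else if m mod 8 = 1 \<or> m mod 8 = 7 then 1 else - 1)
      else Legendre m (int p))"

definition kronecker :: "int \<Rightarrow> int \<Rightarrow> int" where
  "kronecker m k =
     (if k = 0 then (if \<bar>m\<bar> = 1 then 1 else 0)
      else (if k < 0 \<and> m < 0 then - 1 else 1) *
           (\<Prod>p\<in>prime_factors (nat \<bar>k\<bar>). kronecker_prime m p ^ multiplicity p (nat \<bar>k\<bar>)))"

subsection \<open>The group of integer vectors modulo \<open>c\<close>\<close>

definition Zn :: "(int ^ 'n) monoid" where
  "Zn = \<lparr>carrier = UNIV, mult = (+), one = 0\<rparr>"

definition cZn :: "nat \<Rightarrow> (int ^ 'n) set" where
  "cZn c = range (\<lambda>v. int c *s v)"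

abbreviation Zn_mod :: "nat \<Rightarrow> (int ^ 'n) set monoid" where
  "Zn_mod c \<equiv> Zn Mod cZn c"

definition residue_class :: "nat \<Rightarrow> int ^ 'n \<Rightarrow> (int ^ 'n) set" where
  "residue_class c v = cZn c #>\<^bsub>Zn\<^esub> v"

definition perp :: "nat \<Rightarrow> (int ^ 'n) set set \<Rightarrow> (int ^ 'n) set set" where
  "perp c H = {V \<in> carrier (Zn_mod c).
     \<forall>K\<in>H. \<forall>v\<in>V. \<forall>h\<in>K. [(\<Sum>i\<in>UNIV. v $ i * h $ i) = 0] (mod int c)}"

subsection \<open>Gauss sums\<close>

text \<open>
  The sum runs over a set of residue classes; the lemma \<open>gauss_sum_eq\<close> below shows
  that the chosen representatives do not matter.
\<close>

definition gauss_sum ::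
  "int ^ 'n ^ 'n \<Rightarrow> (int ^ 'n) set set \<Rightarrow> real \<Rightarrow> real ^ 'n \<Rightarrow> complex" where
  "gauss_sum G H x w =
     (\<Sum>V\<in>H. e (of_real (x * half_form (rmat G) (rvec (SOME v. v \<in> V) + w))))"

text \<open>The integer vectors in \<open>aGw + G\<int>\<^sup>n\<close>.\<close>

definition shifted_lattice :: "int ^ 'n ^ 'n \<Rightarrow> int \<Rightarrow> real ^ 'n \<Rightarrow> (int ^ 'n) set" where
  "shifted_lattice G a w =
     {y. \<exists>z :: int ^ 'n. rvec y = of_int a *\<^sub>R (rmat G *v w) + rmat G *v rvec z}"

definition dual_support ::
  "int ^ 'n ^ 'n \<Rightarrow> nat \<Rightarrow> int \<Rightarrow> real ^ 'n \<Rightarrow> (int ^ 'n) set set \<Rightarrow> (int ^ 'n) set set" where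
  "dual_support G c a w H = perp c H \<inter> residue_class c ` shifted_lattice G a w"

definition dual_term ::
  "int ^ 'n ^ 'n \<Rightarrow> nat \<Rightarrow> int \<Rightarrow> int \<Rightarrow> real ^ 'n \<Rightarrow> int ^ 'n \<Rightarrow> complex" where
  "dual_term G c a a' w y =
     e (of_real (- of_int a' / (real (level G) * real c) *
        half_form (dual_matrix G) (rvec y - of_int a *\<^sub>R (rmat G *v w))))"

definition mu :: "int ^ 'n ^ 'n \<Rightarrow> int \<Rightarrow> nat \<Rightarrow> complex" where
  "mu G a c =
     (if odd a
      then of_int (kronecker (- sgn a * int c) \<bar>a\<bar> ^ CARD('n)) * of_int (kronecker (det G) a) *
           e (of_nat CARD('n) * of_int (sgn a * (1 - a)) / 8)
      else of_int (kronecker a (det G)))"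

definition gamma_factor :: "int ^ 'n ^ 'n \<Rightarrow> int \<Rightarrow> nat \<Rightarrow> real ^ 'n \<Rightarrow> complex" where
  "gamma_factor G a c w =
     e (of_nat CARD('n) / 8) * mu G a c *
     e (of_real (of_int a / (2 * real c) * (w \<bullet> (rmat G *v w))))"

subsection \<open>Independence of representatives\<close>

lemma e_add_int: "e (z + of_int k) = e z"
proof -
  have "e (z + of_int k) = e z * exp (2 * of_int k * of_real pi * \<i>)"
    by (simp add: e_def algebra_simps flip: exp_add)
  also have "exp (2 * of_int k * of_real pi * \<i>) = 1"
    using exp_integer_2pi[of "of_int k"] by (simp add: mult_ac)
  finally show ?thesis by simp
qed

lemma residue_class_alt: "residue_class c v = {int c *s z + v | z. True}"
  by (auto simp: residue_class_def r_coset_def Zn_def cZn_def)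

lemma carrier_Zn_mod: "carrier (Zn_mod c) = range (residue_class c)"
  by (auto simp: FactGroup_def RCOSETS_def residue_class_def Zn_def)

lemma residue_class_self: "v \<in> residue_class c v"
proof -
  have "v = int c *s 0 + v" by (simp add: vec_eq_iff)
  then show ?thesis unfolding residue_class_alt by blast
qed

lemma symmetric_matrix_inner:
  fixes A :: "real ^ 'n ^ 'n"
  assumes "transpose A = A"
  shows "x \<bullet> (A *v y) = y \<bullet> (A *v x)"
  by (metis assms dot_lmul_matrix inner_commute vector_transpose_matrix)

lemma half_form_add:
  fixes A :: "real ^ 'n ^ 'n"
  assumes "transpose A = A"
  shows "half_form A (x + y) = half_form A x + half_form A y + y \<bullet> (A *v x)"
  using symmetric_matrix_inner[OF assms, of x y]
  by (simp add: half_form_def matrix_vector_right_distrib inner_add_left inner_add_right algebra_simps)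

lemma half_form_scale: "half_form A (k *\<^sub>R x) = k\<^sup>2 * half_form A x"
  by (simp add: half_form_def matrix_vector_mult_scaleR power2_eq_square)

lemma rmat_mult_rvec: "rmat G *v rvec z = rvec (G *v z)"
  by (simp add: vec_eq_iff matrix_vector_mult_def)

lemma even_sym_sum:
  fixes f :: "'n \<Rightarrow> 'n \<Rightarrow> int"
  assumes "finite S" "\<And>i j. f i j = f j i" "\<And>i. even (f i i)"
  shows "even (\<Sum>i\<in>S. \<Sum>j\<in>S. f i j)"
  using assms(1)
proof (induction rule: finite_induct)
  case (insert x F)
  have "(\<Sum>i\<in>insert x F. \<Sum>j\<in>insert x F. f i j) =
      f x x + 2 * (\<Sum>j\<in>F. f x j) + (\<Sum>i\<in>F. \<Sum>j\<in>F. f i j)"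
    using insert.hyps assms(2) by (simp add: sum.distrib)
  then show ?case using insert.IH assms(3) by simp
qed simp

lemma half_form_int:
  fixes G :: "int ^ 'n ^ 'n"
  assumes "transpose G = G" "even_integral (rmat G)"
  shows "half_form (rmat G) (rvec z) \<in> \<int>"
proof -
  let ?f = "\<lambda>i j. z $ i * (G $ i $ j * z $ j)"
  have "G $ i $ j = G $ j $ i" for i j
    using arg_cong[OF assms(1), of "\<lambda>M. M $ i $ j"] by (simp add: transpose_def)
  moreover have "even (G $ i $ i)" for i
  proof -
    obtain k :: int where "real_of_int (G $ i $ i) = 2 * of_int k"
      using assms(2) by (auto simp: even_integral_def)
    then have "G $ i $ i = 2 * k" by linarith
    then show ?thesis by simp
  qed
  ultimately have "even (\<Sum>i\<in>UNIV. \<Sum>j\<in>UNIV. ?f i j)"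
    by (intro even_sym_sum) auto
  then obtain k where k: "(\<Sum>i\<in>UNIV. \<Sum>j\<in>UNIV. ?f i j) = 2 * k" by blast
  have "rvec z \<bullet> (rmat G *v rvec z) = of_int (\<Sum>i\<in>UNIV. \<Sum>j\<in>UNIV. ?f i j)"
    by (simp add: inner_vec_def matrix_vector_mult_def sum_distrib_left)
  then show ?thesis unfolding k by (simp add: half_form_def)
qed

lemma gauss_sum_eq:
  fixes G :: "int ^ 'n ^ 'n"
  assumes G: "transpose G = G" "even_integral (rmat G)" and c: "c > 0"
    and w: "\<forall>i. (rmat G *v w) $ i \<in> \<int>"
    and H: "H \<subseteq> carrier (Zn_mod c)" and r: "\<forall>V\<in>H. r V \<in> V"
  shows "gauss_sum G H (of_int a / real c) w =
    (\<Sum>V\<in>H. e (of_real (of_int a / real c * half_form (rmat G) (rvec (r V) + w))))"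
  unfolding gauss_sum_def
proof (rule sum.cong[OF refl])
  fix V assume V: "V \<in> H"
  then obtain u where u: "V = residue_class c u" using H by (auto simp: carrier_Zn_mod)
  have s: "(SOME v. v \<in> V) \<in> V" by (metis residue_class_self someI u)
  obtain z1 z2 where "(SOME v. v \<in> V) = int c *s z1 + u" "r V = int c *s z2 + u"
    using s r V u by (auto simp: residue_class_alt)
  then have "(SOME v. v \<in> V) = r V + int c *s (z1 - z2)"
    by (simp add: vec_eq_iff algebra_simps)
  then obtain z where "(SOME v. v \<in> V) = r V + int c *s z" by blast
  then have eq: "rvec (SOME v. v \<in> V) + w = (rvec (r V) + w) + real c *\<^sub>R rvec z"
    by (simp add: vec_eq_iff)
  have sym: "transpose (rmat G) = rmat G"
    using G(1) by (simp add: vec_eq_iff transpose_def)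
  have "rvec z \<bullet> (rmat G *v (rvec (r V) + w)) \<in> \<int>"
    using w by (auto simp: matrix_vector_right_distrib rmat_mult_rvec inner_vec_def
        intro!: Ints_sum Ints_mult Ints_add)
  then obtain k where k: "rvec z \<bullet> (rmat G *v (rvec (r V) + w)) = of_int k" by (auto elim: Ints_cases)
  obtain l where l: "half_form (rmat G) (rvec z) = of_int l"
    using half_form_int[OF G] by (auto elim: Ints_cases)
  have "of_int a / real c * half_form (rmat G) (rvec (SOME v. v \<in> V) + w) =
      of_int a / real c * half_form (rmat G) (rvec (r V) + w) + of_int (a * (int c * l + k))"
    unfolding eq half_form_add[OF sym] half_form_scale inner_scaleR_left k l
    using c by (simp add: field_simps power2_eq_square)
  then show "e (of_real (of_int a / real c * half_form (rmat G) (rvec (SOME v. v \<in> V) + w))) =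
      e (of_real (of_int a / real c * half_form (rmat G) (rvec (r V) + w)))"
    by (metis e_add_int of_real_add of_real_of_int_eq)
qed

end

theory Submission
  imports Defs
begin

text \<open>
  Poisson summation over \<open>H\<close> and completing the square reduce the identity to the evaluation of
  the complete Gauss sum \<open>W(a/c)\<close>, the sum of \<open>e(a/c \<cdot> q(v))\<close> over \<open>v\<close> modulo \<open>c\<close>, for
  \<open>q(v) = v\<^sup>TGv/2\<close>.

  For \<open>a = 1\<close>: if the lattice is replaced by a sublattice and \<open>c\<close> by a suitable multiple, the sum
  only changes by the index, so \<open>G\<close> may be diagonalized over the rationals and the evaluation
  reduces to the one-dimensional sums \<open>S(M)\<close> with \<open>4 | M\<close>. As \<open>S(Mt\<^sup>2) = t S(M)\<close>, the quotient
  \<open>S(M)/\<surd>M\<close> equals its own limit along \<open>Mt\<^sup>2\<close>. Riemann sums, together with summation by parts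
  for the tail, identify this limit with a Fresnel integral that does not depend on \<open>M\<close>, so
  \<open>S(M)/\<surd>M = S(4)/2 = 1 + i\<close>.

  For odd \<open>a > 0\<close>, the Chinese remainder theorem gives \<open>W(1/(ac)) = W(a/c) W(c/a)\<close>, and \<open>W(c/a)\<close>
  is a product of one-dimensional sums because \<open>G\<close> is diagonalizable modulo odd prime powers
  prime to its determinant. Negative \<open>a\<close> follows by conjugation. For even \<open>a\<close> one replaces \<open>a\<close> by a
  positive \<open>b \<equiv> a (mod c)\<close> with \<open>b \<equiv> 1 (mod 8)\<close> and applies reciprocity.
\<close>

text \<open>The hypothesis \<open>N | c\<close> acts through one mechanism. If
  \<open>G B = N\<close> with \<open>B\<close> even and \<open>s = (c/N) B u\<close>, then
  \<open>G s = c u\<close> and \<open>c\<close> divides \<open>q(s)\<close>, so translation by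
  \<open>s\<close> fixes \<open>q\<close> modulo \<open>c\<close> while a linear character picks up
  a root of unity. Hence Fourier coefficients outside \<open>aGw + GZ^n\<close> vanish, and dual
  terms depend only on classes modulo \<open>c\<close>. Finer translates \<open>B t\<close>,
  available when \<open>c\<close> is divisible by more than \<open>N\<close>, compare a lattice with
  a sublattice. For this reason rational diagonalization first yields \<open>W(1/c)\<close> only for
  \<open>c\<close> divisible by a constant depending on \<open>G\<close>; comparing the moduli
  \<open>c\<close> and \<open>c t^2\<close> then reaches every multiple of \<open>N\<close>. The two
  branches of \<open>mu\<close> meet as follows. If \<open>a\<close> is even, then \<open>c\<close>,
  \<open>N\<close> and \<open>D\<close> are odd, and the formula for odd numerators itself forces
  \<open>n\<close> to be even. So the \<open>n\<close>-th power of the symbol of \<open>-c\<close>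
  disappears, \<open>b = 1 (mod 8)\<close> removes the eighth root of unity, and only
  \<open>(D/b) = (b/D)\<close> is left. The facts about symbols used here, the value at
  \<open>-1\<close> and reciprocity for \<open>b = 1 (mod 4)\<close>, are read off from
  one-dimensional Gauss sums.\<close>

lemma e_add: "e (x + y) = e x * e y"
  by (simp add: e_def distrib_left exp_add)

lemma e_0 [simp]: "e 0 = 1"
  by (simp add: e_def)

lemma e_of_int [simp]: "e (of_int k) = 1"
  using e_add_int[of 0 k] by simp

lemma norm_e_of_real [simp]: "norm (e (of_real r)) = 1"
proof -
  have "e (of_real r) = exp (\<i> * of_real (2 * pi * r))" by (simp add: e_def mult_ac)
  then show ?thesis by (simp only: norm_exp_i_times)
qed

lemma e_minus: "e (- z) = inverse (e z)"
  by (simp add: e_def exp_minus)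

lemma e_nonzero [simp]: "e z \<noteq> 0"
  by (simp add: e_def)

lemma cnj_e_of_real: "cnj (e (of_real r)) = e (of_real (- r))"
  by (simp add: e_def exp_cnj)

subsection \<open>Additive characters and residue systems\<close>

text \<open>Integer arguments reduce every periodicity argument to a congruence
  (\<open>chr_cong\<close>). For \<open>m = 0\<close> division by zero gives the constant 1, which
  keeps \<open>chr_eq_1\<close> and \<open>chr_cong\<close> free of side conditions.\<close>

definition chr :: "int \<Rightarrow> int \<Rightarrow> complex" where
  "chr m k = e (of_real (of_int k / of_int m))"

lemma chr_add: "chr m (k + l) = chr m k * chr m l"
  by (simp add: chr_def add_divide_distrib e_add)

lemma chr_0 [simp]: "chr m 0 = 1"
  by (simp add: chr_def)

lemma chr_uminus: "chr m (- k) = cnj (chr m k)"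
  unfolding chr_def cnj_e_of_real by simp

lemma norm_chr [simp]: "norm (chr m k) = 1"
  unfolding chr_def by (rule norm_e_of_real)

lemma chr_nonzero [simp]: "chr m k \<noteq> 0"
  by (simp add: chr_def)

lemma chr_sum: "chr m (\<Sum>i\<in>A. f i) = (\<Prod>i\<in>A. chr m (f i))"
  by (induction A rule: infinite_finite_induct) (simp_all add: chr_add)

lemma chr_eq_1:
  assumes "m dvd k" shows "chr m k = 1"
proof (cases "m = 0")
  case False
  then obtain l where "k = m * l" using assms by blast
  then have "of_int k / of_int m = (of_int l :: real)" using False by simp
  then show ?thesis unfolding chr_def by (metis e_of_int of_real_of_int_eq)
qed (simp add: chr_def)

lemma chr_cong:
  assumes "[k = l] (mod m)" shows "chr m k = chr m l"
proof -
  have "chr m k = chr m (l + (k - l))" by simp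
  also have "\<dots> = chr m l" unfolding chr_add
    using assms by (simp add: chr_eq_1 cong_iff_dvd_diff)
  finally show ?thesis .
qed

lemma chr_mult_cancel: "d \<noteq> 0 \<Longrightarrow> chr (d * m) (d * k) = chr m k"
  by (simp add: chr_def)

lemma chr_eq_1_iff:
  assumes "m \<noteq> 0" shows "chr m k = 1 \<longleftrightarrow> m dvd k"
proof
  assume "chr m k = 1"
  then have "exp (\<i> * of_real (2 * pi * (of_int k / of_int m))) = 1"
    by (simp add: chr_def e_def mult_ac)
  then obtain n :: int where "2 * pi * (of_int k / of_int m) = of_int (2 * n) * pi"
    unfolding exp_eq_1 by (auto simp del: of_real_mult of_real_divide)
  then have "pi * (2 * (of_int k / of_int m)) = pi * (2 * of_int n)" by (simp add: mult_ac)
  then have "of_int k / of_int m = (of_int n :: real)" by (simp only: mult_cancel_left) simp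
  then have "(of_int k :: real) = of_int (m * n)" using assms by (simp add: field_simps)
  then show "m dvd k" by (metis dvd_triv_left of_int_eq_iff)
qed (rule chr_eq_1)

lemma chr_power: "chr m (k * int n) = chr m k ^ n"
  by (induction n) (simp_all add: distrib_left chr_add)

lemma sum_chr:
  assumes "m > 0"
  shows "(\<Sum>x\<in>{0..<m}. chr m (k * x)) = (if m dvd k then of_int m else 0)"
proof -
  have "{0..<m} = int ` {..<nat m}"
  proof
    show "{0..<m} \<subseteq> int ` {..<nat m}"
    proof
      fix x assume "x \<in> {0..<m}"
      then have "x = int (nat x)" "nat x \<in> {..<nat m}" by auto
      then show "x \<in> int ` {..<nat m}" by blast
    qed
  qed auto
  then have *: "(\<Sum>x\<in>{0..<m}. chr m (k * x)) = (\<Sum>n<nat m. chr m k ^ n)"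
    by (simp add: sum.reindex chr_power)
  show ?thesis
  proof (cases "m dvd k")
    case True
    then show ?thesis using * assms by (simp add: chr_eq_1)
  next
    case False
    have "chr m k ^ nat m = 1"
      using assms chr_power[of m k "nat m"] by (simp add: chr_eq_1)
    then show ?thesis
      using * False assms by (simp add: geometric_sum chr_eq_1_iff)
  qed
qed

section \<open>Boxes as complete residue systems\<close>

text \<open>Separate side lengths are allowed because \<open>gsum_congr_dmat\<close> works with
  different moduli \<open>d_i\<close> in the coordinates.\<close>

definition ibox :: "int ^ 'n \<Rightarrow> (int ^ 'n) set" where
  "ibox b = {v. \<forall>i. 0 \<le> v $ i \<and> v $ i < b $ i}"

abbreviation rbox :: "int \<Rightarrow> (int ^ 'n) set" where
  "rbox m \<equiv> ibox (\<chi> i. m)"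

lemma bij_betw_ibox: "bij_betw vec_lambda (PiE UNIV (\<lambda>i. {0..<b $ i})) (ibox b)"
  by (rule bij_betw_byWitness[where f' = vec_nth]) (auto simp: ibox_def PiE_def)

lemma finite_ibox [simp]: "finite (ibox b)"
  using bij_betw_finite[OF bij_betw_ibox[of b]] by (simp add: finite_PiE)

lemma sum_prod_ibox:
  fixes f :: "'n :: finite \<Rightarrow> int \<Rightarrow> complex"
  shows "(\<Sum>v\<in>ibox b. \<Prod>i\<in>UNIV. f i (v $ i)) = (\<Prod>i\<in>UNIV. \<Sum>x\<in>{0..<b $ i}. f i x)"
  unfolding sum.reindex_bij_betw[OF bij_betw_ibox, symmetric]
  by (subst prod_sum_PiE) auto

lemma card_ibox: "card (ibox b) = (\<Prod>i\<in>UNIV. nat (b $ i))"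
  using bij_betw_same_card[OF bij_betw_ibox[of b]] by (simp add: card_PiE)

lemma card_rbox: "card (rbox m :: (int ^ 'n) set) = nat m ^ CARD('n)"
  by (simp add: card_ibox)

definition vmod :: "int \<Rightarrow> int ^ 'n \<Rightarrow> int ^ 'n" where
  "vmod m v = (\<chi> i. v $ i mod m)"

definition vcong :: "int \<Rightarrow> int ^ 'n \<Rightarrow> int ^ 'n \<Rightarrow> bool" where
  "vcong m u v \<longleftrightarrow> (\<forall>i. m dvd u $ i - v $ i)"

lemma vmod_rbox: "m > 0 \<Longrightarrow> vmod m v \<in> rbox m"
  by (simp add: vmod_def ibox_def)

lemma vcong_vmod: "vcong m (vmod m v) v"
  by (simp add: vcong_def vmod_def mod_eq_dvd_iff flip: mod_eq_dvd_iff)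

lemma vcong_iff_vmod: "vcong m u v \<longleftrightarrow> vmod m u = vmod m v"
  by (simp add: vcong_def vmod_def vec_eq_iff mod_eq_dvd_iff)

lemma vmod_rbox_id: "v \<in> rbox m \<Longrightarrow> vmod m v = v"
  by (simp add: vmod_def ibox_def vec_eq_iff)

text \<open>Counting replaces surjectivity: \<open>m^n\<close> pairwise incongruent vectors already
  represent all classes. The changes of variables in complete sums (shifts, Chinese remainders, base
  change) are instances, and only injectivity has to be checked for them.\<close>

lemma sum_complete_residues:
  fixes f :: "int ^ 'n \<Rightarrow> 'a :: comm_monoid_add" and g :: "'b \<Rightarrow> int ^ 'n"
  assumes m: "m > 0" and fin: "finite A" and card: "card A = nat m ^ CARD('n)"
    and inj: "\<And>a b. a \<in> A \<Longrightarrow> b \<in> A \<Longrightarrow> vcong m (g a) (g b) \<Longrightarrow> a = b"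
    and per: "\<And>u v. vcong m u v \<Longrightarrow> f u = f v"
  shows "(\<Sum>a\<in>A. f (g a)) = (\<Sum>v\<in>rbox m. f v)"
proof -
  have i: "inj_on (vmod m \<circ> g) A"
    by (auto intro!: inj_onI inj simp: vcong_iff_vmod)
  have "(vmod m \<circ> g) ` A = rbox m"
  proof (rule card_subset_eq)
    show "(vmod m \<circ> g) ` A \<subseteq> rbox m" using vmod_rbox[OF m] by auto
    show "card ((vmod m \<circ> g) ` A) = card (rbox m :: (int ^ 'n) set)"
      unfolding card_image[OF i] card_rbox card ..
  qed simp
  then have "(\<Sum>v\<in>rbox m. f v) = (\<Sum>a\<in>A. f (vmod m (g a)))"
    using sum.reindex[OF i, of f] by simp
  also have "\<dots> = (\<Sum>a\<in>A. f (g a))"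
    by (rule sum.cong[OF refl]) (rule per, rule vcong_vmod)
  finally show ?thesis by simp
qed

lemma sum_rbox_shift:
  fixes f :: "int ^ 'n \<Rightarrow> 'a :: comm_monoid_add"
  assumes "m > 0" "\<And>u v. vcong m u v \<Longrightarrow> f u = f v"
  shows "(\<Sum>v\<in>rbox m. f (v + s)) = (\<Sum>v\<in>rbox m. f v)"
proof (rule sum_complete_residues[OF assms(1)])
  show "a = b" if "a \<in> rbox m" "b \<in> rbox m" "vcong m (a + s) (b + s)" for a b
    using that vmod_rbox_id[of a m] vmod_rbox_id[of b m] vcong_iff_vmod[of m a b] by (simp add: vcong_def)
qed (use assms(2) in \<open>auto simp: card_rbox\<close>)

lemma vcong_rbox_eq: "a \<in> rbox m \<Longrightarrow> b \<in> rbox m \<Longrightarrow> vcong m a b \<Longrightarrow> a = b"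
  using vmod_rbox_id[of a m] vmod_rbox_id[of b m] vcong_iff_vmod[of m a b] by simp

lemma sum_rbox_mult:
  fixes f :: "int ^ 'n \<Rightarrow> complex"
  assumes m: "m > 0" and k: "k > 0" and per: "\<And>u v. vcong m u v \<Longrightarrow> f u = f v"
  shows "(\<Sum>v\<in>rbox (m * k). f v) = of_int k ^ CARD('n) * (\<Sum>v\<in>rbox m. f v)"
proof -
  have "(\<Sum>v\<in>rbox (m * k). f v) = (\<Sum>(x, y)\<in>rbox m \<times> rbox k. f (x + m *s y))"
    unfolding case_prod_unfold
  proof (rule sum_complete_residues[symmetric])
    show "card (rbox m \<times> rbox k :: ((int ^ 'n) \<times> (int ^ 'n)) set) = nat (m * k) ^ CARD('n)"
      using m k by (simp add: card_cartesian_product card_rbox nat_mult_distrib power_mult_distrib)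
    show "f u = f v" if "vcong (m * k) u v" for u v
      using that by (intro per) (auto simp: vcong_def dest: dvd_mult_left)
    fix a b :: "(int ^ 'n) \<times> (int ^ 'n)"
    assume a: "a \<in> rbox m \<times> rbox k" and b: "b \<in> rbox m \<times> rbox k"
      and *: "vcong (m * k) (fst a + m *s snd a) (fst b + m *s snd b)"
    have eq: "fst a = fst b"
    proof (rule vcong_rbox_eq)
      show "vcong m (fst a) (fst b)"
        unfolding vcong_def
      proof
        fix i
        have "m * k dvd (fst a $ i - fst b $ i) + m * (snd a $ i - snd b $ i)"
          using * by (auto simp: vcong_def algebra_simps)
        then have "m dvd (fst a $ i - fst b $ i) + m * (snd a $ i - snd b $ i)"
          by (rule dvd_mult_left)
        then show "m dvd fst a $ i - fst b $ i" by (simp add: dvd_add_left_iff)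
      qed
    qed (use a b in auto)
    have "snd a = snd b"
    proof (rule vcong_rbox_eq)
      show "vcong k (snd a) (snd b)"
        unfolding vcong_def
      proof
        fix i
        have "m * k dvd m * (snd a $ i - snd b $ i)"
          using * eq by (auto simp: vcong_def algebra_simps)
        then show "k dvd snd a $ i - snd b $ i" using m by simp
      qed
    qed (use a b in auto)
    with eq show "a = b" by (simp add: prod_eq_iff)
  qed (use m k in auto)
  also have "\<dots> = (\<Sum>(x, y)\<in>rbox m \<times> (rbox k :: (int ^ 'n) set). f x)"
    by (intro sum.cong) (auto intro!: per simp: vcong_def)
  also have "\<dots> = of_int k ^ CARD('n) * (\<Sum>v\<in>rbox m. f v)"
    using k by (simp add: sum.cartesian_product[symmetric] card_rbox sum_distrib_left)
  finally show ?thesis .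
qed

subsection \<open>Integral quadratic forms and their Gauss sums\<close>

definition vdot :: "int ^ 'n \<Rightarrow> int ^ 'n \<Rightarrow> int" where
  "vdot u v = (\<Sum>i\<in>UNIV. u $ i * v $ i)"

lemma vdot_commute: "vdot u v = vdot v u"
  by (simp add: vdot_def mult.commute)

lemma vdot_add_left: "vdot (u + v) x = vdot u x + vdot v x"
  by (simp add: vdot_def distrib_right sum.distrib)

lemma vdot_add_right: "vdot x (u + v) = vdot x u + vdot x v"
  by (simp add: vdot_def distrib_left sum.distrib)

lemma vdot_scale_left: "vdot (k *s u) v = k * vdot u v"
  by (simp add: vdot_def sum_distrib_left mult_ac)

lemma vdot_scale_right: "vdot u (k *s v) = k * vdot u v"
  by (simp add: vdot_def sum_distrib_left mult_ac)

lemma vdot_matrix_left: "vdot (A *v x) y = vdot x (transpose A *v y)"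
proof -
  have "vdot (A *v x) y = (\<Sum>i\<in>UNIV. \<Sum>j\<in>UNIV. A $ i $ j * x $ j * y $ i)"
    by (simp add: vdot_def matrix_vector_mult_def sum_distrib_right)
  also have "\<dots> = (\<Sum>j\<in>UNIV. \<Sum>i\<in>UNIV. A $ i $ j * x $ j * y $ i)" by (rule sum.swap)
  also have "\<dots> = vdot x (transpose A *v y)"
    by (simp add: vdot_def matrix_vector_mult_def transpose_def sum_distrib_left mult_ac)
  finally show ?thesis .
qed

lemma vdot_symmetric:
  assumes "transpose G = G" shows "vdot x (G *v y) = vdot y (G *v x)"
  using vdot_matrix_left[of G y x] assms by (simp add: vdot_commute)

lemma vcong_iff_scale: "vcong m u v \<longleftrightarrow> (\<exists>z. u = v + m *s z)"
proof
  assume "vcong m u v"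
  then obtain z where "\<And>i. u $ i - v $ i = m * z i"
    unfolding vcong_def dvd_def by metis
  then have "u = v + m *s (\<chi> i. z i)" by (simp add: vec_eq_iff algebra_simps)
  then show "\<exists>z. u = v + m *s z" ..
qed (auto simp: vcong_def)

section \<open>Even forms, base change and complete Gauss sums\<close>

definition even_form :: "int ^ 'n ^ 'n \<Rightarrow> bool" where
  "even_form G \<longleftrightarrow> transpose G = G \<and> (\<forall>i. even (G $ i $ i))"

text \<open>The division is exact for even forms (\<open>qf_double\<close>); identities for
  \<open>qf\<close> are therefore proved after doubling.\<close>

definition qf :: "int ^ 'n ^ 'n \<Rightarrow> int ^ 'n \<Rightarrow> int" where
  "qf G x = vdot x (G *v x) div 2"

lemma qf_double:
  assumes "even_form G" shows "vdot x (G *v x) = 2 * qf G x"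
proof -
  have "G $ i $ j = G $ j $ i" for i j
  proof -
    have "transpose G $ j $ i = G $ i $ j" by (simp add: transpose_def)
    then show ?thesis using assms by (simp add: even_form_def)
  qed
  then have "even (\<Sum>i\<in>UNIV. \<Sum>j\<in>UNIV. x $ i * (G $ i $ j * x $ j))"
    using assms by (intro even_sym_sum) (auto simp: even_form_def)
  also have "(\<Sum>i\<in>UNIV. \<Sum>j\<in>UNIV. x $ i * (G $ i $ j * x $ j)) = vdot x (G *v x)"
    by (simp add: vdot_def matrix_vector_mult_def sum_distrib_left)
  finally show ?thesis by (simp add: qf_def)
qed

lemma qf_add:
  assumes "even_form G" shows "qf G (x + y) = qf G x + qf G y + vdot x (G *v y)"
proof -
  have "2 * qf G (x + y) = 2 * (qf G x + qf G y + vdot x (G *v y))"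
    using assms vdot_symmetric[of G x y]
    by (simp add: qf_double[symmetric] even_form_def matrix_vector_right_distrib vdot_add_left
        vdot_add_right)
  then show ?thesis by simp
qed

lemma matrix_vector_scale: "A *v (k *s x) = k *s (A *v (x :: int ^ 'n))"
  by (simp add: matrix_vector_mult_def vec_eq_iff sum_distrib_left mult_ac)

lemma qf_scale:
  assumes "even_form G" shows "qf G (k *s x) = k\<^sup>2 * qf G x"
proof -
  have "2 * qf G (k *s x) = 2 * (k\<^sup>2 * qf G x)"
    using qf_double[OF assms, of x]
    by (simp add: qf_double[OF assms, symmetric] matrix_vector_scale vdot_scale_left vdot_scale_right
        power2_eq_square)
  then show ?thesis by simp
qed

lemma qf_cong:
  assumes "even_form G" "vcong m u v" shows "[qf G u = qf G v] (mod m)"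
proof -
  obtain z where z: "u = v + m *s z" using assms(2) by (auto simp: vcong_iff_scale)
  have "qf G u - qf G v = m * (m * qf G z + vdot v (G *v z))"
    unfolding z by (simp add: qf_add qf_scale assms(1) matrix_vector_scale vdot_scale_right
        algebra_simps power2_eq_square)
  then show ?thesis by (simp add: cong_iff_dvd_diff)
qed

text \<open>This is \<open>W(b/m)\<close> of the overview. Numerator and modulus are separate
  integers because reciprocity exchanges them.\<close>

definition gsum :: "int ^ 'n ^ 'n \<Rightarrow> int \<Rightarrow> int \<Rightarrow> complex" where
  "gsum G b m = (\<Sum>v\<in>rbox m. chr m (b * qf G v))"

lemma chr_qf_cong:
  assumes "even_form G" "vcong m u v" shows "chr m (b * qf G u) = chr m (b * qf G v)"
  by (intro chr_cong cong_mult qf_cong assms) simp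

text \<open>A change of basis if \<open>P\<close> is unimodular, and the restriction of the form to
  the sublattice \<open>P Z^n\<close> if \<open>P\<close> is merely injective. Diagonalization uses
  both.\<close>

definition congr :: "int ^ 'n ^ 'n \<Rightarrow> int ^ 'n ^ 'n \<Rightarrow> int ^ 'n ^ 'n" where
  "congr P G = transpose P ** G ** P"

lemma vdot_congr: "vdot x (congr P G *v y) = vdot (P *v x) (G *v (P *v y))"
  by (simp add: congr_def vdot_matrix_left matrix_vector_mul_assoc matrix_mul_assoc)

lemma qf_congr: "qf (congr P G) x = qf G (P *v x)"
  by (simp add: qf_def vdot_congr)

lemma vdot_axis: "vdot (axis i 1) v = v $ i"
  by (simp add: vdot_def axis_def if_distrib[of "\<lambda>x. x * _"] cong: if_cong)

lemma vdot_axis_axis: "vdot (axis i 1) (G *v axis j 1) = G $ i $ j"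
  unfolding vdot_axis by (simp add: matrix_vector_mult_def axis_def if_distrib[of "\<lambda>x. _ * x"] cong: if_cong)

lemma even_form_congr:
  assumes "even_form G" shows "even_form (congr P G)"
  unfolding even_form_def
proof (intro conjI allI)
  show "transpose (congr P G) = congr P G"
    using assms by (simp add: congr_def even_form_def matrix_transpose_mul matrix_mul_assoc)
  show "even (congr P G $ i $ i)" for i
    using qf_double[OF assms, of "P *v axis i 1"]
    by (simp add: vdot_axis_axis[symmetric] vdot_congr)
qed

definition dmat :: "int ^ 'n \<Rightarrow> int ^ 'n ^ 'n" where
  "dmat d = (\<chi> i j. if i = j then d $ i else 0)"

lemma dmat_mult: "(dmat d *v x) $ i = d $ i * x $ i"
  by (simp add: dmat_def matrix_vector_mult_def if_distrib[of "\<lambda>x. x * _"] cong: if_cong)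

lemma mat_mult_vector: "mat k *v x = k *s (x :: int ^ 'n)"
  by (simp add: mat_def matrix_vector_mult_def vec_eq_iff if_distrib[of "\<lambda>x. x * _"] cong: if_cong)

text \<open>The summand is multiplied by a character of \<open>v\<close> modulo the \<open>d\<^sub>i\<close> when \<open>v\<close> is translated by
  \<open>B t\<close>. Averaging over these translations restricts the sum to the sublattice \<open>\<Oplus> d\<^sub>i \<int>\<close>.\<close>

lemma gsum_congr_dmat:
  fixes G B :: "int ^ 'n ^ 'n"
  assumes G: "even_form G" and B: "even_form B" and GB: "G ** B = mat N" and N: "N > 0"
    and k: "k > 0" and m: "m\<^sup>2 dvd k" and d: "\<And>i. d $ i > 0" "\<And>i. d $ i dvd m"
  shows "gsum (congr (dmat d) G) 1 (N * k) = of_int (\<Prod>i\<in>UNIV. d $ i) * gsum G 1 (N * k)"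
proof -
  define C where "C = N * k"
  define f where "f v = chr C (qf G v)" for v
  have C: "C > 0" using N k by (simp add: C_def)
  have per: "f u = f v" if "vcong C u v" for u v
    using chr_qf_cong[OF G that, of 1] by (simp add: f_def)
  have dk: "d $ i dvd k" for i using d(2)[of i] m by (auto simp: power2_eq_square dest: dvd_mult_left intro: dvd_trans)
  define D where "D = {v \<in> rbox C. \<forall>i. d $ i dvd v $ i}"

  have twist: "(\<Sum>v\<in>rbox C. f v) = (\<Sum>v\<in>rbox C. f v * (\<Prod>i\<in>UNIV. chr (d $ i) (v $ i * u $ i)))" for u :: "int ^ 'n"
  proof -
    \<comment> \<open>Chosen so that \<open>N t_i / C = u_i / d_i\<close>: the mixed term between
      \<open>v\<close> and \<open>B t\<close> is then the wanted character. Since \<open>m^2\<close>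
      divides \<open>k\<close>, \<open>t\<close> is \<open>m l\<close> times an integer vector,
      which makes \<open>q(B t) = N q_B(t)\<close> a multiple of \<open>C\<close>.\<close>
    define t :: "int ^ 'n" where "t = (\<chi> i. k div d $ i * u $ i)"
    define t' :: "int ^ 'n" where "t' = (\<chi> i. m div d $ i * u $ i)"
    obtain l where l: "k = m\<^sup>2 * l" using m by blast
    have "m \<noteq> 0" using k l by auto
    have t: "t = (m * l) *s t'"
      unfolding t_def t'_def l using d(2) by (simp add: vec_eq_iff power2_eq_square mult_ac div_mult_swap)
    have Gs: "G *v (B *v t) = N *s t" by (simp add: matrix_vector_mul_assoc GB mat_mult_vector)
    have "2 * qf G (B *v t) = 2 * (N * qf B t)"
      using qf_double[OF B, of t] qf_double[OF G, of "B *v t"]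
      by (simp add: Gs vdot_scale_right vdot_commute)
    then have "qf G (B *v t) = N * qf B t" by simp
    also have "\<dots> = C * (l * qf B t')" by (simp add: t qf_scale[OF B] C_def l power2_eq_square mult_ac)
    finally have q: "chr C (qf G (B *v t)) = 1" by (simp add: chr_eq_1)
    have "f (v + B *v t) = f v * (\<Prod>i\<in>UNIV. chr (d $ i) (v $ i * u $ i))" for v
    proof -
      have "chr C (v $ i * (N * t $ i)) = chr (d $ i) (v $ i * u $ i)" for i
      proof -
        have "C = N * (k div d $ i) * d $ i" using dk[of i] by (simp add: C_def mult_ac)
        moreover have "v $ i * (N * t $ i) = N * (k div d $ i) * (v $ i * u $ i)" by (simp add: t_def)
        moreover have "N * (k div d $ i) \<noteq> 0" using C calculation(1) by auto
        ultimately show ?thesis by (metis chr_mult_cancel)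
      qed
      then have "chr C (vdot v (N *s t)) = (\<Prod>i\<in>UNIV. chr (d $ i) (v $ i * u $ i))"
        by (simp add: vdot_def chr_sum)
      then show ?thesis by (simp add: f_def qf_add[OF G] chr_add Gs q)
    qed
    then show ?thesis using sum_rbox_shift[OF C, of f "B *v t"] per by simp
  qed

  have "of_int (\<Prod>i\<in>UNIV. d $ i) * (\<Sum>v\<in>rbox C. f v) = (\<Sum>u\<in>ibox d. \<Sum>v\<in>rbox C. f v)"
    using d(1) by (simp add: card_ibox less_imp_le)
  also have "\<dots> = (\<Sum>u\<in>ibox d. \<Sum>v\<in>rbox C. f v * (\<Prod>i\<in>UNIV. chr (d $ i) (v $ i * u $ i)))"
    by (intro sum.cong refl twist)
  also have "\<dots> = (\<Sum>v\<in>rbox C. \<Sum>u\<in>ibox d. f v * (\<Prod>i\<in>UNIV. chr (d $ i) (v $ i * u $ i)))"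
    by (rule sum.swap)
  also have "\<dots> = (\<Sum>v\<in>rbox C. f v * (\<Prod>i\<in>UNIV. if d $ i dvd v $ i then of_int (d $ i) else 0))"
  proof (rule sum.cong[OF refl])
    fix v
    show "(\<Sum>u\<in>ibox d. f v * (\<Prod>i\<in>UNIV. chr (d $ i) (v $ i * u $ i))) =
        f v * (\<Prod>i\<in>UNIV. if d $ i dvd v $ i then of_int (d $ i) else 0)"
      using d(1) sum_prod_ibox[of "\<lambda>i x. chr (d $ i) (v $ i * x)" d]
      by (simp add: sum_distrib_left[symmetric] sum_chr)
  qed
  also have "\<dots> = (\<Sum>v\<in>rbox C. if v \<in> D then of_int (\<Prod>i\<in>UNIV. d $ i) * f v else 0)"
    by (rule sum.cong) (auto simp: D_def)
  also have "\<dots> = of_int (\<Prod>i\<in>UNIV. d $ i) * (\<Sum>v\<in>D. f v)"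
    by (simp add: sum_distrib_left sum.If_cases D_def Int_def)
  finally have SD: "(\<Sum>v\<in>rbox C. f v) = (\<Sum>v\<in>D. f v)"
    using d(1) by (simp add: prod_zero_iff less_le)

  define q where "q = (\<chi> i. C div d $ i)"
  have dC: "d $ i dvd C" for i using dk[of i] by (simp add: C_def)
  have q: "d $ i * q $ i = C" "q $ i > 0" for i
    using dC[of i] d(1)[of i] C by (auto simp: q_def pos_imp_zdiv_pos_iff zdvd_imp_le)
  have "gsum (congr (dmat d) G) 1 C = (\<Sum>x\<in>rbox C. f (dmat d *v x))"
    by (simp add: gsum_def qf_congr f_def)
  \<comment> \<open>Write \<open>x = y + q z\<close> coordinatewise with
    \<open>0 <= y_i < q_i\<close> and \<open>0 <= z_i < d_i\<close>. As \<open>d_i q_i = C\<close>,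
    the part \<open>z\<close> is invisible after applying \<open>dmat d\<close>, so each point of
    \<open>D\<close> is counted once for every \<open>z\<close>.\<close>
  also have "\<dots> = (\<Sum>a\<in>ibox q \<times> ibox d. f (dmat d *v (fst a + (\<chi> i. q $ i * snd a $ i))))"
  proof (rule sum_complete_residues[symmetric, OF C])
    have "(\<Prod>i\<in>UNIV. nat (q $ i)) * (\<Prod>i\<in>UNIV. nat (d $ i)) = (\<Prod>i\<in>(UNIV :: 'n set). nat C)"
      unfolding prod.distrib[symmetric] by (rule prod.cong) (use q d in \<open>simp_all flip: nat_mult_distrib add: less_imp_le mult.commute\<close>)
    then show "card (ibox q \<times> ibox d) = nat C ^ CARD('n)"
      by (simp add: card_cartesian_product card_ibox)
    show "f (dmat d *v u) = f (dmat d *v v)" if "vcong C u v" for u v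
      using that by (intro per) (simp add: vcong_def dmat_mult flip: right_diff_distrib)
    fix a b :: "(int ^ 'n) \<times> (int ^ 'n)"
    assume a: "a \<in> ibox q \<times> ibox d" and b: "b \<in> ibox q \<times> ibox d"
      and *: "vcong C (fst a + (\<chi> i. q $ i * snd a $ i)) (fst b + (\<chi> i. q $ i * snd b $ i))"
    have "fst a $ i = fst b $ i \<and> snd a $ i = snd b $ i" for i
    proof -
      have bd: "0 \<le> fst a $ i" "fst a $ i < q $ i" "0 \<le> fst b $ i" "fst b $ i < q $ i"
         "0 \<le> snd a $ i" "snd a $ i < d $ i" "0 \<le> snd b $ i" "snd b $ i < d $ i"
        using a b by (auto simp: ibox_def)
      have dv: "d $ i * q $ i dvd (fst a $ i - fst b $ i) + q $ i * (snd a $ i - snd b $ i)"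
        using * q(1)[of i] by (auto simp: vcong_def algebra_simps)
      then have "q $ i dvd (fst a $ i - fst b $ i) + q $ i * (snd a $ i - snd b $ i)"
        by (rule dvd_mult_right)
      then have "q $ i dvd fst a $ i - fst b $ i" by (simp add: dvd_add_left_iff)
      then have 1: "fst a $ i = fst b $ i"
        using bd by (metis mod_eq_dvd_iff mod_pos_pos_trivial)
      then have "q $ i * d $ i dvd q $ i * (snd a $ i - snd b $ i)" using dv by (simp add: mult.commute)
      then have "d $ i dvd snd a $ i - snd b $ i" using q(2)[of i] by simp
      then have "snd a $ i = snd b $ i" using bd by (metis mod_eq_dvd_iff mod_pos_pos_trivial)
      with 1 show ?thesis by simp
    qed
    then show "a = b" by (simp add: prod_eq_iff vec_eq_iff)
  qed auto
  also have "\<dots> = (\<Sum>(y, z)\<in>ibox q \<times> (ibox d :: (int ^ 'n) set). f (dmat d *v y))"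
    unfolding case_prod_unfold
    by (intro sum.cong refl per)
      (simp add: vcong_def dmat_mult distrib_left mult.assoc[symmetric] q)
  also have "\<dots> = of_int (\<Prod>i\<in>UNIV. d $ i) * (\<Sum>y\<in>ibox q. f (dmat d *v y))"
    using d(1) by (simp add: sum.cartesian_product[symmetric] card_ibox less_imp_le sum_distrib_left)
  also have "(\<Sum>y\<in>ibox q. f (dmat d *v y)) = (\<Sum>v\<in>D. f v)"
  proof (rule sum.reindex_bij_witness[of _ "\<lambda>v. \<chi> i. v $ i div d $ i" "\<lambda>y. dmat d *v y"])
    fix y assume y: "y \<in> ibox q"
    show "(\<chi> i. (dmat d *v y) $ i div d $ i) = y"
      using d(1) by (simp add: vec_eq_iff dmat_mult less_le)
    show "dmat d *v y \<in> D"
    proof -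
      have "0 \<le> d $ i * y $ i \<and> d $ i * y $ i < C" for i
        using y d(1)[of i] mult_strict_left_mono[of "y $ i" "q $ i" "d $ i"]
        by (simp add: ibox_def q(1))
      then show ?thesis by (simp add: D_def ibox_def dmat_mult)
    qed
  next
    fix v assume v: "v \<in> D"
    show "dmat d *v (\<chi> i. v $ i div d $ i) = v"
      using v by (simp add: vec_eq_iff dmat_mult D_def)
    show "(\<chi> i. v $ i div d $ i) \<in> ibox q"
    proof -
      have "0 \<le> v $ i div d $ i \<and> v $ i div d $ i < q $ i" for i
      proof -
        obtain w where w: "v $ i = d $ i * w" using v by (auto simp: D_def)
        have "0 \<le> d $ i * w" "d $ i * w < d $ i * q $ i"
          using v q(1)[of i] by (auto simp: D_def ibox_def simp flip: w)
        then show ?thesis using d(1)[of i] by (simp add: w zero_le_mult_iff)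
      qed
      then show ?thesis by (simp add: ibox_def)
    qed
  qed auto
  also have "(\<Sum>v\<in>D. f v) = gsum G 1 C" using SD by (simp add: gsum_def f_def)
  finally show ?thesis by (simp add: C_def)
qed

subsection \<open>One-dimensional Gauss sums\<close>

text \<open>\<open>gs 1 m\<close> is \<open>S(m)\<close> of the overview. It is also the complete
  sum of the one-dimensional form with matrix \<open>(2)\<close> (\<open>gs_eq_gsum\<close>), so
  general results on \<open>gsum\<close> apply to it.\<close>

definition gs :: "int \<Rightarrow> int \<Rightarrow> complex" where
  "gs b m = (\<Sum>x\<in>{0..<m}. chr m (b * x\<^sup>2))"

section \<open>Asymptotics of \<open>S(4K)\<close> in terms of a Fresnel integral\<close>

text \<open>After subtracting the boundary term \<open>g(C) E(C)\<close>, the partial sum changes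
  from \<open>C\<close> to \<open>C + 1\<close> by \<open>(g(C) - g(C+1)) E(C+1)\<close>. The norms
  of these changes telescope because \<open>g\<close> decreases.\<close>

lemma summation_by_parts_bound:
  fixes g :: "nat \<Rightarrow> real" and E :: "nat \<Rightarrow> complex"
  assumes "A \<le> B" and dec: "\<And>x. A \<le> x \<Longrightarrow> x < B \<Longrightarrow> g (Suc x) \<le> g x" and pos: "g B \<ge> 0"
    and E: "\<And>x. norm (E x) \<le> 1"
  shows "norm (\<Sum>x\<in>{A..<B}. of_real (g x) * (E (Suc x) - E x)) \<le> 2 * g A"
proof -
  have "norm ((\<Sum>x\<in>{A..<C}. of_real (g x) * (E (Suc x) - E x)) - of_real (g C) * E C) \<le> 2 * g A - g C \<and> 0 \<le> g A"
    if "A \<le> C" "C \<le> B" for C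
    using that
  proof (induction C rule: dec_induct)
    case base
    have "0 \<le> g A" using assms(1)
    proof (induction rule: inc_induct)
      case base
      show ?case by (rule pos)
    next
      case (step n)
      then show ?case using dec[of n] by simp
    qed
    then show ?case using E[of A] mult_left_mono[of "norm (E A)" 1 "g A"] by (simp add: norm_mult)
  next
    case (step C)
    let ?T = "\<lambda>C. \<Sum>x\<in>{A..<C}. of_real (g x) * (E (Suc x) - E x)"
    have "?T (Suc C) - of_real (g (Suc C)) * E (Suc C)
        = (?T C - of_real (g C) * E C) + of_real (g C - g (Suc C)) * E (Suc C)"
      using step.hyps by (simp add: algebra_simps)
    also have "norm \<dots> \<le> (2 * g A - g C) + (g C - g (Suc C)) * 1"
    proof (rule norm_triangle_mono)
      have "g (Suc C) \<le> g C" using dec step by simp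
      then have n: "norm (complex_of_real (g C - g (Suc C))) = g C - g (Suc C)"
        by (simp only: norm_of_real)
      show "norm (of_real (g C - g (Suc C)) * E (Suc C)) \<le> (g C - g (Suc C)) * 1"
        unfolding norm_mult n by (intro mult_left_mono E) (use \<open>g (Suc C) \<le> g C\<close> in simp)
    qed (use step in simp)
    finally show ?case using step by simp
  qed
  from this[OF assms(1) order_refl]
  have *: "norm ((\<Sum>x\<in>{A..<B}. of_real (g x) * (E (Suc x) - E x)) - of_real (g B) * E B) \<le> 2 * g A - g B"
    by blast
  have "norm (of_real (g B) * E B) \<le> g B"
    using E[of B] pos mult_left_mono[of "norm (E B)" 1 "g B"] by (simp add: norm_mult)
  then show ?thesis
    using * norm_triangle_sub[of "\<Sum>x\<in>{A..<B}. of_real (g x) * (E (Suc x) - E x)" "of_real (g B) * E B"] by linarith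
qed

text \<open>Jordan's inequality: sine is concave on this interval and lies above its chord.\<close>

lemma sin_ge_linear:
  fixes y :: real
  assumes "0 \<le> y" "y \<le> pi / 2" shows "2 * y / pi \<le> sin y"
proof -
  have c: "convex_on {0..pi/2} (\<lambda>x. - sin x)"
  proof (rule f''_ge0_imp_convex)
    show "((\<lambda>x. - sin x) has_real_derivative - cos x) (at x)" for x by (auto intro!: derivative_eq_intros)
    show "((\<lambda>x. - cos x) has_real_derivative sin x) (at x)" for x by (auto intro!: derivative_eq_intros)
    show "sin x \<ge> 0" if "x \<in> {0..pi/2}" for x using that by (intro sin_ge_zero) auto
  qed auto
  have "- sin ((1 - 2 * y / pi) *\<^sub>R 0 + (2 * y / pi) *\<^sub>R (pi / 2)) \<le> (1 - 2 * y / pi) * - sin 0 + (2 * y / pi) * - sin (pi / 2)"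
    by (rule convex_onD[OF c]) (use assms in \<open>auto simp: field_simps\<close>)
  then show ?thesis by simp
qed

text \<open>The Fresnel integrand. With \<open>h = 1 / sqrt (4 K)\<close>, the values
  \<open>qexp (x h)\<close> are the summands of \<open>S(4K)\<close>.\<close>

definition qexp :: "real \<Rightarrow> complex" where
  "qexp u = e (of_real (u\<^sup>2))"

lemma norm_qexp [simp]: "norm (qexp u) = 1"
  unfolding qexp_def by (rule norm_e_of_real)

text \<open>The squares of \<open>u + v\<close> and \<open>u - v\<close> differ from
  \<open>u^2 + v^2\<close> by \<open>2 u v\<close> and \<open>-2 u v\<close>. With
  \<open>v = h/2\<close> this presents a summand of the Gauss sum as a difference; it also gives the
  Lipschitz bound.\<close>

lemma qexp_diff:
  "qexp (u + v) - qexp (u - v) = e (of_real (u\<^sup>2 + v\<^sup>2)) * (2 * \<i> * of_real (sin (4 * pi * u * v)))"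
proof -
  have 1: "qexp (u + v) = e (of_real (u\<^sup>2 + v\<^sup>2)) * exp (\<i> * of_real (4 * pi * u * v))"
    unfolding qexp_def e_def by (simp add: power2_eq_square algebra_simps flip: exp_add)
  have 2: "qexp (u - v) = e (of_real (u\<^sup>2 + v\<^sup>2)) * exp (- (\<i> * of_real (4 * pi * u * v)))"
    unfolding qexp_def e_def by (simp add: power2_eq_square algebra_simps flip: exp_add)
  have 3: "exp (\<i> * of_real t) - exp (- (\<i> * of_real t)) = 2 * \<i> * of_real (sin t)" for t
    unfolding sin_of_real[symmetric] sin_exp_eq by simp
  show ?thesis unfolding 1 2 3[symmetric] by (simp add: right_diff_distrib)
qed

text \<open>By \<open>qexp_diff\<close>, \<open>qexp (x h)\<close> is a constant of norm 1/2 times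
  \<open>g(x) (E(x+1) - E(x))\<close>, with \<open>E\<close> sampled half a step to the left and
  \<open>g(x) = 1 / sin (2 pi x h^2)\<close>. For \<open>x <= K\<close> the angle stays below
  \<open>pi / 2\<close>, so \<open>g\<close> decreases; summation by parts bounds the sum by
  \<open>g(A)\<close>, and Jordan's inequality bounds \<open>g(A)\<close>.\<close>

lemma sum_qexp_tail_bound:
  fixes A K :: nat and h :: real
  assumes A: "0 < A" "A \<le> K" and h: "h > 0" "h\<^sup>2 * (4 * real K) = 1"
  shows "norm (\<Sum>x\<in>{A..<K}. qexp (real x * h)) \<le> 1 / (4 * real A * h\<^sup>2)"
proof -
  define E where "E x = qexp (real x * h - h / 2)" for x :: nat
  define g where "g x = 1 / sin (2 * pi * real x * h\<^sup>2)" for x :: nat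
  have le: "2 * pi * real x * h\<^sup>2 \<le> pi / 2" if "x \<le> K" for x
  proof -
    have "real x * h\<^sup>2 \<le> real K * h\<^sup>2" using that by (intro mult_right_mono) auto
    moreover have "real K * h\<^sup>2 = 1 / 4" using h(2) by (simp add: field_simps)
    ultimately have "real x * h\<^sup>2 \<le> 1 / 4" by linarith
    then have "(2 * pi) * (real x * h\<^sup>2) \<le> (2 * pi) * (1 / 4)" by (intro mult_left_mono) auto
    then show ?thesis by (simp add: mult_ac)
  qed
  have sp: "sin (2 * pi * real x * h\<^sup>2) > 0" if "0 < x" "x \<le> K" for x
    using le[OF that(2)] that h by (intro sin_gt_zero) (auto intro: le_less_trans)
  have "qexp (real x * h) = e (of_real (- (h / 2)\<^sup>2)) / (2 * \<i>) * (of_real (g x) * (E (Suc x) - E x))"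
    if "x \<in> {A..<K}" for x
  proof -
    have "E (Suc x) - E x = qexp (real x * h + h / 2) - qexp (real x * h - h / 2)"
      by (simp add: E_def algebra_simps)
    also have "\<dots> = e (of_real ((real x * h)\<^sup>2 + (h / 2)\<^sup>2)) * (2 * \<i> * of_real (sin (2 * pi * real x * h\<^sup>2)))"
      unfolding qexp_diff by (simp add: power2_eq_square mult_ac)
    also have "e (of_real ((real x * h)\<^sup>2 + (h / 2)\<^sup>2)) = qexp (real x * h) / e (of_real (- (h / 2)\<^sup>2))"
      unfolding qexp_def of_real_add of_real_minus e_add e_minus divide_inverse inverse_inverse_eq ..
    finally have eq: "E (Suc x) - E x = qexp (real x * h) / e (of_real (- (h / 2)\<^sup>2)) *
        (2 * \<i> * of_real (sin (2 * pi * real x * h\<^sup>2)))" .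
    have "of_real (g x) * of_real (sin (2 * pi * real x * h\<^sup>2)) = (1 :: complex)"
      using sp[of x] that A unfolding of_real_mult[symmetric] g_def by simp
    moreover have "q = u / (2 * \<i>) * (c * y)"
      if "y = q / u * (2 * \<i> * t)" "c * t = 1" "u \<noteq> 0" for q u t c y :: complex
    proof -
      have "u / (2 * \<i>) * (c * y) = q * (c * t)" using that(3) unfolding that(1) by (simp add: field_simps)
      then show ?thesis using that(2) by simp
    qed
    ultimately show ?thesis using eq e_nonzero by blast
  qed
  then have "(\<Sum>x\<in>{A..<K}. qexp (real x * h)) =
      e (of_real (- (h / 2)\<^sup>2)) / (2 * \<i>) * (\<Sum>x\<in>{A..<K}. of_real (g x) * (E (Suc x) - E x))"
    by (simp add: sum_distrib_left)
  also have "norm \<dots> = norm (\<Sum>x\<in>{A..<K}. of_real (g x) * (E (Suc x) - E x)) / 2"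
    unfolding norm_mult norm_divide norm_e_of_real by simp
  also have "\<dots> \<le> g A"
  proof -
    have "norm (\<Sum>x\<in>{A..<K}. of_real (g x) * (E (Suc x) - E x)) \<le> 2 * g A"
    proof (rule summation_by_parts_bound)
      show "g (Suc x) \<le> g x" if "A \<le> x" "x < K" for x
      proof -
        have "sin (2 * pi * real x * h\<^sup>2) \<le> sin (2 * pi * real (Suc x) * h\<^sup>2)"
          using le[of "Suc x"] that h by (intro sin_monotone_2pi_le) (auto intro: order_trans[of _ 0])
        then show ?thesis unfolding g_def using sp[of x] that A by (intro divide_left_mono mult_pos_pos sp) auto
      qed
      show "g K \<ge> 0" using sp[of K] A by (simp add: g_def less_imp_le)
    qed (use A in \<open>auto simp: E_def\<close>)
    then show ?thesis by simp
  qed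
  also have "g A \<le> 1 / (4 * real A * h\<^sup>2)"
  proof -
    have "4 * real A * h\<^sup>2 = 2 * (2 * pi * real A * h\<^sup>2) / pi" by simp
    also have "\<dots> \<le> sin (2 * pi * real A * h\<^sup>2)" by (rule sin_ge_linear) (use le[of A] A in auto)
    finally show ?thesis unfolding g_def using sp[of A] A h by (intro divide_left_mono) auto
  qed
  finally show ?thesis .
qed

lemma qexp_lipschitz:
  assumes "0 \<le> u" "u \<le> R" "0 \<le> v" "v \<le> R"
  shows "norm (qexp u - qexp v) \<le> 8 * pi * R * \<bar>u - v\<bar>"
proof -
  have eq: "qexp u - qexp v = qexp ((u + v) / 2 + (u - v) / 2) - qexp ((u + v) / 2 - (u - v) / 2)"
    by (simp add: field_simps)
  have "norm (qexp u - qexp v) = 2 * \<bar>sin (4 * pi * ((u + v) / 2) * ((u - v) / 2))\<bar>"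
    unfolding eq qexp_diff norm_mult norm_e_of_real by simp
  also have "\<dots> \<le> 2 * \<bar>4 * pi * ((u + v) / 2) * ((u - v) / 2)\<bar>"
    by (intro mult_left_mono abs_sin_x_le_abs_x) simp
  also have "\<dots> = 2 * pi * (u + v) * \<bar>u - v\<bar>" using assms by (simp add: abs_mult)
  \<comment> \<open>Here \<open>u + v <= 2 R\<close>, so the factor \<open>4 R\<close> leaves slack;
    only the growth in \<open>R\<close> and \<open>\<bar>u - v\<bar>\<close> matters later.\<close>
  also have "\<dots> \<le> (2 * pi) * (4 * R) * \<bar>u - v\<bar>"
    using assms by (intro mult_mono) auto
  finally show ?thesis by simp
qed

lemma continuous_on_qexp: "continuous_on S qexp"
  unfolding qexp_def e_def by (intro continuous_intros)

lemma qexp_integrable: "qexp integrable_on {a..b}"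
  by (intro integrable_continuous_real continuous_on_qexp)

lemma riemann_sum_qexp_bound:
  assumes h: "h > 0" and A: "real A * h \<le> R"
  shows "norm (of_real h * (\<Sum>x<A. qexp (real x * h)) - integral {0..real A * h} qexp) \<le> real A * (8 * pi * R * h\<^sup>2)"
  using A
proof (induction A)
  case (Suc A)
  have R: "real A * h \<le> R" using Suc.prems h by (simp add: algebra_simps)
  have le: "0 \<le> real A * h" "real A * h \<le> real (Suc A) * h" using h by (auto simp: algebra_simps)
  have "integral {0..real (Suc A) * h} qexp = integral {0..real A * h} qexp + integral {real A * h..real (Suc A) * h} qexp"
    using Henstock_Kurzweil_Integration.integral_combine[OF le qexp_integrable] by simp
  then have "of_real h * (\<Sum>x<Suc A. qexp (real x * h)) - integral {0..real (Suc A) * h} qexp =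
     (of_real h * (\<Sum>x<A. qexp (real x * h)) - integral {0..real A * h} qexp) +
     (of_real h * qexp (real A * h) - integral {real A * h..real (Suc A) * h} qexp)"
    by (simp add: algebra_simps)
  also have "norm \<dots> \<le> real A * (8 * pi * R * h\<^sup>2) + 8 * pi * R * h\<^sup>2"
  proof (rule norm_triangle_mono)
    have "of_real h * qexp (real A * h) = integral {real A * h..real (Suc A) * h} (\<lambda>_. qexp (real A * h))"
      using le h by (simp add: algebra_simps scaleR_conv_of_real)
    moreover have "integral {real A * h..real (Suc A) * h} (\<lambda>u. qexp (real A * h) - qexp u) =
        integral {real A * h..real (Suc A) * h} (\<lambda>_. qexp (real A * h)) - integral {real A * h..real (Suc A) * h} qexp"
      by (rule Henstock_Kurzweil_Integration.integral_diff) (auto intro: qexp_integrable)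
    ultimately have "of_real h * qexp (real A * h) - integral {real A * h..real (Suc A) * h} qexp =
        integral {real A * h..real (Suc A) * h} (\<lambda>u. qexp (real A * h) - qexp u)"
      by (simp only:)
    also have "norm \<dots> \<le> (8 * pi * R * h) * (real (Suc A) * h - real A * h)"
    proof (rule integral_bound)
      fix u assume u: "u \<in> {real A * h..real (Suc A) * h}"
      have "norm (qexp (real A * h) - qexp u) \<le> 8 * pi * R * \<bar>real A * h - u\<bar>"
        using u le Suc.prems R by (intro qexp_lipschitz) auto
      also have "\<dots> \<le> 8 * pi * R * h"
      proof (rule mult_left_mono)
        have "0 \<le> R" using le R by linarith
        then show "0 \<le> 8 * pi * R" by simp
      qed (use u in \<open>auto simp: algebra_simps\<close>)
      finally show "norm (qexp (real A * h) - qexp u) \<le> 8 * pi * R * h" .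
    qed (use le in \<open>auto intro!: continuous_intros continuous_on_qexp\<close>)
    finally show "norm (of_real h * qexp (real A * h) - integral {real A * h..real (Suc A) * h} qexp) \<le> 8 * pi * R * h\<^sup>2"
      by (simp add: power2_eq_square algebra_simps)
  qed (use Suc.IH R in simp)
  also have "real A * (8 * pi * R * h\<^sup>2) + 8 * pi * R * h\<^sup>2 = real (Suc A) * (8 * pi * R * h\<^sup>2)"
    by (simp only: of_nat_Suc distrib_right mult_1_left add.commute)
  finally show ?case .
qed simp

text \<open>Modulo \<open>4 K\<close>, the square of \<open>x\<close> is invariant under
  \<open>x + 2 K\<close> and \<open>2 K - x\<close>, so the full sum consists of four copies of its
  first quarter. The reflection sends the second quarter to \<open>1..K\<close> instead of
  \<open>0..K-1\<close>; the two endpoint terms account for the error 4. On the first quarter the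
  tail bound is available.\<close>

lemma gs_four_times_quarter:
  assumes "K > 0"
  shows "norm (gs 1 (4 * int K) - 4 * (\<Sum>x<K. chr (4 * int K) ((int x)\<^sup>2))) \<le> 4"
proof -
  define F where "F x = chr (4 * int K) ((int x)\<^sup>2)" for x :: nat
  have "gs 1 (4 * int K) = (\<Sum>x<4 * K. F x)"
    using sum.atLeast_int_lessThan_int_shift[of "\<lambda>x. chr (4 * int K) (x\<^sup>2)" 0 "4 * K"]
    by (simp add: gs_def F_def atLeast0LessThan)
  also have "\<dots> = (\<Sum>x<2 * K. F x) + (\<Sum>x<2 * K. F (x + 2 * K))"
    using sum.atLeastLessThan_concat[of 0 "2 * K" "4 * K" F] sum.shift_bounds_nat_ivl[of F 0 "2 * K" "2 * K"]
    by (simp add: lessThan_atLeast0)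
  also have "(\<Sum>x<2 * K. F (x + 2 * K)) = (\<Sum>x<2 * K. F x)"
    unfolding F_def by (intro sum.cong refl chr_cong)
      (auto simp: cong_iff_dvd_diff power2_eq_square algebra_simps intro!: dvd_add)
  also have "(\<Sum>x<2 * K. F x) = (\<Sum>x<K. F x) + (\<Sum>x\<in>{K..<2 * K}. F x)"
    using sum.atLeastLessThan_concat[of 0 K "2 * K" F] by (simp add: lessThan_atLeast0)
  also have "(\<Sum>x\<in>{K..<2 * K}. F x) = (\<Sum>y\<in>{1..K}. F y)"
  proof (rule sum.reindex_bij_witness[of _ "\<lambda>y. 2 * K - y" "\<lambda>x. 2 * K - x"])
    fix x assume x: "x \<in> {K..<2 * K}"
    have "[(int (2 * K - x))\<^sup>2 = (int x)\<^sup>2] (mod 4 * int K)"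
      using x by (simp add: of_nat_diff cong_iff_dvd_diff power2_eq_square algebra_simps)
    then show "F (2 * K - x) = F x" unfolding F_def by (rule chr_cong)
  qed auto
  also have "(\<Sum>y\<in>{1..n}. F y) = (\<Sum>y<n. F y) + F n - F 0" for n
    by (induction n) simp_all
  finally have "gs 1 (4 * int K) - 4 * (\<Sum>x<K. F x) = 2 * (F K - F 0)"
    by simp
  also have "norm \<dots> \<le> 4"
  proof -
    have "norm (F K - F 0) \<le> 2" using norm_triangle_ineq4[of "F K" "F 0"] by (simp add: F_def)
    then show ?thesis unfolding norm_mult by simp
  qed
  finally show ?thesis by (simp add: F_def)
qed

text \<open>Origin of the error: \<open>4 h\<close> from the endpoints of the quarters and
  \<open>4 h\<close> from rounding \<open>R\<close> down to a multiple of \<open>h\<close>,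
  \<open>32 pi R^2 h\<close> from the Riemann sum up to \<open>R\<close>, and \<open>2 / R\<close>
  from the oscillating tail beyond it.\<close>

lemma gs_asymp:
  fixes K :: nat and R :: real
  assumes K: "K > 0" and R: "R \<ge> 1" and h_def: "h = 1 / sqrt (4 * real K)" and Rh: "4 * R * h \<le> 1"
  shows "norm (of_real h * gs 1 (4 * int K) - 4 * integral {0..R} qexp) \<le> 8 * h + 32 * pi * R\<^sup>2 * h + 2 / R"
proof -
  have h: "h > 0" "h\<^sup>2 * (4 * real K) = 1" using K by (simp_all add: h_def power_divide)
  \<comment> \<open>The index where the Riemann sum ends and the tail begins. The hypothesis
    \<open>4 R h <= 1\<close> keeps it within the first quarter, that is
    \<open>A <= K\<close>.\<close>
  define A where "A = nat \<lfloor>R / h\<rfloor>"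
  have "R / h > 0" using R h by simp
  then have "real A \<le> R / h" "R / h < real A + 1" unfolding A_def by linarith+
  then have A: "real A * h \<le> R" "R - h \<le> real A * h" using h by (simp_all add: field_simps)
  have "4 * h \<le> 4 * R * h" using R h by simp
  then have h4: "4 * h \<le> 1" using Rh by linarith
  then have A2: "R / 2 \<le> real A * h" using A R by linarith
  then have A0: "A > 0" using R by (intro gr0I) auto
  have "real A * h * (4 * h) \<le> R * (4 * h)" using A h by (intro mult_right_mono) auto
  moreover have "R * (4 * h) \<le> 1" using Rh by (simp add: mult_ac)
  moreover have "real A * (h\<^sup>2 * 4) = real A * h * (4 * h)" by (simp add: power2_eq_square)
  moreover have "real K * (h\<^sup>2 * 4) = 1" using h(2) by (simp add: mult_ac)
  ultimately have "real A * (h\<^sup>2 * 4) \<le> real K * (h\<^sup>2 * 4)" by linarith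
  then have AK: "A \<le> K" using h by simp
  let ?q = "\<lambda>x. qexp (real x * h)"
  have F: "chr (4 * int K) ((int x)\<^sup>2) = ?q x" for x
  proof -
    have "(real x * h)\<^sup>2 = real_of_int ((int x)\<^sup>2) / real_of_int (4 * int K)"
      using K by (simp add: h_def power_mult_distrib power_divide)
    then show ?thesis by (simp only: chr_def qexp_def)
  qed
  have 1: "norm (of_real h * (gs 1 (4 * int K) - 4 * (\<Sum>x<K. ?q x))) \<le> h * 4"
    unfolding norm_mult norm_of_real using gs_four_times_quarter[OF K] h(1) by (intro mult_mono) (auto simp: F)
  have 2: "norm (4 * of_real h * (\<Sum>x\<in>{A..<K}. ?q x)) \<le> 2 / R"
  proof -
    have "norm (4 * of_real h * (\<Sum>x\<in>{A..<K}. ?q x)) = 4 * h * norm (\<Sum>x\<in>{A..<K}. ?q x)"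
      using h(1) by (simp add: norm_mult)
    also have "\<dots> \<le> 4 * h * (1 / (4 * real A * h\<^sup>2))"
      using sum_qexp_tail_bound[OF A0 AK h] h(1) by (intro mult_left_mono) auto
    also have "\<dots> = 1 / (real A * h)" using h A0 by (simp add: field_simps power2_eq_square)
    also have "\<dots> \<le> 1 / (R / 2)" using A2 R by (intro divide_left_mono) auto
    finally show ?thesis by simp
  qed
  have 3: "norm (4 * (of_real h * (\<Sum>x<A. ?q x) - integral {0..real A * h} qexp)) \<le> 32 * pi * R\<^sup>2 * h"
  proof -
    have "norm (4 * (of_real h * (\<Sum>x<A. ?q x) - integral {0..real A * h} qexp)) \<le> 4 * (real A * (8 * pi * R * h\<^sup>2))"
      using riemann_sum_qexp_bound[OF h(1) A(1)] unfolding norm_mult by (simp add: mult_ac)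
    also have "\<dots> = (real A * h) * (32 * pi * R * h)" by (simp add: power2_eq_square)
    also have "\<dots> \<le> R * (32 * pi * R * h)" using A R h by (intro mult_right_mono) auto
    finally show ?thesis by (simp add: power2_eq_square mult_ac)
  qed
  have 4: "norm (4 * integral {real A * h..R} qexp) \<le> 4 * h"
  proof -
    have "norm (integral {real A * h..R} qexp) \<le> 1 * (R - real A * h)"
      by (rule integral_bound) (use A in \<open>auto intro: continuous_on_qexp\<close>)
    then show ?thesis using A by (simp add: norm_mult)
  qed
  have split: "(\<Sum>x<K. ?q x) = (\<Sum>x<A. ?q x) + (\<Sum>x\<in>{A..<K}. ?q x)"
    using sum.atLeastLessThan_concat[of 0 A K ?q] AK by (simp add: lessThan_atLeast0)
  have int: "integral {0..R} qexp = integral {0..real A * h} qexp + integral {real A * h..R} qexp"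
    using Henstock_Kurzweil_Integration.integral_combine[OF _ A(1) qexp_integrable, of 0] h by simp
  have "of_real h * gs 1 (4 * int K) - 4 * integral {0..R} qexp =
     (of_real h * (gs 1 (4 * int K) - 4 * (\<Sum>x<K. ?q x)) + 4 * of_real h * (\<Sum>x\<in>{A..<K}. ?q x)) +
     (4 * (of_real h * (\<Sum>x<A. ?q x) - integral {0..real A * h} qexp) - 4 * integral {real A * h..R} qexp)"
    unfolding split int by (simp add: algebra_simps)
  also have "norm \<dots> \<le> (h * 4 + 2 / R) + (32 * pi * R\<^sup>2 * h + 4 * h)"
    by (rule norm_triangle_mono[OF norm_triangle_mono[OF 1 2] order_trans[OF norm_triangle_ineq4 add_mono[OF 3 4]]])
  finally show ?thesis by simp
qed

section \<open>Exact scaling and the value of \<open>S(M)\<close> for \<open>4 | M\<close>\<close>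

lemma even_form_mat2: "even_form (mat 2)"
  by (simp add: even_form_def transpose_mat) (simp add: mat_def)

lemma qf_mat2: "qf (mat 2) (x :: int ^ 1) = (x $ 1)\<^sup>2"
  by (simp add: qf_def vdot_def mat_mult_vector power2_eq_square UNIV_1)

lemma gs_eq_gsum: "gs b m = gsum (mat 2 :: int ^ 1 ^ 1) b m"
  using sum_prod_ibox[of "\<lambda>(_ :: 1) x. chr m (b * x\<^sup>2)" "\<chi> i. m"]
  by (simp add: gs_def gsum_def qf_mat2 UNIV_1)

lemma mat_mult_mat: "mat a ** mat b = (mat (a * b) :: int ^ 'n ^ 'n)"
  by (simp add: matrix_matrix_mult_def mat_def vec_eq_iff if_distrib[of "\<lambda>x. x * _"] cong: if_cong)

text \<open>Apply \<open>gsum_congr_dmat\<close> to \<open>G = B = (2)\<close> and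
  \<open>N = 4\<close>, which is where \<open>4 | M\<close> comes from. Restricting to
  \<open>t Z\<close> multiplies \<open>S(M t^2)\<close> by the index \<open>t\<close>; the
  restricted sum has period \<open>M\<close> and equals \<open>t^2 S(M)\<close>.\<close>

lemma gs_scale:
  assumes M: "M > 0" "4 dvd M" and t: "t > 0"
  shows "gs 1 (M * t\<^sup>2) = of_int t * gs 1 M"
proof -
  let ?G = "mat 2 :: int ^ 1 ^ 1"
  obtain l where l: "M = 4 * l" using M by blast
  have "gsum (congr (dmat (\<chi> i. t)) ?G) 1 (M * t\<^sup>2) = (\<Sum>v\<in>(rbox (M * t\<^sup>2) :: (int ^ 1) set). chr M ((v $ 1)\<^sup>2))"
    unfolding gsum_def qf_congr qf_mat2 dmat_mult using t
    by (intro sum.cong refl) (simp add: power_mult_distrib chr_mult_cancel mult.commute[of M])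
  also have "\<dots> = of_int (t\<^sup>2) * gs 1 M"
  proof -
    have "chr M ((u $ 1)\<^sup>2) = chr M ((v $ 1)\<^sup>2)" if "vcong M u v" for u v :: "int ^ 1"
      using chr_qf_cong[OF even_form_mat2 that, of 1] by (simp add: qf_mat2)
    then show ?thesis
      using t M sum_rbox_mult[of M "t\<^sup>2" "\<lambda>v :: int ^ 1. chr M ((v $ 1)\<^sup>2)"]
      by (simp add: gs_eq_gsum gsum_def qf_mat2)
  qed
  finally have "of_int (t\<^sup>2) * gs 1 M = of_int t * gs 1 (M * t\<^sup>2)"
    using gsum_congr_dmat[of ?G ?G 4 "l * t\<^sup>2" t "\<chi> i. t"] M t
    by (simp add: even_form_mat2 mat_mult_mat l gs_eq_gsum mult.assoc UNIV_1)
  then show ?thesis using t by (simp add: power2_eq_square)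
qed

text \<open>Replacing \<open>K\<close> by \<open>K t\<^sup>2\<close> leaves the left-hand side unchanged and, as \<open>t\<close> grows, removes
  every error term of the asymptotic formula except the tail \<open>2 / R\<close>.\<close>

lemma gs_normalized_integral_bound:
  fixes K :: nat and R :: real
  assumes K: "K > 0" and R: "R \<ge> 1"
  shows "norm (of_real (1 / sqrt (4 * real K)) * gs 1 (4 * int K) - 4 * integral {0..R} qexp) \<le> 2 / R"
proof (rule field_le_epsilon)
  fix \<epsilon> :: real assume "\<epsilon> > 0"
  define h where "h = 1 / sqrt (4 * real K)"
  have h: "h > 0" using K by (simp add: h_def)
  \<comment> \<open>The first bound makes \<open>gs_asymp\<close> applicable to
    \<open>K t^2\<close>, whose step is \<open>h / t\<close>; the second pushes the terms
    proportional to the step below \<open>\<epsilon>\<close>.\<close>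
  obtain t :: nat where t: "real t > max (4 * R * h) ((8 * h + 32 * pi * R\<^sup>2 * h) / \<epsilon>)"
    using reals_Archimedean2 by blast
  have "4 * R * h > 0" using R h by simp
  then have t0: "t > 0" using t by (intro gr0I) auto
  have e1: "1 / sqrt (4 * real (K * t\<^sup>2)) = h / real t"
    by (simp add: h_def real_sqrt_mult mult.assoc[symmetric])
  have "of_real (h / real t) * gs 1 (4 * int (K * t\<^sup>2)) = of_real h * gs 1 (4 * int K)"
    using gs_scale[of "4 * int K" "int t"] K t0 by (simp add: mult.assoc)
  moreover have "norm (of_real (h / real t) * gs 1 (4 * int (K * t\<^sup>2)) - 4 * integral {0..R} qexp) \<le> 8 * (h / real t) + 32 * pi * R\<^sup>2 * (h / real t) + 2 / R"
  proof (rule gs_asymp)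
    show "4 * R * (h / real t) \<le> 1" using t t0 by (simp add: field_simps)
  qed (use K t0 R e1 in auto)
  ultimately have "norm (of_real h * gs 1 (4 * int K) - 4 * integral {0..R} qexp) \<le> 8 * (h / real t) + 32 * pi * R\<^sup>2 * (h / real t) + 2 / R"
    by (simp only:)
  also have "\<dots> = (8 * h + 32 * pi * R\<^sup>2 * h) / real t + 2 / R" using t0 by (simp add: field_simps)
  also have "(8 * h + 32 * pi * R\<^sup>2 * h) / real t \<le> \<epsilon>"
    using t t0 \<open>\<epsilon> > 0\<close> by (simp add: pos_divide_less_eq pos_divide_le_eq mult.commute)
  finally show "norm (of_real (1 / sqrt (4 * real K)) * gs 1 (4 * int K) - 4 * integral {0..R} qexp) \<le> 2 / R + \<epsilon>"
    unfolding h_def by simp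
qed

lemma e_quarter: "e (1 / 4) = \<i>"
proof -
  have "2 * complex_of_real pi * \<i> * (1 / 4) = \<i> * of_real (pi / 2)" by simp
  then show ?thesis unfolding e_def by (simp only: cis_conv_exp[symmetric] cis_pi_half)
qed

lemma chr_4_1: "chr 4 1 = \<i>"
  using e_quarter by (simp add: chr_def)

lemma gs_1_4: "gs 1 4 = 2 + 2 * \<i>"
proof -
  have "{0..<4 :: int} = {0, 1, 2, 3}" by auto
  moreover have "chr 4 4 = 1" "chr 4 9 = chr 4 1" by (auto intro!: chr_eq_1 chr_cong simp: cong_def)
  ultimately show ?thesis by (simp add: gs_def chr_4_1)
qed

lemma gs_four:
  assumes "M > 0" "4 dvd M"
  shows "gs 1 M = (1 + \<i>) * of_real (sqrt (of_int M))"
proof -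
  obtain l where l: "M = 4 * l" using assms by blast
  define K where "K = nat l"
  have K: "K > 0" "M = 4 * int K" using l assms(1) by (auto simp: K_def)
  define s where "s K = of_real (1 / sqrt (4 * real K)) * gs 1 (4 * int K)" for K
  have "norm (s K - s 1) \<le> \<epsilon>" if "\<epsilon> > 0" for \<epsilon>
  proof -
    define R where "R = max 1 (4 / \<epsilon>)"
    have R: "R \<ge> 1" "4 / \<epsilon> \<le> R" by (simp_all add: R_def)
    have "norm (s K - s 1) = norm ((s K - 4 * integral {0..R} qexp) - (s 1 - 4 * integral {0..R} qexp))"
      by simp
    also have "\<dots> \<le> 2 / R + 2 / R"
      unfolding s_def using K R by (intro order_trans[OF norm_triangle_ineq4 add_mono] gs_normalized_integral_bound) auto
    also have "\<dots> \<le> \<epsilon>" using R \<open>\<epsilon> > 0\<close> by (simp add: field_simps)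
    finally show ?thesis .
  qed
  then have "norm (s K - s 1) \<le> 0" by (rule field_le_epsilon) simp
  then have "s K = s 1" by simp
  also have "s 1 = 1 + \<i>" by (simp add: s_def gs_1_4 field_simps)
  finally show ?thesis using K by (simp add: s_def field_simps)
qed

section \<open>Chinese remainders and changes of variables\<close>

text \<open>In \<open>v = m2 x + m1 y\<close> the mixed term is a multiple of \<open>m1 m2\<close>,
  and \<open>q(m2 x) / (m1 m2) = m2 q(x) / m1\<close>. This produces the twisted numerators.\<close>

lemma gsum_crt:
  fixes G :: "int ^ 'n ^ 'n"
  assumes G: "even_form G" and m: "m1 > 0" "m2 > 0" "coprime m1 m2"
  shows "gsum G b (m1 * m2) = gsum G (b * m2) m1 * gsum G (b * m1) m2"
proof -
  define F where "F v = chr (m1 * m2) (b * qf G v)" for v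
  have "gsum G b (m1 * m2) = (\<Sum>v\<in>rbox (m1 * m2). F v)" by (simp add: gsum_def F_def)
  also have "\<dots> = (\<Sum>(x, y)\<in>rbox m1 \<times> rbox m2. F (m2 *s x + m1 *s y))"
    unfolding case_prod_unfold
  proof (rule sum_complete_residues[symmetric])
    show "card (rbox m1 \<times> rbox m2 :: ((int ^ 'n) \<times> (int ^ 'n)) set) = nat (m1 * m2) ^ CARD('n)"
      using m by (simp add: card_cartesian_product card_rbox nat_mult_distrib power_mult_distrib)
    show "F u = F v" if "vcong (m1 * m2) u v" for u v
      unfolding F_def by (rule chr_qf_cong[OF G that])
    fix a b :: "(int ^ 'n) \<times> (int ^ 'n)"
    assume a: "a \<in> rbox m1 \<times> rbox m2" and b: "b \<in> rbox m1 \<times> rbox m2"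
      and *: "vcong (m1 * m2) (m2 *s fst a + m1 *s snd a) (m2 *s fst b + m1 *s snd b)"
    have dv: "m1 * m2 dvd m2 * (fst a $ i - fst b $ i) + m1 * (snd a $ i - snd b $ i)" for i
      using * by (auto simp: vcong_def algebra_simps)
    have "m1 dvd fst a $ i - fst b $ i" for i
      using dvd_mult_left[OF dv[of i]] m by (simp add: dvd_add_left_iff coprime_dvd_mult_right_iff)
    moreover have "m2 dvd snd a $ i - snd b $ i" for i
      using dvd_mult_right[OF dv[of i]] m by (simp add: dvd_add_right_iff coprime_dvd_mult_right_iff coprime_commute)
    ultimately have "fst a = fst b" "snd a = snd b"
      using a b vcong_rbox_eq[of "fst a" m1 "fst b"] vcong_rbox_eq[of "snd a" m2 "snd b"]
      by (auto simp: vcong_def)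
    then show "a = b" by (simp add: prod_eq_iff)
  qed (use m in auto)
  also have "\<dots> = (\<Sum>(x, y)\<in>rbox m1 \<times> rbox m2. chr m1 (b * m2 * qf G x) * chr m2 (b * m1 * qf G y))"
  proof (intro sum.cong refl, clarify)
    fix x y :: "int ^ 'n"
    have "b * qf G (m2 *s x + m1 *s y) = m2 * (b * m2 * qf G x) + m1 * (b * m1 * qf G y) + m1 * m2 * (b * vdot x (G *v y))"
      using vdot_symmetric[of G x y] G
      by (simp add: qf_add[OF G] qf_scale[OF G] matrix_vector_scale vdot_scale_left vdot_scale_right
          algebra_simps power2_eq_square even_form_def)
    then have "F (m2 *s x + m1 *s y) = chr (m1 * m2) (m2 * (b * m2 * qf G x)) * chr (m1 * m2) (m1 * (b * m1 * qf G y))"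
      by (simp add: F_def chr_add chr_eq_1)
    also have "chr (m1 * m2) (m2 * (b * m2 * qf G x)) = chr m1 (b * m2 * qf G x)"
      using chr_mult_cancel[of m2 m1 "b * m2 * qf G x"] m by (simp add: mult.commute[of m1 m2])
    also have "chr (m1 * m2) (m1 * (b * m1 * qf G y)) = chr m2 (b * m1 * qf G y)"
      using m by (intro chr_mult_cancel) simp
    finally show "F (m2 *s x + m1 *s y) = chr m1 (b * m2 * qf G x) * chr m2 (b * m1 * qf G y)" .
  qed
  also have "\<dots> = gsum G (b * m2) m1 * gsum G (b * m1) m2"
    by (simp add: gsum_def sum_product sum.cartesian_product)
  finally show ?thesis .
qed

lemma gs_crt:
  "m1 > 0 \<Longrightarrow> m2 > 0 \<Longrightarrow> coprime m1 m2 \<Longrightarrow> gs b (m1 * m2) = gs (b * m2) m1 * gs (b * m1) m2"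
  unfolding gs_eq_gsum by (rule gsum_crt[OF even_form_mat2])

lemma gsum_cong: "[b = b'] (mod m) \<Longrightarrow> gsum G b m = gsum G b' m"
  unfolding gsum_def by (intro sum.cong refl chr_cong cong_mult) auto

lemma gs_cong: "[b = b'] (mod m) \<Longrightarrow> gs b m = gs b' m"
  unfolding gs_eq_gsum by (rule gsum_cong)

lemma gsum_uminus: "gsum G (- b) m = cnj (gsum G b m)"
  by (simp add: gsum_def chr_uminus)

text \<open>Injectivity modulo \<open>m\<close> makes \<open>P\<close> a permutation of the
  residues. This covers unimodular \<open>P\<close> as well as diagonal \<open>P\<close> with
  entries prime to \<open>m\<close>.\<close>

lemma gsum_congr_inj:
  fixes G :: "int ^ 'n ^ 'n"
  assumes G: "even_form G" and m: "m > 0"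
    and inj: "\<And>x y. vcong m (P *v x) (P *v y) \<Longrightarrow> vcong m x y"
  shows "gsum (congr P G) b m = gsum G b m"
  unfolding gsum_def qf_congr
  by (rule sum_complete_residues[OF m]) (use m in \<open>auto simp: card_rbox intro: vcong_rbox_eq inj chr_qf_cong[OF G]\<close>)

lemma vcong_matrix:
  assumes "vcong m x y" shows "vcong m (A *v x) (A *v y)"
proof -
  obtain z where "x = y + m *s z" using assms by (auto simp: vcong_iff_scale)
  then have "A *v x = A *v y + m *s (A *v z)"
    by (simp add: matrix_vector_right_distrib matrix_vector_scale)
  then show ?thesis by (auto simp: vcong_iff_scale)
qed

lemma gsum_congr_unimodular:
  assumes G: "even_form G" and m: "m > 0" and P: "Q ** P = mat 1"
  shows "gsum (congr P G) b m = gsum G b m"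
proof (rule gsum_congr_inj[OF G m])
  fix x y assume "vcong m (P *v x) (P *v y)"
  then have "vcong m (Q *v (P *v x)) (Q *v (P *v y))" by (rule vcong_matrix)
  then show "vcong m x y" by (simp add: matrix_vector_mul_assoc P)
qed

lemma gsum_congr_coprime:
  assumes G: "even_form G" and m: "m > 0" and d: "\<And>i. coprime (d $ i) m"
  shows "gsum (congr (dmat d) G) b m = gsum G b m"
proof (rule gsum_congr_inj[OF G m])
  fix x y assume "vcong m (dmat d *v x) (dmat d *v y)"
  then show "vcong m x y"
    using d by (simp add: vcong_def dmat_mult coprime_commute coprime_dvd_mult_right_iff flip: right_diff_distrib)
qed

lemma gs_mult_square:
  assumes "m > 0" "coprime t m"
  shows "gs (b * t\<^sup>2) m = gs b m"
proof -
  have "gsum (congr (dmat (\<chi> i. t)) (mat 2 :: int ^ 1 ^ 1)) b m = gsum (mat 2 :: int ^ 1 ^ 1) (b * t\<^sup>2) m"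
    by (simp add: gsum_def qf_congr qf_mat2 dmat_mult power_mult_distrib mult.assoc)
  then show ?thesis
    using gsum_congr_coprime[OF even_form_mat2, of m "(\<chi> i. t) :: int ^ 1"] assms by (simp add: gs_eq_gsum)
qed

section \<open>Explicit values for odd moduli\<close>

lemma chr_4_odd:
  assumes "odd m" shows "chr 4 m = \<i> \<or> chr 4 m = - \<i>"
proof -
  have "m mod 4 = 1 \<or> m mod 4 = 3" using assms by presburger
  then have "[m = 1] (mod 4) \<or> [m = 3] (mod 4)" by (simp add: cong_def)
  moreover have "chr 4 3 = - \<i>" using chr_power[of 4 1 3] by (simp add: chr_4_1 power3_eq_cube)
  ultimately show ?thesis using chr_cong chr_4_1 by metis
qed

lemma gs_1_odd:
  assumes "m > 0" "odd m"
  shows "gs 1 m = (1 + \<i>) / (1 + chr 4 m) * of_real (sqrt (of_int m))"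
proof -
  have "coprime 4 m" using assms(2) coprime_power_left_iff[of 2 2 m] by simp
  then have "gs 1 (4 * m) = gs m 4 * gs (1 * 2\<^sup>2) m"
    using gs_crt[of 4 m 1] assms by simp
  also have "gs (1 * 2\<^sup>2) m = gs 1 m"
    using assms by (intro gs_mult_square) auto
  also have "gs m 4 = 2 * (1 + chr 4 m)"
  proof -
    have "{0..<4 :: int} = {0, 1, 2, 3}" by auto
    moreover have "chr 4 (m * 4) = 1" "chr 4 (m * 9) = chr 4 m"
      by (auto intro!: chr_eq_1 chr_cong simp: cong_iff_dvd_diff)
    ultimately show ?thesis by (simp add: gs_def algebra_simps)
  qed
  finally have "2 * (1 + chr 4 m) * gs 1 m = (1 + \<i>) * (2 * of_real (sqrt (of_int m)))"
    using assms by (simp add: gs_four real_sqrt_mult)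
  moreover have "g = (1 + \<i>) / z * r" if "2 * z * g = (1 + \<i>) * (2 * r)" "z \<noteq> 0" for g z r :: complex
  proof -
    have "g = 2 * z * g / (2 * z)" using that(2) by simp
    also have "\<dots> = (1 + \<i>) / z * r" unfolding that(1) using that(2) by (simp add: field_simps)
    finally show ?thesis .
  qed
  moreover have "1 + chr 4 m \<noteq> 0" using chr_4_odd[OF assms(2)] by (auto simp: complex_eq_iff)
  ultimately show ?thesis by blast
qed

lemma one_plus_i: "1 + \<i> = of_real (sqrt 2) * e (1 / 8)"
proof -
  have "2 * complex_of_real pi * \<i> * (1 / 8) = \<i> * of_real (pi / 4)" by simp
  then have *: "e (1 / 8) = cis (pi / 4)" unfolding e_def by (simp only: cis_conv_exp)
  show ?thesis unfolding * by (simp add: complex_eq_iff cos_45 sin_45)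
qed

text \<open>The same argument with \<open>8 m\<close>. Numerator 2 is the relevant one: clearing the
  factor 1/2 of the quadratic form modulo an odd number introduces it, and its root of unity is the
  one occurring in \<open>mu\<close>.\<close>

lemma gs_2_odd:
  assumes "m > 0" "odd m"
  shows "gs 2 m = chr 8 (1 - m) * of_real (sqrt (of_int m))"
proof -
  have "coprime 8 m" using assms(2) coprime_power_left_iff[of 2 3 m] by simp
  then have "gs 1 (8 * m) = gs m 8 * gs (2 * 2\<^sup>2) m"
    using gs_crt[of 8 m 1] assms by simp
  also have "gs (2 * 2\<^sup>2) m = gs 2 m"
    using assms by (intro gs_mult_square) auto
  also have "gs m 8 = 4 * chr 8 m"
  proof -
    have "{0..<8 :: int} = {0, 1, 2, 3, 4, 5, 6, 7}" by auto
    moreover have "chr 8 (m * 16) = 1" "chr 8 (m * 9) = chr 8 m" "chr 8 (m * 25) = chr 8 m"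
       "chr 8 (m * 49) = chr 8 m" "chr 8 (m * 36) = chr 8 (m * 4)"
      by (auto intro!: chr_eq_1 chr_cong simp: cong_iff_dvd_diff)
    moreover have "chr 8 (m * 4) = - 1"
    proof -
      have "chr 8 4 = chr 4 2" using chr_mult_cancel[of 2 4 2] by simp
      also have "\<dots> = - 1" using chr_power[of 4 1 2] by (simp add: chr_4_1)
      finally have 1: "chr 8 4 = - 1" .
      obtain l where "m = 2 * l + 1" using assms(2) by (elim oddE)
      then have "[m * 4 = 4] (mod 8)" by (simp add: cong_iff_dvd_diff)
      then show ?thesis using 1 chr_cong by metis
    qed
    ultimately show ?thesis by (simp add: gs_def)
  qed
  finally have "4 * chr 8 m * gs 2 m = of_real (sqrt 2) * e (1 / 8) * of_real (sqrt 8 * sqrt (of_int m))"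
    using assms by (simp add: gs_four real_sqrt_mult one_plus_i)
  also have "\<dots> = 4 * chr 8 1 * of_real (sqrt (of_int m))"
    by (simp add: chr_def) (simp flip: of_real_mult real_sqrt_mult)
  finally have "chr 8 m * gs 2 m = chr 8 m * (chr 8 (1 - m) * of_real (sqrt (of_int m)))"
    using chr_add[of 8 m "1 - m"] by simp
  then show ?thesis by simp
qed

subsection \<open>The Kronecker symbol\<close>

text \<open>In multiset form, multiplicativity in the lower argument becomes additivity of prime
  factorizations.\<close>

lemma kronecker_eq_prod_mset:
  assumes "k > 0"
  shows "kronecker m k = prod_mset (image_mset (kronecker_prime m) (prime_factorization (nat k)))"
proof -
  have "(\<Prod>p\<in>prime_factors (nat k). kronecker_prime m p ^ multiplicity p (nat k)) =
      (\<Prod>p\<in>prime_factors (nat k). kronecker_prime m p ^ count (prime_factorization (nat k)) p)"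
    by (intro prod.cong refl) (simp add: count_prime_factorization_prime in_prime_factors_imp_prime)
  then show ?thesis using assms by (simp add: kronecker_def image_prod_mset_multiplicity)
qed

lemma kronecker_1_right [simp]: "kronecker m 1 = 1"
  by (simp add: kronecker_eq_prod_mset)

lemma kronecker_mult_right:
  "k > 0 \<Longrightarrow> l > 0 \<Longrightarrow> kronecker m (k * l) = kronecker m k * kronecker m l"
  by (simp add: kronecker_eq_prod_mset nat_mult_distrib prime_factorization_mult)

lemma kronecker_prime_power:
  assumes "prime p" shows "kronecker m (int p ^ k) = kronecker_prime m p ^ k"
proof -
  have "kronecker m (int p) = kronecker_prime m p"
    using assms by (simp add: kronecker_eq_prod_mset prime_gt_0_nat prime_factorization_prime)
  then show ?thesis
    using assms by (induction k) (simp_all add: kronecker_mult_right prime_gt_0_nat)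
qed

lemma odd_prime_factor:
  assumes "odd k" "p \<in> prime_factors (nat k)" shows "prime p" "odd p" "int p dvd k"
proof -
  show "prime p" using assms(2) by blast
  have "p dvd nat k" "nat k \<noteq> 0" using assms(2) by auto
  then have "k > 0" by auto
  then show d: "int p dvd k" using \<open>p dvd nat k\<close> by (metis int_dvd_int_iff int_nat_eq less_imp_le)
  then show "odd p" using assms(1) by (meson dvd_trans even_of_nat)
qed

section \<open>Multiplicativity and periodicity in the upper argument\<close>

text \<open>Euler's criterion gives the identity modulo \<open>p\<close>. Both sides lie in
  \<open>{-1, 0, 1}\<close>, so their difference is at most 2 in absolute value, less than
  \<open>p\<close>.\<close>

lemma Legendre_mult:
  assumes "prime p" "odd p"
  shows "Legendre (a * b) (int p) = Legendre a (int p) * Legendre b (int p)"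
proof -
  have p2: "2 < p" using assms prime_ge_2_nat[of p] by (cases "p = 2") auto
  have "[Legendre (a * b) p = (a * b) ^ ((p - 1) div 2)] (mod p)"
    by (rule euler_criterion[OF assms(1) p2])
  also have "[(a * b) ^ ((p - 1) div 2) = Legendre a p * Legendre b p] (mod p)"
    unfolding power_mult_distrib
    by (rule cong_sym, rule cong_mult; rule euler_criterion[OF assms(1) p2])
  finally have "int p dvd Legendre (a * b) p - Legendre a p * Legendre b p"
    by (simp add: cong_iff_dvd_diff)
  moreover have "\<bar>Legendre (a * b) p - Legendre a p * Legendre b p\<bar> \<le> 2"
    by (auto simp: Legendre_def)
  ultimately have "Legendre (a * b) p - Legendre a p * Legendre b p = 0"
    using p2 zdvd_imp_le[of "int p" "\<bar>Legendre (a * b) p - Legendre a p * Legendre b p\<bar>"] by fastforce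
  then show ?thesis by simp
qed

lemma Legendre_sq:
  assumes "\<not> p dvd a" shows "(Legendre a p)\<^sup>2 = 1"
  using assms by (simp add: Legendre_def cong_0_iff)

lemma Legendre_cong:
  assumes "[a = b] (mod p)" shows "Legendre a p = Legendre b p"
proof -
  have "[a = 0] (mod p) \<longleftrightarrow> [b = 0] (mod p)" using assms cong_sym cong_trans by blast
  moreover have "QuadRes p a \<longleftrightarrow> QuadRes p b" unfolding QuadRes_def using assms cong_sym cong_trans by blast
  ultimately show ?thesis by (simp add: Legendre_def)
qed

lemma kronecker_mult_left:
  assumes "k > 0" "odd k"
  shows "kronecker (a * b) k = kronecker a k * kronecker b k"
proof -
  have "(\<Prod>p\<in>prime_factors (nat k). kronecker_prime (a * b) p ^ multiplicity p (nat k)) =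
     (\<Prod>p\<in>prime_factors (nat k). kronecker_prime a p ^ multiplicity p (nat k) * kronecker_prime b p ^ multiplicity p (nat k))"
  proof (rule prod.cong[OF refl])
    fix p assume p: "p \<in> prime_factors (nat k)"
    have "p \<noteq> 2" using odd_prime_factor(2)[OF assms(2) p] by auto
    then show "kronecker_prime (a * b) p ^ multiplicity p (nat k) =
        kronecker_prime a p ^ multiplicity p (nat k) * kronecker_prime b p ^ multiplicity p (nat k)"
      using Legendre_mult[OF odd_prime_factor(1,2)[OF assms(2) p]]
      by (simp add: kronecker_prime_def power_mult_distrib)
  qed
  then show ?thesis using assms(1) by (simp add: kronecker_def prod.distrib)
qed

text \<open>Congruence is required modulo each prime divisor of \<open>k\<close> only. In the
  application \<open>k = det G\<close>, whose primes divide \<open>c\<close>, whereas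
  \<open>det G\<close> itself is only known to divide a power of \<open>N\<close>.\<close>

lemma kronecker_cong:
  assumes "k > 0" "odd k" "\<And>p. prime p \<Longrightarrow> int p dvd k \<Longrightarrow> [a = b] (mod int p)"
  shows "kronecker a k = kronecker b k"
proof -
  have "(\<Prod>p\<in>prime_factors (nat k). kronecker_prime a p ^ multiplicity p (nat k)) =
     (\<Prod>p\<in>prime_factors (nat k). kronecker_prime b p ^ multiplicity p (nat k))"
  proof (rule prod.cong[OF refl])
    fix p assume p: "p \<in> prime_factors (nat k)"
    have "Legendre a (int p) = Legendre b (int p)"
      using odd_prime_factor[OF assms(2) p] by (intro Legendre_cong assms(3)) auto
    moreover have "p \<noteq> 2" using odd_prime_factor(2)[OF assms(2) p] by auto
    ultimately show "kronecker_prime a p ^ multiplicity p (nat k) = kronecker_prime b p ^ multiplicity p (nat k)"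
      by (simp add: kronecker_prime_def)
  qed
  then show ?thesis using assms(1) by (simp add: kronecker_def)
qed

lemma kronecker_sq:
  assumes "k > 0" "odd k" "coprime a k"
  shows "(kronecker a k)\<^sup>2 = 1"
proof -
  have "(\<Prod>p\<in>prime_factors (nat k). (kronecker_prime a p)\<^sup>2 ^ multiplicity p (nat k)) = 1"
  proof (rule prod.neutral, rule ballI)
    fix p assume p: "p \<in> prime_factors (nat k)"
    note q = odd_prime_factor[OF assms(2) p]
    have "\<not> int p dvd a"
      using q coprime_common_divisor[OF assms(3), of "int p"] by auto
    then have "(kronecker_prime a p)\<^sup>2 = 1" using q by (auto simp: kronecker_prime_def Legendre_sq)
    then show "(kronecker_prime a p)\<^sup>2 ^ multiplicity p (nat k) = 1" by simp
  qed
  then show ?thesis using assms(1)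
    by (simp add: kronecker_def prod_power_distrib power_mult[symmetric] mult.commute)
qed

lemma kronecker_1_left: "k > 0 \<Longrightarrow> odd k \<Longrightarrow> kronecker 1 k = 1"
  using kronecker_mult_left[of k 1 1] kronecker_sq[of k 1] by (auto simp: power2_eq_square)

section \<open>Dependence of odd Gauss sums on the numerator\<close>

text \<open>The cases record that the factors divide \<open>m\<close>, so that coprimality of
  \<open>det G\<close> with \<open>m\<close> is inherited in \<open>gsum_odd\<close>.\<close>

lemma odd_prime_power_induct [consumes 2, case_names one prime_power mult]:
  fixes m :: int
  assumes "m > 0" "odd m" and one: "P 1"
    and prime_power: "\<And>p k. prime p \<Longrightarrow> odd p \<Longrightarrow> int p ^ k dvd m \<Longrightarrow> P (int p ^ k)"
    and mult: "\<And>a b. a > 0 \<Longrightarrow> b > 0 \<Longrightarrow> odd a \<Longrightarrow> odd b \<Longrightarrow> a * b dvd m \<Longrightarrow> coprime a b \<Longrightarrow> P a \<Longrightarrow> P b \<Longrightarrow> P (a * b)"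
  shows "P m"
proof -
  have "P (int n)" if "n > 0" "odd n" "int n dvd m" for n
    using that
  proof (induction n rule: less_induct)
    case (less n)
    show ?case
    proof (cases "n = 1")
      case False
      then obtain p where p: "prime p" "p dvd n" using prime_factor_nat by blast
      obtain n' where n': "n = p ^ multiplicity p n * n'" "\<not> p dvd n'"
        using multiplicity_decompose'[of n p] less.prems p by (metis gr_implies_not0 not_prime_unit)
      define k where "k = multiplicity p n"
      have n: "n = p ^ k * n'" using n'(1) by (simp add: k_def)
      have k: "k > 0" using p less.prems(1) by (simp add: k_def prime_multiplicity_gt_zero_iff)
      have pos: "n' > 0" "p ^ k > 1"
        using n less.prems(1) one_less_power[OF prime_gt_1_nat[OF p(1)] k] by auto
      have op: "odd p" "odd n'" using p less.prems(2) n by (auto elim: dvd_trans)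
      have dv: "int p ^ k * int n' dvd m" using less.prems(3) n by simp
      have "n' < n" using pos n by simp
      then have "P (int n')" using pos op dv by (intro less.IH) (auto dest: dvd_mult_right)
      moreover have "P (int p ^ k)" using p op dv by (intro prime_power) (auto dest: dvd_mult_left)
      moreover have "coprime (int p ^ k) (int n')"
        using p n'(2) by (simp add: prime_imp_coprime)
      ultimately have "P (int p ^ k * int n')"
        using pos op dv p by (intro mult) (auto simp: prime_gt_0_nat)
      then show ?thesis using n by simp
    qed (use one in simp)
  qed
  from this[of "nat m"] show ?thesis using assms(1,2) by (simp add: even_nat_iff)
qed

text \<open>Splitting \<open>x = y + p m z\<close>, the square is linear in \<open>z\<close> modulo
  \<open>p^2 m\<close>. The sum over \<open>z\<close> is a character sum modulo \<open>p\<close> and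
  vanishes unless \<open>p\<close> divides \<open>2 b y\<close>, hence \<open>y\<close>; the
  surviving \<open>y = p z\<close> give the sum modulo \<open>m\<close>.\<close>

lemma gs_square_step:
  assumes p: "p > 0" and m: "m > 0" and cop: "coprime (2 * b) p"
  shows "gs b (p\<^sup>2 * m) = of_int p * gs b m"
proof -
  define q where "q = p * m"
  have q: "q > 0" "p * q = p\<^sup>2 * m" using p m by (simp_all add: q_def power2_eq_square)
  have "gs b (p\<^sup>2 * m) = (\<Sum>(y, z)\<in>{0..<q} \<times> {0..<p}. chr (p\<^sup>2 * m) (b * (y + q * z)\<^sup>2))"
    unfolding gs_def
  proof (rule sum.reindex_bij_witness[of _ "\<lambda>(y, z). y + q * z" "\<lambda>x. (x mod q, x div q)"])
    fix x assume x: "x \<in> {0..<p\<^sup>2 * m}"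
    have "x div q * q \<le> x" using div_mult_mod_eq[of x q] pos_mod_sign[OF q(1), of x] by linarith
    then have "x div q * q < p * q" using x q(2) by simp
    then have "x div q < p" "0 \<le> x div q" using x q(1) by (simp_all add: pos_imp_zdiv_nonneg_iff)
    then show "(x mod q, x div q) \<in> {0..<q} \<times> {0..<p}" using q by simp
  next
    fix a assume a: "a \<in> {0..<q} \<times> {0..<p}"
    obtain y z where yz: "a = (y, z)" "0 \<le> y" "y < q" "0 \<le> z" "z \<le> p - 1" using a by (cases a) auto
    have "q * z \<le> q * (p - 1)" using yz q by (intro mult_left_mono) auto
    then have "y + q * z < p\<^sup>2 * m" using yz unfolding q(2)[symmetric] by (simp add: algebra_simps)
    then show "(case a of (y, z) \<Rightarrow> y + q * z) \<in> {0..<p\<^sup>2 * m}" using yz q by simp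
  qed (use q in \<open>auto simp: div_add1_eq\<close>)
  also have "\<dots> = (\<Sum>y\<in>{0..<q}. \<Sum>z\<in>{0..<p}. chr (p\<^sup>2 * m) (b * y\<^sup>2) * chr p (2 * b * y * z))"
    unfolding sum.cartesian_product
  proof (intro sum.cong refl, clarify)
    fix y z
    have "b * (y + q * z)\<^sup>2 = b * y\<^sup>2 + (p * m) * (2 * b * y * z) + (p\<^sup>2 * m) * (b * m * z\<^sup>2)"
      by (simp add: q_def power2_eq_square algebra_simps)
    moreover have "chr (p\<^sup>2 * m) ((p * m) * (2 * b * y * z)) = chr p (2 * b * y * z)"
      using chr_mult_cancel[of "p * m" p "2 * b * y * z"] p m by (simp add: power2_eq_square mult_ac)
    ultimately show "chr (p\<^sup>2 * m) (b * (y + q * z)\<^sup>2) = chr (p\<^sup>2 * m) (b * y\<^sup>2) * chr p (2 * b * y * z)"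
      by (simp add: chr_add chr_eq_1)
  qed
  also have "\<dots> = (\<Sum>y\<in>{0..<q}. if p dvd y then of_int p * chr (p\<^sup>2 * m) (b * y\<^sup>2) else 0)"
    using p cop by (intro sum.cong refl)
      (simp add: sum_distrib_left[symmetric] sum_chr coprime_commute coprime_dvd_mult_right_iff)
  also have "\<dots> = (\<Sum>y\<in>{y\<in>{0..<q}. p dvd y}. of_int p * chr (p\<^sup>2 * m) (b * y\<^sup>2))"
    by (simp add: sum.If_cases Int_def)
  also have "\<dots> = (\<Sum>y\<in>{0..<m}. of_int p * chr m (b * y\<^sup>2))"
  proof (rule sum.reindex_bij_witness[of _ "\<lambda>y. p * y" "\<lambda>y. y div p"])
    fix y assume "y \<in> {y\<in>{0..<q}. p dvd y}"
    then obtain z where z: "y = p * z" "0 \<le> p * z" "p * z < p * m" by (auto simp: q_def)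
    then show "p * (y div p) = y" "y div p \<in> {0..<m}" using p by (simp_all add: zero_le_mult_iff)
    have eq: "b * y\<^sup>2 = p\<^sup>2 * (b * z\<^sup>2)" by (simp add: z power2_eq_square)
    have "chr (p\<^sup>2 * m) (b * y\<^sup>2) = chr m (b * z\<^sup>2)"
      unfolding eq using p by (intro chr_mult_cancel) simp
    moreover have "y div p = z" using z p by simp
    ultimately show "of_int p * chr m (b * (y div p)\<^sup>2) = of_int p * chr (p\<^sup>2 * m) (b * y\<^sup>2)"
      by (simp only:)
  qed (use p in \<open>auto simp: q_def\<close>)
  finally show ?thesis by (simp add: gs_def sum_distrib_left)
qed

lemma gs_prime_half:
  assumes p: "p = 2 * h + 1" "h > 0"
  shows "gs b p = 1 + 2 * (\<Sum>x\<in>{1..h}. chr p (b * x\<^sup>2))"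
proof -
  have "{0..<p} = insert 0 ({1..h} \<union> {h + 1..2 * h})" using p by auto
  then have "gs b p = 1 + ((\<Sum>x\<in>{1..h}. chr p (b * x\<^sup>2)) + (\<Sum>x\<in>{h + 1..2 * h}. chr p (b * x\<^sup>2)))"
    unfolding gs_def using p by (simp add: sum.union_disjoint)
  also have "(\<Sum>x\<in>{h + 1..2 * h}. chr p (b * x\<^sup>2)) = (\<Sum>x\<in>{1..h}. chr p (b * x\<^sup>2))"
  proof (rule sum.reindex_bij_witness[of _ "\<lambda>x. p - x" "\<lambda>x. p - x"])
    fix x
    have "[b * (p - x)\<^sup>2 = b * x\<^sup>2] (mod p)"
      by (simp add: cong_iff_dvd_diff power2_eq_square algebra_simps)
    then show "chr p (b * (p - x)\<^sup>2) = chr p (b * x\<^sup>2)" by (rule chr_cong)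
  qed (use p in auto)
  finally show ?thesis by simp
qed

text \<open>The numbers \<open>x\<^sup>2\<close> and \<open>b x\<^sup>2\<close> with \<open>1 \<le> x \<le> (p - 1) / 2\<close> together run exactly once through the
  nonzero residues modulo \<open>p\<close>.\<close>

lemma gs_nonresidue:
  assumes p: "prime p" "odd p" and b: "\<not> int p dvd b" "\<not> QuadRes (int p) b"
  shows "gs b (int p) = - gs 1 (int p)"
proof -
  define q h where "q = int p" and "h = int (p div 2)"
  have pq: "prime q" using p by (simp add: q_def)
  have "int p = int (2 * (p div 2) + 1)" using p(2) by simp
  then have q: "q = 2 * h + 1" unfolding q_def h_def by linarith
  have h: "h > 0" using q prime_gt_1_int[OF pq] by linarith
  define g where "g = (\<lambda>(x, c). c * x\<^sup>2 mod q)"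
  have cop: "\<not> q dvd x" if "x \<in> {1..h}" for x
    using that q zdvd_not_zless[of x q] by auto
  have same: "x = y" if "x \<in> {1..h}" "y \<in> {1..h}" "q dvd x\<^sup>2 - y\<^sup>2" for x y
  proof -
    have "q dvd (x - y) * (x + y)" using that(3) by (simp add: power2_eq_square algebra_simps)
    then have "q dvd x - y \<or> q dvd x + y" using pq by (simp add: prime_dvd_mult_iff)
    moreover have "\<not> q dvd x + y" using that q zdvd_not_zless[of "x + y" q] by auto
    ultimately have "x mod q = y mod q" by (simp add: mod_eq_dvd_iff)
    then show ?thesis using that q by simp
  qed
  have cross: False if "x \<in> {1..h}" "y \<in> {1..h}" "q dvd b * y\<^sup>2 - x\<^sup>2" for x y
  proof -
    have "coprime y q" using cop[OF that(2)] pq by (metis coprime_commute prime_imp_coprime)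
    then obtain z where z: "[y * z = 1] (mod q)" using cong_solve_coprime_int by blast
    have "[(x * z)\<^sup>2 = x\<^sup>2 * z\<^sup>2] (mod q)" by (simp add: power_mult_distrib)
    also have "[x\<^sup>2 * z\<^sup>2 = b * y\<^sup>2 * z\<^sup>2] (mod q)"
      using that(3) by (intro cong_mult cong_refl cong_sym[of "b * y\<^sup>2"]) (simp add: cong_iff_dvd_diff)
    also have "b * y\<^sup>2 * z\<^sup>2 = b * (y * z)\<^sup>2" by (simp add: power_mult_distrib)
    also have "[b * (y * z)\<^sup>2 = b * 1\<^sup>2] (mod q)" by (intro cong_mult cong_refl cong_pow z)
    finally show False using b(2) by (auto simp: QuadRes_def q_def)
  qed
  have inj: "inj_on g ({1..h} \<times> {1, b})"
  proof (rule inj_onI, clarify)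
    fix x c y d assume *: "x \<in> {1..h}" "y \<in> {1..h}" "c \<in> {1, b}" "d \<in> {1, b}" "g (x, c) = g (y, d)"
    have dv: "q dvd c * x\<^sup>2 - d * y\<^sup>2" using *(5) by (simp add: g_def mod_eq_dvd_iff)
    have "q dvd 1 * y\<^sup>2 - b * x\<^sup>2 \<longleftrightarrow> q dvd b * x\<^sup>2 - y\<^sup>2" by (metis dvd_minus_iff minus_diff_eq mult_1)
    then have "c = d" using * dv cross[of x y] cross[of y x] by (auto simp: dvd_diff_commute)
    moreover have "q dvd x\<^sup>2 - y\<^sup>2"
    proof -
      have "q dvd c * (x\<^sup>2 - y\<^sup>2)" using dv \<open>c = d\<close> by (simp add: algebra_simps)
      moreover have "\<not> q dvd c" using *(3) b pq by (auto simp: q_def)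
      ultimately show ?thesis using pq by (simp add: prime_dvd_mult_iff)
    qed
    ultimately show "x = y \<and> c = d" using same * by blast
  qed
  have "QuadRes (int p) 1" unfolding QuadRes_def by (rule exI[of _ 1]) simp
  then have b1: "b \<noteq> 1" using b(2) by auto
  have im: "g ` ({1..h} \<times> {1, b}) = {1..<q}"
  proof (rule card_subset_eq)
    show "g ` ({1..h} \<times> {1, b}) \<subseteq> {1..<q}"
    proof
      fix r assume "r \<in> g ` ({1..h} \<times> {1, b})"
      then obtain x c where x: "x \<in> {1..h}" and c: "c \<in> {1, b}" and r: "r = g (x, c)" by blast
      have "\<not> q dvd c * x\<^sup>2" using cop[OF x] c b pq
        by (auto simp: prime_dvd_mult_iff prime_dvd_power_iff q_def)
      then have "c * x\<^sup>2 mod q \<noteq> 0" by (simp add: mod_eq_0_iff_dvd)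
      moreover have "q > 0" using q h by simp
      then have "0 \<le> c * x\<^sup>2 mod q" "c * x\<^sup>2 mod q < q" by simp_all
      ultimately have "1 \<le> c * x\<^sup>2 mod q" "c * x\<^sup>2 mod q < q" by linarith+
      then show "r \<in> {1..<q}" by (simp only: r g_def prod.case atLeastLessThan_iff simp_thms)
    qed
    show "card (g ` ({1..h} \<times> {1, b})) = card {1..<q}"
      unfolding card_image[OF inj] using b1 q h by (simp add: card_cartesian_product)
  qed simp
  have "- 1 = (\<Sum>r\<in>{1..<q}. chr q r)"
  proof -
    have "{0..<q} = insert 0 {1..<q}" using q h by auto
    moreover have "\<not> is_unit q" using pq by auto
    ultimately have "1 + (\<Sum>r\<in>{1..<q}. chr q r) = 0" using sum_chr[of q 1] q h by simp
    then show ?thesis by (rule minus_unique)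
  qed
  also have "\<dots> = (\<Sum>a\<in>{1..h} \<times> {1, b}. chr q (g a))"
    unfolding im[symmetric] by (rule sum.reindex[OF inj, unfolded o_def])
  also have "\<dots> = (\<Sum>(x, c)\<in>{1..h} \<times> {1, b}. chr q (c * x\<^sup>2))"
  proof (rule sum.cong[OF refl])
    fix a
    show "chr q (g a) = (case a of (x, c) \<Rightarrow> chr q (c * x\<^sup>2))"
      by (cases a, simp only: g_def prod.case, rule chr_cong) (simp add: cong_def)
  qed
  also have "\<dots> = (\<Sum>x\<in>{1..h}. chr q (1 * x\<^sup>2)) + (\<Sum>x\<in>{1..h}. chr q (b * x\<^sup>2))"
    unfolding sum.cartesian_product[symmetric] using b1 by (simp add: sum.distrib)
  finally have "(\<Sum>x\<in>{1..h}. chr q (1 * x\<^sup>2)) + (\<Sum>x\<in>{1..h}. chr q (b * x\<^sup>2)) = - 1" by simp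
  moreover have "gs 1 q + gs b q = 2 + 2 * ((\<Sum>x\<in>{1..h}. chr q (1 * x\<^sup>2)) + (\<Sum>x\<in>{1..h}. chr q (b * x\<^sup>2)))"
    unfolding gs_prime_half[OF q h, of 1] gs_prime_half[OF q h, of b] by (simp only: distrib_left) simp
  ultimately have "gs 1 q + gs b q = 2 + 2 * (- 1)" by (simp only:)
  then have "gs b q + gs 1 q = 0" by (simp add: add.commute)
  then show ?thesis unfolding q_def by (rule eq_neg_iff_add_eq_0[THEN iffD2])
qed

lemma gs_prime:
  assumes p: "prime p" "odd p" and b: "\<not> int p dvd b"
  shows "gs b (int p) = of_int (Legendre b (int p)) * gs 1 (int p)"
proof (cases "QuadRes (int p) b")
  case True
  then obtain y where y: "[y\<^sup>2 = b] (mod int p)" by (auto simp: QuadRes_def)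
  have "\<not> int p dvd y" using y b
    by (metis cong_dvd_iff dvd_power_same dvd_power dvd_trans zero_less_numeral)
  then have "coprime y (int p)" using p by (metis coprime_commute prime_imp_coprime prime_nat_int_transfer)
  then have "gs (1 * y\<^sup>2) (int p) = gs 1 (int p)" using p by (intro gs_mult_square) (simp_all add: prime_gt_0_nat)
  then show ?thesis using True b gs_cong[OF y] by (simp add: Legendre_def cong_0_iff)
next
  case False
  then show ?thesis using gs_nonresidue[OF p b] b by (simp add: Legendre_def cong_0_iff)
qed

text \<open>\<open>gs_square_step\<close> lowers the exponent by two with the same factor
  \<open>p\<close> for the numerators \<open>b\<close> and 1, and the square of the Legendre symbol
  is 1. Only the exponents 0 and 1 remain.\<close>

lemma gs_prime_power:
  assumes p: "prime p" "odd p" and b: "\<not> int p dvd b"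
  shows "gs b (int p ^ k) = of_int (Legendre b (int p) ^ k) * gs 1 (int p ^ k)"
proof (induction k rule: induct_nat_012)
  case 0
  have "{0..<1 :: int} = {0}" by auto
  then show ?case by (simp add: gs_def)
next
  case 1
  then show ?case using gs_prime[OF assms] by simp
next
  case (ge2 k)
  have cop: "coprime (2 * c) (int p)" if "\<not> int p dvd c" for c
  proof -
    have "coprime (int p) c" using p that by (simp add: prime_imp_coprime)
    moreover have "coprime 2 (int p)" using p by simp
    ultimately show ?thesis by (simp add: coprime_commute)
  qed
  have "\<not> int p dvd 1" using p by auto
  then have "gs c (int p ^ Suc (Suc k)) = of_int (int p) * gs c (int p ^ k)" if "c = 1 \<or> c = b" for c
    using gs_square_step[of "int p" "int p ^ k" c] cop[of c] that b p
    by (auto simp: power2_eq_square mult.assoc prime_gt_0_nat)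
  then show ?case using ge2 Legendre_sq[OF b] by (simp add: power2_eq_square mult.assoc[symmetric])
qed

lemma gs_kronecker:
  assumes "m > 0" "odd m" "coprime b m"
  shows "gs b m = of_int (kronecker b m) * gs 1 m"
proof -
  \<comment> \<open>All numerators are treated at once because Chinese remainders replace
    \<open>b\<close> by \<open>b m2\<close> and \<open>b m1\<close>.\<close>
  have "\<forall>b. coprime b m \<longrightarrow> gs b m = of_int (kronecker b m) * gs 1 m"
    using assms(1,2)
  proof (induction rule: odd_prime_power_induct)
    case one
    have "{0..<1 :: int} = {0}" by auto
    then show ?case by (simp add: gs_def)
  next
    case (prime_power p k)
    have "p \<noteq> 2" using prime_power by auto
    show ?case
    proof (intro allI impI)
      fix b assume "coprime b (int p ^ k)"
      show "gs b (int p ^ k) = of_int (kronecker b (int p ^ k)) * gs 1 (int p ^ k)"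
      proof (cases "int p dvd b")
        case True
        then have "k = 0" using \<open>coprime b (int p ^ k)\<close> prime_power(1)
          by (metis coprime_common_divisor dvd_power gr0I not_prime_unit prime_nat_int_transfer)
        moreover have "{0..<1 :: int} = {0}" by auto
        ultimately show ?thesis by (simp add: gs_def)
      next
        case False
        then show ?thesis using gs_prime_power[OF prime_power(1,2) False] prime_power(1) \<open>p \<noteq> 2\<close>
          by (simp add: kronecker_prime_power kronecker_prime_def)
      qed
    qed
  next
    case (mult m1 m2)
    have c: "coprime m1 m2" "coprime m2 m1" using mult by (simp_all add: coprime_commute)
    show ?case
    proof (intro allI impI)
      fix b assume "coprime b (m1 * m2)"
      then have b: "coprime b m1" "coprime b m2" by simp_all
      \<comment> \<open>The mixed symbols of \<open>m1\<close> and \<open>m2\<close> do not depend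
        on \<open>d\<close>. Comparing \<open>d = b\<close> with \<open>d = 1\<close> eliminates
        them without any appeal to reciprocity.\<close>
      have 1: "gs d (m1 * m2) = of_int (kronecker d m1 * kronecker d m2) * (of_int (kronecker m2 m1 * kronecker m1 m2) * gs 1 m1 * gs 1 m2)"
        if "coprime d m1" "coprime d m2" for d
      proof -
        have "gs (d * m2) m1 = of_int (kronecker d m1 * kronecker m2 m1) * gs 1 m1"
          using mult(7)[rule_format, of "d * m2"] that c mult(1,3) by (simp add: kronecker_mult_left)
        moreover have "gs (d * m1) m2 = of_int (kronecker d m2 * kronecker m1 m2) * gs 1 m2"
          using mult(8)[rule_format, of "d * m1"] that c mult(2,4) by (simp add: kronecker_mult_left)
        ultimately show ?thesis using gs_crt[OF mult(1,2,6), of d] by simp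
      qed
      show "gs b (m1 * m2) = of_int (kronecker b (m1 * m2)) * gs 1 (m1 * m2)"
        using 1[OF b] 1[of 1] mult(1-4) by (simp add: kronecker_mult_right kronecker_1_left)
    qed
  qed
  then show ?thesis using assms(3) by blast
qed

lemma gs_uminus: "gs (- b) m = cnj (gs b m)"
  unfolding gs_eq_gsum by (rule gsum_uminus)

section \<open>The symbol at \<open>-1\<close> and quadratic reciprocity\<close>

text \<open>\<open>gs (- 2) m\<close> is both the conjugate of \<open>gs 2 m\<close> and its
  multiple by the symbol of \<open>-1\<close>; the explicit root of unity in \<open>gs_2_odd\<close>
  decides the value.\<close>

lemma kronecker_minus_1:
  assumes "m > 0" "odd m"
  shows "of_int (kronecker (- 1) m) = chr 4 (m - 1)"
proof -
  define r :: complex where "r = of_real (sqrt (of_int m))"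
  have r: "r \<noteq> 0" using assms by (simp add: r_def)
  have "coprime 2 m" "coprime (- 2) m" using assms(2) by simp_all
  then have "gs (- 2) m = of_int (kronecker (- 1) m) * gs 2 m"
    using gs_kronecker[OF assms, of 2] gs_kronecker[OF assms, of "- 2"]
      kronecker_mult_left[OF assms, of "- 1" 2] by simp
  moreover have "gs (- 2) m = chr 8 (m - 1) * r"
    using gs_uminus[of 2 m] gs_2_odd[OF assms] chr_uminus[of 8 "1 - m"] by (simp add: r_def)
  ultimately have "chr 8 (m - 1) = of_int (kronecker (- 1) m) * chr 8 (1 - m)"
    using gs_2_odd[OF assms] r by (simp add: r_def)
  then have "chr 8 (m - 1) * chr 8 (m - 1) = of_int (kronecker (- 1) m) * (chr 8 (1 - m) * chr 8 (m - 1))"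
    by simp
  also have "chr 8 (1 - m) * chr 8 (m - 1) = 1" using chr_add[of 8 "1 - m" "m - 1"] by simp
  also have "chr 8 (m - 1) * chr 8 (m - 1) = chr 4 (m - 1)"
    using chr_add[of 8 "m - 1" "m - 1"] chr_mult_cancel[of 2 4 "m - 1"] by simp
  finally show ?thesis by simp
qed

lemma gs_1_odd_nonzero:
  assumes "m > 0" "odd m" shows "gs 1 m \<noteq> 0"
proof -
  have "1 + \<i> \<noteq> 0" "1 + chr 4 m \<noteq> 0" using chr_4_odd[OF assms(2)] by (auto simp: complex_eq_iff)
  then show ?thesis using assms by (simp add: gs_1_odd)
qed

text \<open>Chinese remainders express \<open>gs 1 (D b)\<close> with both symbols. For
  \<open>b = 1 (mod 4)\<close> one has \<open>i^(D b) = i^D\<close> and \<open>i^b = i\<close>, so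
  the explicit formula is multiplicative and the product of the symbols is 1.\<close>

lemma kronecker_reciprocity:
  assumes b: "b > 0" "b mod 4 = 1" and D: "D > 0" "odd D" and cop: "coprime b D"
  shows "kronecker D b = kronecker b D"
proof -
  have ob: "odd b" using b(2) by presburger
  have c1: "chr 4 b = \<i>" using chr_cong[of b 1 4] b(2) by (simp add: cong_def chr_4_1)
  have "4 dvd b - 1" using b(2) by presburger
  then have "4 dvd D * b - D" by (metis dvd_mult mult.right_neutral right_diff_distrib)
  then have c2: "chr 4 (D * b) = chr 4 D" by (intro chr_cong) (simp add: cong_iff_dvd_diff)
  have "gs 1 (D * b) = of_int (kronecker b D) * gs 1 D * (of_int (kronecker D b) * gs 1 b)"
    using gs_crt[OF D(1) b(1), of 1] cop D b ob gs_kronecker[of D b] gs_kronecker[of b D]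
    by (simp add: coprime_commute)
  moreover have "gs 1 (D * b) = gs 1 D * gs 1 b"
  proof -
    have "1 + \<i> \<noteq> 0" by (simp add: complex_eq_iff)
    then show ?thesis
      using gs_1_odd[of "D * b"] gs_1_odd[OF D] gs_1_odd[OF b(1) ob] D b ob
      by (simp add: c1 c2 real_sqrt_mult)
  qed
  moreover have "gs 1 D \<noteq> 0" "gs 1 b \<noteq> 0"
    using D b ob by (simp_all add: gs_1_odd_nonzero)
  ultimately have "of_int (kronecker b D * kronecker D b) = (1 :: complex)"
    by simp
  then have "kronecker b D * kronecker D b = 1" by (metis of_int_eq_1_iff)
  then show ?thesis by (metis abs_mult zmult_eq_1_iff)
qed

subsection \<open>Diagonalization\<close>

text \<open>Positivity on integer vectors is inherited by \<open>congr P G\<close> for every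
  \<open>P\<close> injective on them, so the whole diagonalization stays over the integers.\<close>

definition good_form :: "int ^ 'n ^ 'n \<Rightarrow> bool" where
  "good_form G \<longleftrightarrow> even_form G \<and> (\<forall>z. z \<noteq> 0 \<longrightarrow> qf G z > 0)"

lemma good_form_even: "good_form G \<Longrightarrow> even_form G"
  by (simp add: good_form_def)

lemma good_form_diagonal:
  fixes G :: "int ^ 'n ^ 'n"
  assumes "good_form G" shows "G $ i $ i > 0"
proof -
  have "axis i 1 \<noteq> (0 :: int ^ 'n)" by (simp add: axis_eq_0_iff)
  then have "qf G (axis i 1) > 0" using assms by (auto simp: good_form_def)
  then show ?thesis
    using qf_double[OF good_form_even[OF assms], of "axis i 1"] by (simp add: vdot_axis_axis)
qed

lemma good_form_congr:
  assumes "good_form G" "\<And>z. P *v z = 0 \<Longrightarrow> z = 0" shows "good_form (congr P G)"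
  using assms by (auto simp: good_form_def even_form_congr qf_congr)

lemma good_form_congr_unimodular:
  assumes "good_form G" "Q ** P = mat 1" shows "good_form (congr P G)"
proof (rule good_form_congr[OF assms(1)])
  fix z assume "P *v z = 0"
  then have "Q *v (P *v z) = 0" by simp
  then show "z = 0" by (simp add: matrix_vector_mul_assoc assms(2))
qed

lemma good_form_congr_dmat:
  assumes "good_form G" "\<And>i. d $ i > 0" shows "good_form (congr (dmat d) G)"
proof (rule good_form_congr[OF assms(1)])
  fix z assume "dmat d *v z = 0"
  then have "d $ i * z $ i = 0" for i by (metis dmat_mult zero_index)
  then show "z = 0" using assms(2) by (auto simp: vec_eq_iff less_le)
qed

lemma det_congr: "det (congr P G) = (det P)\<^sup>2 * det G"
  by (simp add: congr_def det_mul power2_eq_square)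

lemma det_congr_unimodular:
  assumes "Q ** P = mat 1" shows "det (congr P G) = det (G :: int ^ 'n ^ 'n)"
proof -
  have "det Q * det P = 1" using assms by (metis det_mul det_I)
  then have "det P = 1 \<or> det P = - 1" by (metis mult.commute zmult_eq_1_iff)
  then show ?thesis by (auto simp: det_congr)
qed

lemma det_congr_dmat: "det (congr (dmat d) G) = (\<Prod>i\<in>UNIV. d $ i)\<^sup>2 * det G"
proof -
  have "det (dmat d) = (\<Prod>i\<in>UNIV. d $ i)"
    by (subst det_diagonal) (auto simp: dmat_def)
  then show ?thesis by (simp add: det_congr)
qed

lemma congr_entry: "congr P G $ i $ j = vdot (P *v axis i 1) (G *v (P *v axis j 1))"
  by (simp add: vdot_axis_axis[symmetric] vdot_congr)

lemma congr_dmat_entry: "congr (dmat d) G $ i $ j = d $ i * d $ j * G $ i $ j"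
proof -
  have "dmat d *v axis k 1 = d $ k *s axis k 1" for k
    by (simp add: vec_eq_iff dmat_mult axis_def)
  then show ?thesis
    by (simp add: congr_entry matrix_vector_scale vdot_scale_left vdot_scale_right vdot_axis_axis)
qed

text \<open>The substitution sending the \<open>k\<close>-th basis vector to itself plus
  \<open>r_k\<close> times the \<open>i\<close>-th one. A single shear clears the whole row
  \<open>i\<close> of a form; for \<open>r_i = 0\<close> it is unimodular.\<close>

definition shear :: "'n \<Rightarrow> int ^ 'n \<Rightarrow> int ^ 'n ^ 'n" where
  "shear i r = (\<chi> a b. (if a = b then 1 else 0) + (if a = i then r $ b else 0))"

lemma shear_mult: "shear i r *v x = x + vdot r x *s axis i 1"
  by (auto simp: vec_eq_iff shear_def matrix_vector_mult_def vdot_def axis_def distrib_right sum.distrib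
      if_distrib[of "\<lambda>x. x * _"] cong: if_cong)

lemma shear_inverse:
  assumes "r $ i = 0" shows "shear i (- r) ** shear i r = mat 1"
proof -
  have "vdot (- r) x = - vdot r x" for x by (simp add: vdot_def sum_negf)
  then have "shear i (- r) *v (shear i r *v x) = x" for x
    using assms
    by (simp add: shear_mult vdot_add_right vdot_scale_right vdot_commute[of _ "axis i 1"] vdot_axis vec_eq_iff)
  then show ?thesis by (simp add: matrix_eq matrix_vector_mul_assoc)
qed

lemma congr_shear_entry:
  "congr (shear i r) G $ k $ l = G $ k $ l + r $ l * G $ k $ i + r $ k * G $ i $ l + r $ k * r $ l * G $ i $ i"
proof -
  have "shear i r *v axis k 1 = axis k 1 + r $ k *s axis i 1" for k
    by (simp add: shear_mult vdot_commute[of r] vdot_axis)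
  then show ?thesis
    by (simp add: congr_entry matrix_vector_right_distrib matrix_vector_scale vdot_add_left vdot_add_right
        vdot_scale_left vdot_scale_right vdot_axis_axis algebra_simps)
qed

lemma even_form_sym: "even_form G \<Longrightarrow> G $ i $ j = G $ j $ i"
  by (metis even_form_def vdot_axis_axis vdot_symmetric)

lemma dvd_det_if_dvd_row:
  fixes A :: "int ^ 'n ^ 'n"
  assumes "\<And>j. p dvd A $ i $ j" shows "p dvd det A"
proof -
  have "det A = (\<Sum>\<pi> | \<pi> permutes UNIV. of_int (sign \<pi>) * (\<Prod>i\<in>UNIV. A $ i $ \<pi> i))"
    by (simp add: det_def)
  also have "p dvd \<dots>"
  proof (rule dvd_sum, rule dvd_mult)
    fix \<pi>
    show "p dvd (\<Prod>i\<in>UNIV. A $ i $ \<pi> i)"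
      by (rule dvd_trans[OF assms dvd_prodI[of UNIV i "\<lambda>i. A $ i $ \<pi> i"]]) simp_all
  qed
  finally show ?thesis .
qed

text \<open>The case \<open>p = 1\<close> is diagonalization over the rationals; for an odd prime \<open>p\<close> all scalings, and
  hence all pivots, must be units modulo \<open>p\<close>. If no diagonal entry is a unit, the shear
  \<open>e\<^sub>i \<mapsto> e\<^sub>i + e\<^sub>j\<close> creates the unit \<open>G\<^sub>i\<^sub>i + 2 G\<^sub>i\<^sub>j + G\<^sub>j\<^sub>j\<close>.\<close>

lemma good_form_diagonal_induct [consumes 3, case_names diagonal unimodular scale]:
  fixes G :: "int ^ 'n ^ 'n" and p :: int
  assumes p: "p = 1 \<or> prime p \<and> odd p"
    and "good_form G" "coprime (det G) p"
    and diagonal: "\<And>G. good_form G \<Longrightarrow> coprime (det G) p \<Longrightarrow> (\<And>i j. i \<noteq> j \<Longrightarrow> G $ i $ j = 0) \<Longrightarrow> \<Phi> G"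
    and unimodular: "\<And>G P Q. good_form G \<Longrightarrow> coprime (det G) p \<Longrightarrow> Q ** P = mat 1 \<Longrightarrow> \<Phi> (congr P G) \<Longrightarrow> \<Phi> G"
    and scale: "\<And>G d. good_form G \<Longrightarrow> coprime (det G) p \<Longrightarrow> (\<And>i. d $ i > 0) \<Longrightarrow> (\<And>i. coprime (d $ i) p) \<Longrightarrow>
      \<Phi> (congr (dmat d) G) \<Longrightarrow> \<Phi> G"
  shows "\<Phi> G"
proof -
  \<comment> \<open>\<open>T\<close> contains the indices not yet split off as orthogonal summands;
    the induction is on its size.\<close>
  have "\<Phi> G" if "good_form G" "coprime (det G) p" "\<And>i j. i \<notin> T \<Longrightarrow> i \<noteq> j \<Longrightarrow> G $ i $ j = 0"
    for T and G :: "int ^ 'n ^ 'n"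
    using that
  proof (induction "card T" arbitrary: T G rule: less_induct)
    case less
    have pivot: "\<Phi> G" if G: "good_form G" "coprime (det G) p" and iso: "\<And>i j. i \<notin> T \<Longrightarrow> i \<noteq> j \<Longrightarrow> G $ i $ j = 0"
      and i: "i \<in> T" "coprime (G $ i $ i) p" for i and G :: "int ^ 'n ^ 'n"
    proof -
      define g where "g = G $ i $ i"
      \<comment> \<open>Elimination without division: scaling the other basis vectors by the pivot
        \<open>g\<close> turns the entries \<open>G_il\<close> into \<open>g G_il\<close> and keeps
        \<open>g\<close> in place, so the shear by \<open>-G_il\<close> clears row
        \<open>i\<close>.\<close>
      define d :: "int ^ 'n" where "d = (\<chi> k. if k = i then 1 else g)"
      define r where "r = (\<chi> l. if l = i then 0 else - G $ i $ l)"
      define G1 where "G1 = congr (dmat d) G"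
      note sym = even_form_sym[OF good_form_even[OF G(1)]]
      have d: "d $ k > 0" "coprime (d $ k) p" for k
        using good_form_diagonal[OF G(1), of i] i(2) by (simp_all add: d_def g_def)
      have inv: "shear i (- r) ** shear i r = mat 1" by (rule shear_inverse) (simp add: r_def)
      have G1: "good_form G1" unfolding G1_def by (rule good_form_congr_dmat[OF G(1) d(1)])
      have "coprime (\<Prod>i\<in>UNIV. d $ i) p" by (rule prod_coprime_left) (rule d)
      then have c1: "coprime (det G1) p" unfolding G1_def det_congr_dmat using G(2) by simp
      have "\<Phi> (congr (shear i r) G1)"
      proof (rule less.hyps)
        show "card (T - {i}) < card T" using i by (intro psubset_card_mono) auto
        show "good_form (congr (shear i r) G1)" by (rule good_form_congr_unimodular[OF G1 inv])
        show "coprime (det (congr (shear i r) G1)) p" using c1 by (simp add: det_congr_unimodular[OF inv])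
        fix k l assume k: "k \<notin> T - {i}" "k \<noteq> l"
        show "congr (shear i r) G1 $ k $ l = 0"
        proof (cases "k = i")
          case True
          then show ?thesis using k by (simp add: congr_shear_entry G1_def congr_dmat_entry r_def d_def g_def)
        next
          case False
          then have "G $ k $ l = 0" "G $ k $ i = 0" "G $ i $ k = 0" using k iso[of k] sym[of i k] by auto
          then show ?thesis using False by (simp add: congr_shear_entry G1_def congr_dmat_entry r_def)
        qed
      qed
      then have "\<Phi> G1" by (rule unimodular[OF G1 c1 inv])
      then show ?thesis unfolding G1_def by (rule scale[OF G d])
    qed
    show "\<Phi> G"
    proof (cases "\<exists>i\<in>T. coprime (G $ i $ i) p")
      case True
      then show ?thesis using pivot[OF less.prems] by blast
    next
      case none: False
      show ?thesis
      proof (cases "T = {}")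
        case True
        then show ?thesis using less.prems by (intro diagonal) auto
      next
        case False
        then obtain i where i: "i \<in> T" by blast
        \<comment> \<open>For \<open>p = 1\<close> every diagonal entry is an admissible pivot, so
          this case arises only for an odd prime.\<close>
        then have pr: "prime p" "odd p" using none p by auto
        have dv: "p dvd G $ j $ j" if "j \<in> T" for j
          using none that pr(1) prime_imp_coprime[of p "G $ j $ j"] by (auto simp: coprime_commute)
        note sym = even_form_sym[OF good_form_even[OF less.prems(1)]]
        obtain j where j: "\<not> p dvd G $ i $ j"
        proof -
          have "\<not> p dvd det G"
            using coprime_common_divisor[OF less.prems(2), of p] pr(1) not_prime_unit[of p] by auto
          then show ?thesis using that dvd_det_if_dvd_row[of p G i] by blast
        qed
        then have ij: "i \<noteq> j" using dv i by auto
        have jT: "j \<in> T"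
        proof (rule ccontr)
          assume "j \<notin> T"
          then have "G $ j $ i = 0" using less.prems(3)[of j i] ij by auto
          then show False using j by (simp add: sym[of i j])
        qed
        define r :: "int ^ 'n" where "r = axis i 1"
        have inv: "shear j (- r) ** shear j r = mat 1" by (rule shear_inverse) (use ij in \<open>simp add: r_def axis_def\<close>)
        have "\<Phi> (congr (shear j r) G)"
        proof (rule pivot[OF _ _ _ i])
          show "good_form (congr (shear j r) G)" by (rule good_form_congr_unimodular[OF less.prems(1) inv])
          show "coprime (det (congr (shear j r) G)) p" using less.prems(2) by (simp add: det_congr_unimodular[OF inv])
          show "congr (shear j r) G $ k $ l = 0" if "k \<notin> T" "k \<noteq> l" for k l
            using that less.prems(3)[of k l] less.prems(3)[of k j] i jT
            by (auto simp: congr_shear_entry r_def axis_def)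
          have "congr (shear j r) G $ i $ i = (G $ i $ i + G $ j $ j) + 2 * G $ i $ j"
            by (simp add: congr_shear_entry r_def axis_def sym[of j i])
          moreover have "p dvd G $ i $ i + G $ j $ j" using dv i jT by simp
          moreover have "\<not> p dvd 2 * G $ i $ j"
            using j pr prime_dvd_mult_iff[of p 2] primes_dvd_imp_eq[of p 2] by auto
          ultimately have "\<not> p dvd congr (shear j r) G $ i $ i" by (simp add: dvd_add_right_iff)
          then show "coprime (congr (shear j r) G $ i $ i) p"
            using pr(1) prime_imp_coprime by (metis coprime_commute)
        qed
        then show ?thesis by (rule unimodular[OF less.prems(1,2) inv])
      qed
    qed
  qed
  then show ?thesis using assms(2,3) by blast
qed

subsection \<open>Evaluation of the complete Gauss sum\<close>

lemma qf_diagonal: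
  assumes "even_form G" "\<And>i j. i \<noteq> j \<Longrightarrow> G $ i $ j = 0"
  shows "qf G x = (\<Sum>i\<in>UNIV. G $ i $ i div 2 * (x $ i)\<^sup>2)"
proof -
  have "x $ i * (G *v x) $ i = 2 * (G $ i $ i div 2 * (x $ i)\<^sup>2)" for i
  proof -
    have "(\<Sum>j\<in>UNIV. G $ i $ j * x $ j) = (\<Sum>j\<in>UNIV. if i = j then G $ i $ i * x $ i else 0)"
      by (rule sum.cong) (auto simp: assms(2))
    then have "(G *v x) $ i = G $ i $ i * x $ i" by (simp add: matrix_vector_mult_def)
    moreover obtain k where "G $ i $ i = 2 * k" using assms(1) by (auto simp: even_form_def elim: evenE)
    ultimately show ?thesis by (simp add: power2_eq_square)
  qed
  then have "vdot x (G *v x) = 2 * (\<Sum>i\<in>UNIV. G $ i $ i div 2 * (x $ i)\<^sup>2)"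
    unfolding vdot_def sum_distrib_left by (intro sum.cong refl)
  then show ?thesis by (simp add: qf_def)
qed

lemma gsum_diagonal:
  assumes "even_form G" "\<And>i j. i \<noteq> j \<Longrightarrow> G $ i $ j = 0"
  shows "gsum G b m = (\<Prod>i\<in>UNIV. gs (b * (G $ i $ i div 2)) m)"
proof -
  have "gsum G b m = (\<Sum>v\<in>rbox m. \<Prod>i\<in>UNIV. chr m (b * (G $ i $ i div 2) * (v $ i)\<^sup>2))"
  proof -
    have "qf G v = (\<Sum>i\<in>UNIV. G $ i $ i div 2 * (v $ i)\<^sup>2)" for v
      by (rule qf_diagonal[OF assms])
    then show ?thesis by (simp add: gsum_def sum_distrib_left chr_sum mult.assoc)
  qed
  then show ?thesis
    by (simp add: gs_def sum_prod_ibox[of "\<lambda>i x. chr m (b * (G $ i $ i div 2) * x\<^sup>2)"])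
qed

lemma gs_mult_modulus:
  assumes "d > 0" "C > 0" shows "gs d (C * d) = of_int d * gs 1 C"
proof -
  have per: "chr C ((u $ 1)\<^sup>2) = chr C ((v $ 1)\<^sup>2)" if "vcong C u v" for u v :: "int ^ 1"
    using chr_qf_cong[OF even_form_mat2 that, of 1] by (simp add: qf_mat2)
  have "gs d (C * d) = (\<Sum>v\<in>(rbox (C * d) :: (int ^ 1) set). chr C ((v $ 1)\<^sup>2))"
    using assms chr_mult_cancel[of d C] by (simp add: gs_eq_gsum gsum_def qf_mat2 mult.commute[of C])
  also have "\<dots> = of_int d * gs 1 C"
    using sum_rbox_mult[of C d "\<lambda>v :: int ^ 1. chr C ((v $ 1)\<^sup>2)", OF _ _ per] assms
    by (simp add: gs_eq_gsum gsum_def qf_mat2)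
  finally show ?thesis .
qed

section \<open>Integral multiples of the inverse matrix\<close>

lemma det_rmat: "det (rmat A) = of_int (det A)"
  by (simp add: det_def)

lemma rmat_mult: "rmat (A ** B) = rmat A ** rmat B"
  by (simp add: vec_eq_iff matrix_matrix_mult_def)

text \<open>Cramer's rule over the reals. The numerators are determinants of integer matrices, so
  they form an integer matrix \<open>B\<close>.\<close>

lemma adjugate_exists:
  fixes G :: "int ^ 'n ^ 'n"
  assumes "det G \<noteq> 0"
  obtains B where "G ** B = mat (det G)"
proof -
  have d: "det (rmat G) \<noteq> 0" using assms by (simp add: det_rmat)
  define M where "M j k = (\<chi> i l. if l = k then axis j 1 $ i else G $ i $ l)" for j k :: 'n
  have "rmat G *v (\<chi> k. of_int (det (M j k)) / of_int (det G)) = axis j 1" for j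
  proof -
    have "rmat (M j k) = (\<chi> i l. if l = k then axis j 1 $ i else rmat G $ i $ l)" for k
      by (simp add: vec_eq_iff M_def axis_def)
    then show ?thesis by (simp add: cramer[OF d] flip: det_rmat)
  qed
  then have *: "(\<Sum>k\<in>UNIV. of_int (G $ i $ k) * (of_int (det (M j k)) / of_int (det G))) = (axis j 1 $ i :: real)" for i j
    by (simp add: matrix_vector_mult_def vec_eq_iff)
  define B where "B = (\<chi> k j. det (M j k))"
  have "(G ** B) $ i $ j = mat (det G) $ i $ j" for i j
  proof -
    have "real_of_int ((G ** B) $ i $ j) = of_int (det G) * (\<Sum>k\<in>UNIV. of_int (G $ i $ k) * (of_int (det (M j k)) / of_int (det G)))"
      using assms by (simp add: matrix_matrix_mult_def B_def sum_distrib_left)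
    also have "\<dots> = of_int (mat (det G) $ i $ j)" unfolding * by (simp add: mat_def axis_def)
    finally show ?thesis by linarith
  qed
  then show ?thesis by (intro that[of B]) (simp add: vec_eq_iff)
qed

lemma symmetric_multiple_inverse:
  fixes G A :: "int ^ 'n ^ 'n"
  assumes G: "transpose G = G" and A: "G ** A = mat N" and N: "N \<noteq> 0"
  shows "transpose A = A"
proof -
  have ms: "(mat k ** X) $ i $ j = k * X $ i $ j" "(X ** mat k) $ i $ j = k * X $ i $ j"
    for k i j and X :: "int ^ 'n ^ 'n"
    by (simp_all add: matrix_matrix_mult_def mat_def if_distrib[of "\<lambda>x. x * _"] if_distrib[of "\<lambda>x. _ * x"]
        mult.commute cong: if_cong)
  have "transpose A ** G = transpose (G ** A)" by (simp add: matrix_transpose_mul G)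
  also have "\<dots> = mat N" by (simp add: A transpose_mat)
  finally have tA: "transpose A ** G = mat N" .
  have "transpose A ** (G ** A) = transpose A ** G ** A" by (simp add: matrix_mul_assoc)
  then have "transpose A ** mat N = mat N ** A" by (simp only: A tA)
  then have "N * transpose A $ i $ j = N * A $ i $ j" for i j by (metis ms)
  then show ?thesis using N by (simp add: vec_eq_iff)
qed

text \<open>Doubling the adjugate makes its diagonal even. The result supplies \<open>B\<close> for
  the intermediate forms of the diagonalization and witnesses that the level exists.\<close>

lemma even_form_multiple_inverse:
  fixes G :: "int ^ 'n ^ 'n"
  assumes G: "even_form G" "det G > 0"
  obtains B N where "even_form B" "N > 0" "G ** B = mat N"
proof -
  obtain A where A: "G ** A = mat (det G)" using adjugate_exists[of G] G(2) by auto
  have sym: "transpose A = A" using symmetric_multiple_inverse[of G A "det G"] A G by (simp add: even_form_def)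
  define B where "B = (\<chi> i j. 2 * A $ i $ j)"
  have "even_form B"
    using sym unfolding transpose_def by (simp add: even_form_def B_def vec_eq_iff transpose_def)
  moreover have "G ** B = mat (2 * det G)"
  proof -
    have "(G ** B) $ i $ j = 2 * (G ** A) $ i $ j" for i j
      by (simp add: B_def matrix_matrix_mult_def sum_distrib_left mult_ac)
    then show ?thesis by (simp add: vec_eq_iff A) (simp add: mat_def)
  qed
  ultimately show ?thesis using G(2) that[of B "2 * det G"] by simp
qed

section \<open>The sum \<open>W(1/c)\<close>\<close>

definition gauss_const :: "int ^ 'n ^ 'n \<Rightarrow> int \<Rightarrow> complex" where
  "gauss_const G c = of_real (sqrt (of_int c) ^ CARD('n) * sqrt (of_int (det G))) * chr 8 (int CARD('n))"

lemma gsum_1_diagonal: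
  fixes G :: "int ^ 'n ^ 'n"
  assumes G: "good_form G" "\<And>i j. i \<noteq> j \<Longrightarrow> G $ i $ j = 0"
    and c: "c > 0" "4 * (\<Prod>i\<in>UNIV. G $ i $ i) dvd c"
  shows "gsum G 1 c = gauss_const G c"
proof -
  note even = good_form_even[OF G(1)]
  have "gs (1 * (G $ i $ i div 2)) c = of_real (sqrt (of_int c) * sqrt (of_int (G $ i $ i))) * chr 8 1" for i
  proof -
    define d where "d = G $ i $ i div 2"
    have Gd: "G $ i $ i = 2 * d" using even by (simp add: d_def even_form_def)
    then have d: "d > 0" using good_form_diagonal[OF G(1), of i] by simp
    have "4 * d dvd 4 * (\<Prod>i\<in>UNIV. G $ i $ i)"
      using Gd by (intro mult_dvd_mono dvd_refl dvd_trans[OF _ dvd_prodI[of UNIV i]]) auto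
    then obtain l where l: "c = 4 * d * l" using c(2) by (meson dvd_trans dvdE)
    then have l0: "l > 0" using c(1) d by (simp add: zero_less_mult_iff)
    have "gs (1 * d) c = of_int d * gs 1 (4 * l)"
      using gs_mult_modulus[of d "4 * l"] d l0 l by (simp add: mult_ac)
    also have "\<dots> = of_int d * (of_real (sqrt 2) * chr 8 1 * of_real (sqrt (of_int (4 * l))))"
      using l0 by (simp add: gs_four one_plus_i chr_def)
    also have "\<dots> = of_real (of_int d * (sqrt 2 * sqrt (of_int (4 * l)))) * chr 8 1" by simp
    also have "of_int d * (sqrt 2 * sqrt (of_int (4 * l))) = sqrt ((of_int d)\<^sup>2) * sqrt (2 * of_int (4 * l))"
    proof -
      have "of_int d = sqrt ((of_int d)\<^sup>2)" using d by simp
      then show ?thesis by (simp only: real_sqrt_mult[symmetric])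
    qed
    also have "\<dots> = sqrt (of_int c) * sqrt (of_int (G $ i $ i))"
      unfolding real_sqrt_mult[symmetric] by (simp add: l Gd power2_eq_square mult_ac)
    finally show ?thesis by (simp add: d_def)
  qed
  then have "gsum G 1 c = (\<Prod>i\<in>(UNIV :: 'n set). of_real (sqrt (of_int c) * sqrt (of_int (G $ i $ i))) * chr 8 1)"
    by (subst gsum_diagonal[OF even]) (use G(2) in \<open>simp_all only:\<close>)
  also have "\<dots> = of_real (\<Prod>i\<in>UNIV. sqrt (of_int c) * sqrt (of_int (G $ i $ i))) * chr 8 1 ^ CARD('n)"
    by (simp add: prod.distrib)
  also have "(\<Prod>i\<in>UNIV. sqrt (of_int c) * sqrt (of_int (G $ i $ i))) = sqrt (of_int c) ^ CARD('n) * sqrt (of_int (\<Prod>i\<in>UNIV. G $ i $ i))"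
  proof -
    have "(\<Prod>i\<in>A. sqrt (of_int (G $ i $ i))) = sqrt (of_int (\<Prod>i\<in>A. G $ i $ i))" for A :: "'n set"
      by (induction A rule: infinite_finite_induct) (simp_all add: real_sqrt_mult)
    then show ?thesis by (simp only: prod.distrib prod_constant)
  qed
  also have "(\<Prod>i\<in>UNIV. G $ i $ i) = det G" using det_diagonal[of G] G(2) by simp
  also have "chr 8 1 ^ CARD('n) = chr 8 (int CARD('n))" using chr_power[of 8 1 "CARD('n)"] by simp
  finally show ?thesis by (simp add: gauss_const_def)
qed

text \<open>Diagonalization with \<open>p = 1\<close>, where coprimality is vacuous. A scaling of
  index \<open>m\<close> multiplies the sum by \<open>m\<close>, provided \<open>c\<close> is
  divisible enough, and also multiplies \<open>sqrt (det G)\<close> by \<open>m\<close>. Positivity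
  of \<open>det G\<close> is carried along, since scalings change the determinant by squares and
  unimodular steps preserve it.\<close>

lemma gsum_1_divisible:
  assumes "good_form G"
  shows "det G > 0 \<and> (\<exists>C0>0. \<forall>c>0. C0 dvd c \<longrightarrow> gsum G 1 c = gauss_const G c)"
proof -
  have p: "(1 :: int) = 1 \<or> prime (1 :: int) \<and> odd (1 :: int)" "coprime (det G) (1 :: int)" by simp_all
  show ?thesis
    using p(1) assms p(2)
  proof (induction rule: good_form_diagonal_induct)
    case (diagonal G)
    have pos: "(\<Prod>i\<in>UNIV. G $ i $ i) > 0"
      by (intro prod_pos) (use good_form_diagonal[OF diagonal(1)] in blast)
    moreover have "det G = (\<Prod>i\<in>UNIV. G $ i $ i)" by (rule det_diagonal) (use diagonal in blast)
    moreover have "\<forall>c>0. 4 * (\<Prod>i\<in>UNIV. G $ i $ i) dvd c \<longrightarrow> gsum G 1 c = gauss_const G c"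
      using gsum_1_diagonal[OF diagonal(1,3)] by blast
    ultimately show ?case by (intro conjI exI[of _ "4 * (\<Prod>i\<in>UNIV. G $ i $ i)"]) simp_all
  next
    case (unimodular G P Q)
    have "det (congr P G) = det G" by (rule det_congr_unimodular[OF unimodular(3)])
    moreover have "gsum (congr P G) 1 c = gsum G 1 c" if "c > 0" for c
      by (rule gsum_congr_unimodular[OF good_form_even[OF unimodular(1)] that unimodular(3)])
    ultimately show ?case using unimodular(4) by (simp add: gauss_const_def cong: conj_cong)
  next
    case (scale G d)
    define m where "m = (\<Prod>i\<in>UNIV. d $ i)"
    have m: "m > 0" unfolding m_def by (intro prod_pos) (use scale(3) in blast)
    have det: "det (congr (dmat d) G) = m\<^sup>2 * det G" by (simp add: det_congr_dmat m_def)
    then have pos: "det G > 0" using scale(5) m by (simp add: zero_less_mult_iff)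
    note even = good_form_even[OF scale(1)]
    obtain B N where B: "even_form B" "N > 0" "G ** B = mat N"
      by (rule even_form_multiple_inverse[OF even pos])
    obtain C0 where C0: "C0 > 0" "\<And>c. c > 0 \<Longrightarrow> C0 dvd c \<Longrightarrow> gsum (congr (dmat d) G) 1 c = gauss_const (congr (dmat d) G) c"
      using scale(5) by blast
    \<comment> \<open>The factor \<open>C0\<close> serves the induction hypothesis for the scaled
      form, and \<open>N m^2\<close> serves \<open>gsum_congr_dmat\<close>.\<close>
    have "gsum G 1 c = gauss_const G c" if c: "c > 0" "C0 * (N * m\<^sup>2) dvd c" for c
    proof -
      have "N * m\<^sup>2 dvd c" using c(2) by (rule dvd_mult_right)
      then obtain l where l: "c = N * (m\<^sup>2 * l)" by (metis dvdE mult.assoc)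
      have "m\<^sup>2 * l > 0" using c(1) B(2) l by (simp add: zero_less_mult_iff)
      moreover have "d $ i dvd m" for i unfolding m_def by (rule dvd_prodI) auto
      ultimately have "gsum (congr (dmat d) G) 1 c = of_int m * gsum G 1 c"
        unfolding l using gsum_congr_dmat[OF even B(1,3,2), of "m\<^sup>2 * l" m d] scale(3)
        by (simp only: m_def[symmetric]) simp
      moreover have "gsum (congr (dmat d) G) 1 c = gauss_const (congr (dmat d) G) c"
        using C0(2)[OF c(1)] c(2) by (blast intro: dvd_mult_left)
      moreover have "gauss_const (congr (dmat d) G) c = of_int m * gauss_const G c"
        using m by (simp add: gauss_const_def det real_sqrt_mult)
      ultimately show ?thesis using m by simp
    qed
    moreover have "C0 * (N * m\<^sup>2) > 0" using C0 B m by simp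
    ultimately show ?case using pos by blast
  qed
qed

text \<open>Descent to all multiples of \<open>N\<close>. Modulo \<open>c t^2\<close>, restriction
  to \<open>t Z^n\<close> multiplies the known sum \<open>W(1/(c t^2))\<close> by
  \<open>t^n\<close>. The restricted summand has period \<open>c\<close>, so the same sum is
  \<open>t^(2n) W(1/c)\<close>.\<close>

lemma gsum_1:
  fixes G B :: "int ^ 'n ^ 'n"
  assumes G: "good_form G" and B: "even_form B" "G ** B = mat N" "N > 0" and c: "c > 0" "N dvd c"
  shows "gsum G 1 c = gauss_const G c"
proof -
  note even = good_form_even[OF G]
  obtain t where t: "t > 0" "\<And>c. c > 0 \<Longrightarrow> t dvd c \<Longrightarrow> gsum G 1 c = gauss_const G c"
    using gsum_1_divisible[OF G] by blast
  obtain l where l: "c = N * l" using c(2) by blast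
  have l0: "l > 0" using c(1) B(3) l by (simp add: zero_less_mult_iff)
  define d :: "int ^ 'n" where "d = (\<chi> i. t)"
  have "gsum (congr (dmat d) G) 1 (N * (l * t\<^sup>2)) = of_int (\<Prod>i\<in>UNIV. d $ i) * gsum G 1 (N * (l * t\<^sup>2))"
    by (rule gsum_congr_dmat[OF even B(1,2,3), of _ t]) (use l0 t in \<open>auto simp: d_def\<close>)
  also have "N * (l * t\<^sup>2) = c * t\<^sup>2" by (simp add: l)
  also have "gsum G 1 (c * t\<^sup>2) = gauss_const G (c * t\<^sup>2)" using t c by (intro t(2)) (auto simp: power2_eq_square)
  also have "\<dots> = of_int t ^ CARD('n) * gauss_const G c"
    using t by (simp add: gauss_const_def real_sqrt_mult power_mult_distrib)
  also have "gsum (congr (dmat d) G) 1 (c * t\<^sup>2) = (\<Sum>v\<in>rbox (c * t\<^sup>2). chr c (1 * qf G v))"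
  proof -
    have "dmat d *v v = t *s v" for v by (simp add: vec_eq_iff dmat_mult d_def)
    then show ?thesis
      unfolding gsum_def qf_congr using t
      by (intro sum.cong refl) (simp add: qf_scale[OF even] chr_mult_cancel mult.commute[of c])
  qed
  also have "\<dots> = of_int (t\<^sup>2) ^ CARD('n) * gsum G 1 c"
    unfolding gsum_def using t c by (intro sum_rbox_mult chr_qf_cong[OF even]) auto
  finally have "of_int t ^ CARD('n) * (of_int t ^ CARD('n) * gsum G 1 c) = of_int t ^ CARD('n) * (of_int t ^ CARD('n) * gauss_const G c)"
    by (simp add: d_def power2_eq_square power_mult_distrib mult.assoc)
  then show ?thesis using t by simp
qed

section \<open>Odd moduli prime to the determinant\<close>

lemma kronecker_prod_left:
  "k > 0 \<Longrightarrow> odd k \<Longrightarrow> kronecker (\<Prod>i\<in>A. f i) k = (\<Prod>i\<in>A. kronecker (f i) k)"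
  by (induction A rule: infinite_finite_induct) (simp_all add: kronecker_1_left kronecker_mult_left)

text \<open>Both sides survive the diagonalization steps: scalings prime to \<open>p\<close> permute
  the residues and change the determinant by a square prime to \<open>p\<close>.\<close>

lemma gsum_odd_prime_power:
  fixes G :: "int ^ 'n ^ 'n"
  assumes p: "prime p" "odd p" and G: "good_form G" "coprime (det G) p" and b: "coprime b p"
  shows "gsum G b (p ^ k) = of_int (kronecker (det G) (p ^ k)) * gs (2 * b) (p ^ k) ^ CARD('n)"
proof -
  define m where "m = p ^ k"
  have m: "m > 0" "odd m" using p by (simp_all add: m_def prime_gt_0_int)
  have cm: "coprime x m" if "coprime x p" for x using that by (simp add: m_def)
  have "p = 1 \<or> prime p \<and> odd p" using p by simp
  then have "gsum G b m = of_int (kronecker (det G) m) * gs (2 * b) m ^ CARD('n)"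
    using G
  proof (induction rule: good_form_diagonal_induct)
    case (diagonal G)
    note even = good_form_even[OF diagonal(1)]
    have det: "det G = (\<Prod>i\<in>UNIV. G $ i $ i)" by (rule det_diagonal) (use diagonal in blast)
    have "gs (b * (G $ i $ i div 2)) m = of_int (kronecker (G $ i $ i) m) * gs (2 * b) m" for i
    proof -
      have "G $ i $ i dvd det G" unfolding det by (rule dvd_prodI) auto
      then have cG: "coprime (G $ i $ i) m" by (intro cm coprime_divisors[OF _ dvd_refl diagonal(2)])
      have c2: "coprime 2 m" using m by simp
      have c2b: "coprime (2 * b) m" using c2 cm[OF b] by simp
      \<comment> \<open>The square factor 4 permutes residues modulo odd \<open>m\<close> and undoes
        the division by 2; this is the source of the numerator \<open>2 b\<close>.\<close>
      have "gs (b * (G $ i $ i div 2)) m = gs (b * (G $ i $ i div 2) * 2\<^sup>2) m"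
        by (rule gs_mult_square[symmetric]) (use m in auto)
      also have "b * (G $ i $ i div 2) * 2\<^sup>2 = G $ i $ i * (2 * b)"
        using even by (simp add: even_form_def)
      also have "gs \<dots> m = of_int (kronecker (G $ i $ i * (2 * b)) m) * gs 1 m"
        by (rule gs_kronecker) (use m cG c2b in auto)
      also have "\<dots> = of_int (kronecker (G $ i $ i) m) * gs (2 * b) m"
        using gs_kronecker[OF m c2b] m by (simp add: kronecker_mult_left)
      finally show ?thesis .
    qed
    moreover have "gsum G b m = (\<Prod>i\<in>UNIV. gs (b * (G $ i $ i div 2)) m)"
      by (rule gsum_diagonal[OF even]) (use diagonal(3) in blast)
    ultimately show ?case
      unfolding det by (simp add: kronecker_prod_left m prod.distrib)
  next
    case (unimodular G P Q)
    then show ?case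
      using gsum_congr_unimodular[OF good_form_even[OF unimodular(1)] m(1) unimodular(3)]
      by (simp add: det_congr_unimodular[OF unimodular(3)])
  next
    case (scale G d)
    define D where "D = (\<Prod>i\<in>UNIV. d $ i)"
    have "coprime D m" unfolding D_def by (intro cm prod_coprime_left scale)
    then have "kronecker (D\<^sup>2 * det G) m = kronecker (det G) m"
      using kronecker_sq[OF m] by (simp add: kronecker_mult_left m power2_eq_square)
    moreover have "gsum (congr (dmat d) G) b m = gsum G b m"
      by (rule gsum_congr_coprime[OF good_form_even[OF scale(1)] m(1)]) (rule cm[OF scale(4)])
    ultimately show ?case using scale(5) by (simp add: det_congr_dmat D_def)
  qed
  then show ?thesis by (simp add: m_def)
qed

lemma gsum_odd:
  fixes G :: "int ^ 'n ^ 'n"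
  assumes m: "m > 0" "odd m" and G: "good_form G" "coprime (det G) m" and b: "coprime b m"
  shows "gsum G b m = of_int (kronecker (det G) m) * gs (2 * b) m ^ CARD('n)"
proof -
  have m1: "gsum G b 1 = of_int (kronecker (det G) 1) * gs (2 * b) 1 ^ CARD('n)" for b
  proof -
    have "{0..<1 :: int} = {0}" by auto
    moreover have "card (rbox 1 :: (int ^ 'n) set) = 1" by (simp add: card_rbox)
    ultimately show ?thesis by (simp add: gs_def gsum_def chr_eq_1)
  qed
  have "\<forall>b. coprime b m \<longrightarrow> gsum G b m = of_int (kronecker (det G) m) * gs (2 * b) m ^ CARD('n)"
    using m
  proof (induction rule: odd_prime_power_induct)
    case one
    then show ?case using m1 by blast
  next
    case (prime_power p k)
    show ?case
    proof (cases "k = 0")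
      case False
      then have "int p dvd m" using prime_power(3) by (metis dvd_power dvd_trans gr0I)
      then have "coprime (det G) (int p)" by (rule coprime_divisors[OF dvd_refl _ G(2)])
      then show ?thesis using False prime_power by (auto intro!: gsum_odd_prime_power G(1))
    qed (use m1 in simp)
  next
    case (mult m1 m2)
    have c: "coprime m1 m2" "coprime m2 m1" using mult by (simp_all add: coprime_commute)
    show ?case
    proof (intro allI impI)
      fix b assume "coprime b (m1 * m2)"
      then have b: "coprime b m1" "coprime b m2" by simp_all
      have "gsum G (b * m2) m1 = of_int (kronecker (det G) m1) * gs (2 * b * m2) m1 ^ CARD('n)"
        using mult(7)[rule_format, of "b * m2"] b c by (simp add: mult.assoc)
      moreover have "gsum G (b * m1) m2 = of_int (kronecker (det G) m2) * gs (2 * b * m1) m2 ^ CARD('n)"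
        using mult(8)[rule_format, of "b * m1"] b c by (simp add: mult.assoc)
      ultimately show "gsum G b (m1 * m2) = of_int (kronecker (det G) (m1 * m2)) * gs (2 * b) (m1 * m2) ^ CARD('n)"
        using gsum_crt[OF good_form_even[OF G(1)] mult(1,2,6), of b] gs_crt[OF mult(1,2,6), of "2 * b"] mult(1,2)
        by (simp add: kronecker_mult_right power_mult_distrib)
    qed
  qed
  then show ?thesis using b by blast
qed

section \<open>General numerators and the factor \<open>mu\<close>\<close>

lemma gauss_const_nonzero: "c > 0 \<Longrightarrow> det G > 0 \<Longrightarrow> gauss_const G c \<noteq> 0"
  by (simp add: gauss_const_def)

lemma det_dvd_power:
  fixes G :: "int ^ 'n ^ 'n"
  assumes "G ** B = mat N" shows "det G dvd N ^ CARD('n)"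
proof -
  have "det (mat N :: int ^ 'n ^ 'n) = N ^ CARD('n)"
    by (subst det_diagonal) (auto simp: mat_def)
  then have "det G * det B = N ^ CARD('n)" by (simp flip: assms add: det_mul)
  then show ?thesis by (metis dvd_triv_left)
qed

text \<open>From \<open>W(1/(c a)) = W(a/c) W(c/a)\<close> one has to invert \<open>W(c/a)\<close>,
  up to the factor \<open>a^(n/2)\<close>. The inverse carries \<open>chr 8 (n (a - 1))\<close>;
  passing from the symbol of \<open>c\<close> to that of \<open>-c\<close> turns it into
  \<open>chr 8 (n (1 - a))\<close>.\<close>

lemma gsum_positive_odd:
  fixes G B :: "int ^ 'n ^ 'n"
  assumes G: "good_form G" and B: "even_form B" "G ** B = mat N" "N > 0" and c: "c > 0" "N dvd c"
    and a: "a > 0" "odd a" "coprime a c"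
  shows "gsum G a c = gauss_const G c *
    (of_int (kronecker (- c) a ^ CARD('n) * kronecker (det G) a) * chr 8 (int CARD('n) * (1 - a)))"
proof -
  let ?n = "CARD('n)"
  let ?K = "of_int (kronecker (- c) a ^ ?n * kronecker (det G) a) * chr 8 (int ?n * (1 - a))"
  define s :: complex where "s = of_real (sqrt (of_int a)) ^ ?n"
  have s: "s \<noteq> 0" using a(1) by (simp add: s_def)
  have aN: "coprime a N" using coprime_divisors[OF dvd_refl c(2) a(3)] .
  have aD: "coprime (det G) a"
    using coprime_divisors[OF det_dvd_power[OF B(2)] dvd_refl, of a] aN by (simp add: coprime_commute)
  have ca: "coprime c a" using a(3) by (simp add: coprime_commute)
  have c2: "coprime (2 * c) a" "coprime 2 a" using ca a(2) by simp_all
  have "gs (2 * c) a = of_int (kronecker c a) * gs 2 a"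
    using gs_kronecker[OF a(1,2) c2(1)] gs_kronecker[OF a(1,2) c2(2)] a
    by (simp add: kronecker_mult_left)
  also have "\<dots> = of_int (kronecker c a) * chr 8 (1 - a) * of_real (sqrt (of_int a))"
    by (simp add: gs_2_odd[OF a(1,2)])
  finally have g: "gs (2 * c) a ^ ?n = of_int (kronecker c a ^ ?n) * chr 8 (int ?n * (1 - a)) * s"
    by (simp add: s_def power_mult_distrib chr_power[symmetric] mult.commute)
  have "gsum G 1 (c * a) = gsum G a c * gsum G c a"
    using gsum_crt[OF good_form_even[OF G] c(1) a(1) ca, of 1] by simp
  moreover have "gsum G 1 (c * a) = gauss_const G c * s"
  proof -
    have "gsum G 1 (c * a) = gauss_const G (c * a)" using c a by (intro gsum_1[OF G B]) auto
    then show ?thesis by (simp add: gauss_const_def s_def real_sqrt_mult power_mult_distrib)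
  qed
  moreover have "gsum G c a = of_int (kronecker (det G) a * kronecker c a ^ ?n) * chr 8 (int ?n * (1 - a)) * s"
    using gsum_odd[OF a(1,2) G aD ca] g by (simp add: mult.assoc)
  ultimately have *: "gsum G a c * (of_int (kronecker (det G) a * kronecker c a ^ ?n) * chr 8 (int ?n * (1 - a))) = gauss_const G c"
    using s by simp
  have m1: "of_int (kronecker (- 1) a) ^ ?n = chr 8 (int ?n * (2 * (a - 1)))"
  proof -
    have "of_int (kronecker (- 1) a) = chr 8 (2 * (a - 1))"
      using kronecker_minus_1[OF a(1,2)] chr_mult_cancel[of 2 4 "a - 1"] by simp
    then show ?thesis by (simp add: chr_power[symmetric] mult.commute)
  qed
  have sq: "(kronecker c a)\<^sup>2 = 1" "(kronecker (det G) a)\<^sup>2 = 1"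
    using kronecker_sq a ca aD by blast+
  have "kronecker (- c) a = kronecker (- 1) a * kronecker c a"
    using kronecker_mult_left[OF a(1,2), of "- 1" c] by simp
  then have "of_int (kronecker (det G) a * kronecker c a ^ ?n) * chr 8 (int ?n * (1 - a)) * ?K =
     of_int ((kronecker (det G) a)\<^sup>2 * ((kronecker c a)\<^sup>2) ^ ?n) *
      (of_int (kronecker (- 1) a) ^ ?n * (chr 8 (int ?n * (1 - a)) * chr 8 (int ?n * (1 - a))))"
    by (simp add: power_mult_distrib power2_eq_square mult_ac)
  also have "\<dots> = chr 8 (int ?n * (2 * (a - 1)) + (int ?n * (1 - a) + int ?n * (1 - a)))"
    unfolding m1 chr_add[symmetric] by (simp add: sq)
  also have "\<dots> = 1" by (simp add: algebra_simps)
  finally have K: "of_int (kronecker (det G) a * kronecker c a ^ ?n) * chr 8 (int ?n * (1 - a)) * ?K = 1" .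
  have "gsum G a c = gsum G a c * (of_int (kronecker (det G) a * kronecker c a ^ ?n) * chr 8 (int ?n * (1 - a)) * ?K)"
    unfolding K by simp
  also have "\<dots> = gauss_const G c * ?K" unfolding *[symmetric] by (simp only: mult.assoc)
  finally show ?thesis .
qed

lemma mu_odd:
  fixes G :: "int ^ 'n ^ 'n"
  assumes "odd a"
  shows "mu G a c = of_int (kronecker (- sgn a * int c) \<bar>a\<bar> ^ CARD('n) * kronecker (det G) a) *
    chr 8 (int CARD('n) * (sgn a * (1 - a)))"
  using assms by (simp add: mu_def chr_def)

lemma gsum_eq_mu:
  fixes G B :: "int ^ 'n ^ 'n"
  assumes G: "good_form G" and B: "even_form B" "G ** B = mat N" "N > 0"
    and c: "c > 0" "N dvd int c" and a: "a \<noteq> 0" "coprime a (int c)"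
  shows "gsum G a (int c) = gauss_const G (int c) * mu G a c"
proof -
  let ?n = "CARD('n)"
  have D: "det G > 0" using gsum_1_divisible[OF G] by blast
  have ic: "int c > 0" using c(1) by simp
  note main = gsum_positive_odd[OF G B ic c(2)]
  consider "odd a" "a > 0" | "odd a" "a < 0" | "even a" using a(1) by linarith
  then show ?thesis
  proof cases
    case 1
    then show ?thesis using main[OF 1(2,1) a(2)] by (simp add: mu_odd)
  next
    case 2
    define b where "b = - a"
    have b: "b > 0" "odd b" "coprime b (int c)" "a = - b" using 2 a by (simp_all add: b_def)
    define S where "S = kronecker (int c) b ^ ?n * kronecker (det G) b"
    have "kronecker (- int c) b = kronecker (- 1) b * kronecker (int c) b"
      using kronecker_mult_left[OF b(1,2), of "- 1" "int c"] by simp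
    moreover have "of_int (kronecker (- 1) b) = chr 8 (2 * (b - 1))"
      using kronecker_minus_1[OF b(1,2)] chr_mult_cancel[of 2 4 "b - 1"] by simp
    ultimately have "of_int (kronecker (- int c) b ^ ?n * kronecker (det G) b) = chr 8 (int ?n * (2 * (b - 1))) * of_int S"
      by (simp add: S_def power_mult_distrib chr_power[symmetric] mult_ac)
    then have "gsum G a (int c) = cnj (gauss_const G (int c)) * (cnj (chr 8 (int ?n * (2 * (b - 1)))) * of_int S * cnj (chr 8 (int ?n * (1 - b))))"
      using main[OF b(1,2,3)] gsum_uminus[of G b "int c"] b(4) by simp
    \<comment> \<open>Conjugation turns \<open>e(n/8)\<close> into \<open>e(-n/8)\<close>. The
      quotient \<open>e(-2n/8)\<close> is moved into the root of unity of \<open>mu\<close>.\<close>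
    also have "cnj (gauss_const G (int c)) = gauss_const G (int c) * chr 8 (- 2 * int ?n)"
    proof -
      have "chr 8 (int ?n) * chr 8 (- 2 * int ?n) = chr 8 (- int ?n)" by (simp flip: chr_add)
      then show ?thesis by (simp add: gauss_const_def chr_uminus mult.assoc)
    qed
    also have "gauss_const G (int c) * chr 8 (- 2 * int ?n) * (cnj (chr 8 (int ?n * (2 * (b - 1)))) * of_int S * cnj (chr 8 (int ?n * (1 - b)))) =
       gauss_const G (int c) * (of_int S * chr 8 (- 2 * int ?n + (- (int ?n * (2 * (b - 1))) - int ?n * (1 - b))))"
    proof -
      have "chr 8 (x + (- y - z)) = chr 8 x * (cnj (chr 8 y) * cnj (chr 8 z))" for x y z
        by (simp only: chr_add diff_conv_add_uminus chr_uminus)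
      then show ?thesis by (simp only: mult_ac)
    qed
    also have "chr 8 (- 2 * int ?n + (- (int ?n * (2 * (b - 1))) - int ?n * (1 - b))) = chr 8 (int ?n * (- (1 + b)))"
      by (rule chr_cong) (simp add: cong_iff_dvd_diff algebra_simps)
    also have "of_int S * chr 8 (int ?n * (- (1 + b))) = mu G a c"
    proof -
      have "kronecker (det G) a = kronecker (det G) b" using b(1,4) D by (simp add: kronecker_def)
      moreover have "- sgn a * int c = int c" "\<bar>a\<bar> = b" "sgn a * (1 - a) = - (1 + b)"
        using b(1,4) by simp_all
      ultimately show ?thesis unfolding mu_odd[OF 2(1)] S_def by (simp only:)
    qed
    finally show ?thesis .
  next
    case 3
    have oc: "odd (int c)" using 3 a(2) by (metis coprime_common_divisor odd_one)
    have oN: "odd N" using oc c(2) dvd_trans by blast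
    have oD: "odd (det G)" using det_dvd_power[OF B(2)] oN by (metis dvd_trans even_power)
    \<comment> \<open>For \<open>b = 1 (mod c)\<close> the sum is also \<open>W(1/c)\<close>, so the
      factor attached to an odd \<open>b\<close> must be 1.\<close>
    have real: "of_int (kronecker (- int c) b ^ ?n * kronecker (det G) b) * chr 8 (int ?n * (1 - b)) = 1"
      if "b > 0" "odd b" "[b = 1] (mod int c)" for b
    proof -
      have "coprime b (int c)" using that(3) by (metis cong_imp_coprime cong_sym coprime_1_left)
      then have "gauss_const G (int c) * (of_int (kronecker (- int c) b ^ ?n * kronecker (det G) b) * chr 8 (int ?n * (1 - b))) = gauss_const G (int c)"
        using main[OF that(1,2)] gsum_cong[OF that(3), of G] gsum_1[OF G B ic c(2)] by simp
      then show ?thesis using gauss_const_nonzero[OF ic D] by simp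
    qed
    have sqr: "(kronecker (- int c) b)\<^sup>2 = 1" "(kronecker (det G) b)\<^sup>2 = 1" "coprime b (det G)"
      if b: "b > 0" "odd b" "coprime b (int c)" for b
    proof -
      have "coprime b N" using coprime_divisors[OF dvd_refl c(2) b(3)] .
      then show "coprime b (det G)"
        using coprime_divisors[OF dvd_refl det_dvd_power[OF B(2)], of b] by simp
      then show "(kronecker (det G) b)\<^sup>2 = 1" using b kronecker_sq coprime_commute by blast
      show "(kronecker (- int c) b)\<^sup>2 = 1" using b by (intro kronecker_sq) (simp_all add: coprime_commute)
    qed
    \<comment> \<open>Take \<open>b = 1 + 2 c\<close> and square: the symbols vanish from the
      relation, leaving \<open>8 | 4 n c\<close> with \<open>c\<close> odd.\<close>
    have n: "even ?n"
    proof -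
      define b where "b = 1 + 2 * int c"
      have b: "b > 0" "odd b" "[b = 1] (mod int c)" by (simp_all add: b_def cong_iff_dvd_diff)
      have cop: "coprime b (int c)" using b(3) by (metis cong_imp_coprime cong_sym coprime_1_left)
      have "(of_int (kronecker (- int c) b ^ ?n * kronecker (det G) b) * chr 8 (int ?n * (1 - b)))\<^sup>2 = (1 :: complex)"
        using real[OF b] by simp
      moreover have "(kronecker (- int c) b ^ ?n * kronecker (det G) b)\<^sup>2 = 1"
        using sqr[OF b(1,2) cop] by (metis mult_1 power_commutes power_mult power_mult_distrib power_one mult.commute)
      ultimately have "chr 8 (int ?n * (1 - b)) * chr 8 (int ?n * (1 - b)) = 1"
        by (metis mult_1 of_int_1 of_int_power power2_eq_square power_mult_distrib)
      then have "chr 8 (int ?n * (1 - b) + int ?n * (1 - b)) = 1" by (simp only: chr_add)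
      then have "8 dvd int ?n * (1 - b) + int ?n * (1 - b)" by (subst (asm) chr_eq_1_iff) simp_all
      then have "4 * 2 dvd 4 * (- (int ?n * int c))" by (simp add: b_def algebra_simps)
      then have "even (int ?n * int c)" by (simp only: dvd_mult_cancel_left) simp
      then show ?thesis using oc by simp
    qed
    \<comment> \<open>\<open>c^2 = 1 (mod 8)\<close> for odd \<open>c\<close>, so \<open>X\<close>
      is congruent to \<open>a\<close> modulo \<open>c\<close> and to 1 modulo 8.\<close>
    define X where "X = a + int c * int c * (1 - a)"
    have "int c mod 8 = 1 \<or> int c mod 8 = 3 \<or> int c mod 8 = 5 \<or> int c mod 8 = 7" using oc by presburger
    then have "int c * int c mod 8 = 1" by (auto simp: mod_mult_eq[of "int c" 8 "int c", symmetric])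
    then have cc: "[int c * int c = 1] (mod 8)" by (simp add: cong_def)
    have "[X = a + 1 * (1 - a)] (mod 8)" unfolding X_def by (intro cong_add cong_mult cong_refl cc)
    then have X: "[X = 1] (mod 8)" by simp
    \<comment> \<open>The added multiple of \<open>8 c\<close> makes the number positive without
      changing either residue.\<close>
    define b where "b = X + 8 * \<bar>X\<bar> * int c"
    have b8: "[b = 1] (mod 8)" using cong_add[OF X, of "8 * \<bar>X\<bar> * int c" 0] by (simp add: b_def cong_0_iff)
    have "X \<noteq> 0" using X by (auto simp: cong_def)
    then have "8 * \<bar>X\<bar> * int c \<ge> 8 * \<bar>X\<bar> * 1" using ic by (intro mult_left_mono) auto
    then have b0: "b > 0" using \<open>X \<noteq> 0\<close> unfolding b_def by linarith
    have ob: "odd b" using b8 unfolding cong_def by presburger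
    have "[b = 1] (mod 4)" using b8 by (rule cong_dvd_modulus) simp
    then have b4: "b mod 4 = 1" by (simp add: cong_def)
    have bc: "[b = a] (mod int c)" by (simp add: b_def X_def cong_iff_dvd_diff)
    have cop: "coprime b (int c)" using a(2) bc by (metis cong_imp_coprime cong_sym)
    have "8 dvd 1 - b" using cong_sym[OF b8] by (simp add: cong_iff_dvd_diff)
    then have ch: "chr 8 (int ?n * (1 - b)) = 1" by (intro chr_eq_1) simp
    have "kronecker (- int c) b ^ ?n = 1" using n sqr(1)[OF b0 ob cop] by (elim evenE) (simp add: power_mult)
    moreover have "kronecker (det G) b = kronecker a (det G)"
    proof -
      have "kronecker (det G) b = kronecker b (det G)"
        by (rule kronecker_reciprocity[OF b0 b4 D oD sqr(3)[OF b0 ob cop]])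
      also have "\<dots> = kronecker a (det G)"
      proof (rule kronecker_cong[OF D oD])
        fix p assume p: "prime p" "int p dvd det G"
        then have "int p dvd N ^ ?n" using det_dvd_power[OF B(2)] dvd_trans by blast
        then have "int p dvd N" using p(1) prime_dvd_power by (metis prime_nat_int_transfer)
        then have "int p dvd int c" using c(2) dvd_trans by blast
        then show "[b = a] (mod int p)" using bc cong_dvd_modulus by blast
      qed
      finally show ?thesis .
    qed
    ultimately have "gsum G b (int c) = gauss_const G (int c) * of_int (kronecker a (det G))"
      using main[OF b0 ob cop] by (simp add: ch)
    then show ?thesis using 3 gsum_cong[OF bc, of G] by (simp add: mu_def)
  qed
qed

subsection \<open>Poisson summation over a subgroup\<close>

lemma residue_class_eq_iff: "residue_class c u = residue_class c v \<longleftrightarrow> vcong (int c) u v"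
proof
  assume "residue_class c u = residue_class c v"
  then have "u \<in> residue_class c v" using residue_class_self by blast
  then obtain z where "u = int c *s z + v" by (auto simp: residue_class_alt)
  then show "vcong (int c) u v" by (auto simp: vcong_iff_scale add.commute)
next
  assume "vcong (int c) u v"
  then obtain z where u: "u = v + int c *s z" by (auto simp: vcong_iff_scale)
  have "\<exists>y. int c *s x + u = int c *s y + v" for x
    by (rule exI[of _ "x + z"]) (simp add: u vec_eq_iff algebra_simps)
  moreover have "\<exists>y. int c *s x + v = int c *s y + u" for x
    by (rule exI[of _ "x - z"]) (simp add: u vec_eq_iff algebra_simps)
  ultimately show "residue_class c u = residue_class c v"
    by (auto simp: residue_class_alt)
qed

lemma mem_residue_class: "u \<in> residue_class c v \<longleftrightarrow> vcong (int c) u v"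
  by (auto simp: residue_class_alt vcong_iff_scale add.commute)

lemma residue_class_mult:
  "residue_class c u \<otimes>\<^bsub>Zn_mod c\<^esub> residue_class c v = residue_class c (u + v)"
proof (rule Set.set_eqI)
  fix x
  have "x \<in> residue_class c u \<otimes>\<^bsub>Zn_mod c\<^esub> residue_class c v \<longleftrightarrow>
      (\<exists>a\<in>residue_class c u. \<exists>b\<in>residue_class c v. x = a + b)"
    by (simp add: FactGroup_def set_mult_def Zn_def)
  also have "\<dots> \<longleftrightarrow> x \<in> residue_class c (u + v)"
  proof
    assume "\<exists>a\<in>residue_class c u. \<exists>b\<in>residue_class c v. x = a + b"
    then obtain a b where ab: "vcong (int c) a u" "vcong (int c) b v" "x = a + b"
      by (auto simp: mem_residue_class)
    have "int c dvd (a $ i - u $ i) + (b $ i - v $ i)" for i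
      using ab(1,2) by (simp add: vcong_def)
    then show "x \<in> residue_class c (u + v)"
      by (simp add: mem_residue_class vcong_def ab(3) algebra_simps)
  next
    assume "x \<in> residue_class c (u + v)"
    then have "x - v \<in> residue_class c u" by (simp add: mem_residue_class vcong_def algebra_simps)
    moreover have "x = (x - v) + v" by simp
    ultimately show "\<exists>a\<in>residue_class c u. \<exists>b\<in>residue_class c v. x = a + b"
      using residue_class_self by blast
  qed
  finally show "x \<in> residue_class c u \<otimes>\<^bsub>Zn_mod c\<^esub> residue_class c v \<longleftrightarrow> x \<in> residue_class c (u + v)" .
qed

lemma one_Zn_mod: "\<one>\<^bsub>Zn_mod c\<^esub> = residue_class c 0"
  by (auto simp: FactGroup_def residue_class_alt cZn_def)

text \<open>\<open>perp\<close> quantifies over all representatives, but the product modulo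
  \<open>c\<close> depends only on classes, so one vector \<open>y\<close> decides
  membership.\<close>

lemma perp_residue_class:
  assumes "H \<subseteq> carrier (Zn_mod c)"
  shows "residue_class c y \<in> perp c H \<longleftrightarrow> (\<forall>h. residue_class c h \<in> H \<longrightarrow> int c dvd vdot y h)"
proof -
  have dv: "int c dvd vdot u k \<longleftrightarrow> int c dvd vdot v h" if uv: "vcong (int c) u v" "vcong (int c) k h" for u v k h
  proof -
    obtain x z where "u = v + int c *s x" "k = h + int c *s z" using uv by (auto simp: vcong_iff_scale)
    then have "vdot u k = vdot v h + int c * (vdot v z + vdot x h + int c * vdot x z)"
      by (simp add: vdot_add_left vdot_add_right vdot_scale_left vdot_scale_right algebra_simps)
    then show ?thesis by (simp add: dvd_add_left_iff)
  qed
  show ?thesis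
  proof
    assume y: "residue_class c y \<in> perp c H"
    show "\<forall>h. residue_class c h \<in> H \<longrightarrow> int c dvd vdot y h"
      using y residue_class_self unfolding perp_def vdot_def cong_0_iff by blast
  next
    assume *: "\<forall>h. residue_class c h \<in> H \<longrightarrow> int c dvd vdot y h"
    have "int c dvd vdot v h" if K: "K \<in> H" "v \<in> residue_class c y" "h \<in> K" for K v h
    proof -
      obtain k where k: "K = residue_class c k" using K(1) assms by (auto simp: carrier_Zn_mod)
      then have "vcong (int c) v y" "vcong (int c) h k" using K by (simp_all add: mem_residue_class)
      then show ?thesis using dv * K(1) k by blast
    qed
    then show "residue_class c y \<in> perp c H"
      by (auto simp: perp_def carrier_Zn_mod vdot_def cong_0_iff)
  qed
qed

section \<open>Characters of a subgroup and Poisson summation\<close>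

text \<open>Canonical representatives turn sums over sets of classes into sums over vectors in the
  box, where the Fourier transform is defined.\<close>

definition reps :: "nat \<Rightarrow> (int ^ 'n) set set \<Rightarrow> (int ^ 'n) set" where
  "reps c X = {v \<in> rbox (int c). residue_class c v \<in> X}"

lemma finite_reps [simp]: "finite (reps c X)"
  by (simp add: reps_def)

lemma bij_betw_reps:
  assumes "c > 0" "X \<subseteq> carrier (Zn_mod c)"
  shows "bij_betw (residue_class c) (reps c X) X"
proof (rule bij_betw_imageI)
  show "inj_on (residue_class c) (reps c X)"
    by (rule inj_onI) (auto simp: reps_def residue_class_eq_iff intro: vcong_rbox_eq)
  have "V \<in> residue_class c ` reps c X" if V: "V \<in> X" for V
  proof -
    obtain v where v: "V = residue_class c v" using V assms(2) by (auto simp: carrier_Zn_mod)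
    have "residue_class c (vmod (int c) v) = V" by (simp add: v residue_class_eq_iff vcong_vmod)
    moreover have "vmod (int c) v \<in> rbox (int c)" using assms(1) by (simp add: vmod_rbox)
    ultimately show ?thesis using V by (force simp: reps_def)
  qed
  then show "residue_class c ` reps c X = X" by (auto simp: reps_def)
qed

text \<open>Orthogonality: if some \<open>h\<close> from \<open>H\<close> has nontrivial character
  value, translation by \<open>h\<close> permutes the summands and multiplies the sum by that
  value.\<close>

lemma sum_chr_subgroup:
  fixes H :: "(int ^ 'n) set set"
  assumes c: "c > 0" and H: "subgroup H (Zn_mod c)"
  shows "(\<Sum>v\<in>reps c H. chr (int c) (vdot y v)) =
    (if residue_class c y \<in> perp c H then of_nat (card (reps c H)) else 0)"
proof -
  let ?S = "\<Sum>v\<in>reps c H. chr (int c) (vdot y v)"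
  have sub: "H \<subseteq> carrier (Zn_mod c)" using H by (rule subgroup.subset)
  note perp = perp_residue_class[OF sub, of y]
  show ?thesis
  proof (cases "residue_class c y \<in> perp c H")
    case True
    then have "?S = (\<Sum>v\<in>reps c H. 1)"
      using perp by (intro sum.cong refl chr_eq_1) (auto simp: reps_def)
    then show ?thesis using True by simp
  next
    case False
    then obtain h where h: "residue_class c h \<in> H" "\<not> int c dvd vdot y h" using perp by blast
    have per: "chr (int c) (vdot y u) = chr (int c) (vdot y v)" if uv: "vcong (int c) u v" for u v
    proof -
      obtain z where "u = v + int c *s z" using uv by (auto simp: vcong_iff_scale)
      then show ?thesis by (intro chr_cong) (simp add: vdot_add_right vdot_scale_right cong_iff_dvd_diff)
    qed
    define g where "g v = vmod (int c) (v + h)" for v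
    have inj: "inj_on g (reps c H)"
    proof (rule inj_onI)
      fix u v assume uv: "u \<in> reps c H" "v \<in> reps c H" "g u = g v"
      then have "vcong (int c) (u + h) (v + h)" by (simp add: g_def vcong_iff_vmod)
      then have "vcong (int c) u v" by (simp add: vcong_def)
      then show "u = v" using uv by (auto simp: reps_def intro: vcong_rbox_eq)
    qed
    have "g ` reps c H \<subseteq> reps c H"
    proof
      fix x assume "x \<in> g ` reps c H"
      then obtain v where v: "v \<in> reps c H" "x = g v" by blast
      have "residue_class c x = residue_class c v \<otimes>\<^bsub>Zn_mod c\<^esub> residue_class c h"
        unfolding residue_class_mult by (simp add: v g_def residue_class_eq_iff vcong_vmod)
      also have "\<dots> \<in> H" using v h by (intro subgroup.m_closed[OF H]) (auto simp: reps_def)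
      finally show "x \<in> reps c H" using c by (simp add: reps_def v g_def vmod_rbox)
    qed
    then have im: "g ` reps c H = reps c H" using inj by (intro endo_inj_surj) auto
    have "?S = (\<Sum>v\<in>reps c H. chr (int c) (vdot y (g v)))"
      using sum.reindex[OF inj, of "\<lambda>v. chr (int c) (vdot y v)"] by (simp add: im)
    also have "\<dots> = (\<Sum>v\<in>reps c H. chr (int c) (vdot y v) * chr (int c) (vdot y h))"
    proof (rule sum.cong[OF refl])
      fix v
      have "chr (int c) (vdot y (g v)) = chr (int c) (vdot y (v + h))"
        unfolding g_def by (rule per) (rule vcong_vmod)
      then show "chr (int c) (vdot y (g v)) = chr (int c) (vdot y v) * chr (int c) (vdot y h)"
        by (simp add: vdot_add_right chr_add)
    qed
    finally have "?S * (1 - chr (int c) (vdot y h)) = 0"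
      by (simp add: sum_distrib_right[symmetric] right_diff_distrib)
    then show ?thesis using h(2) c False by (simp add: chr_eq_1_iff)
  qed
qed

text \<open>Poisson summation follows from Fourier inversion on the full group and the orthogonality
  relations for \<open>H\<close>, so the identity \<open>H\<^sup>\<bottom>\<^sup>\<bottom> = H\<close> is not needed.\<close>

lemma poisson_subgroup:
  fixes H :: "(int ^ 'n) set set" and f :: "int ^ 'n \<Rightarrow> complex"
  assumes c: "c > 0" and H: "subgroup H (Zn_mod c)"
  shows "of_nat c ^ CARD('n) * (\<Sum>v\<in>reps c H. f v) =
    of_nat (card (reps c H)) * (\<Sum>y\<in>reps c (perp c H). \<Sum>u\<in>rbox (int c). f u * chr (int c) (- vdot y u))"
proof -
  define fh where "fh y = (\<Sum>u\<in>rbox (int c). f u * chr (int c) (- vdot y u))" for y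
  have inv: "(\<Sum>y\<in>rbox (int c). fh y * chr (int c) (vdot y v)) = of_nat c ^ CARD('n) * f v" if v: "v \<in> rbox (int c)" for v
  proof -
    have "(\<Sum>y\<in>rbox (int c). fh y * chr (int c) (vdot y v)) =
        (\<Sum>u\<in>rbox (int c). \<Sum>y\<in>rbox (int c). f u * (chr (int c) (- vdot y u) * chr (int c) (vdot y v)))"
      unfolding fh_def sum_distrib_right by (subst sum.swap) (simp add: mult.assoc)
    also have "\<dots> = (\<Sum>u\<in>rbox (int c). f u * (\<Sum>y\<in>rbox (int c). \<Prod>i\<in>UNIV. chr (int c) ((v $ i - u $ i) * y $ i)))"
    proof -
      have "chr (int c) (- vdot y u) * chr (int c) (vdot y v) = (\<Prod>i\<in>UNIV. chr (int c) ((v $ i - u $ i) * y $ i))" for y u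
        unfolding chr_add[symmetric] chr_sum[symmetric] vdot_def
        by (simp add: sum_negf[symmetric] sum.distrib[symmetric] algebra_simps)
      then show ?thesis by (simp add: sum_distrib_left)
    qed
    also have "\<dots> = (\<Sum>u\<in>rbox (int c). f u * (\<Prod>i\<in>(UNIV :: 'n set). if int c dvd v $ i - u $ i then of_nat c else 0))"
      using c of_int_of_nat_eq[of c, where ?'a = complex] sum_prod_ibox[of "\<lambda>i x. chr (int c) ((v $ i - _ $ i) * x)" "\<chi> i. int c"]
      by (simp add: sum_chr cong: if_cong)
    also have "\<dots> = (\<Sum>u\<in>rbox (int c). if u = v then of_nat c ^ CARD('n) * f v else 0)"
    proof (rule sum.cong[OF refl])
      fix u :: "int ^ 'n" assume u: "u \<in> rbox (int c)"
      show "f u * (\<Prod>i\<in>UNIV. if int c dvd v $ i - u $ i then of_nat c else 0) = (if u = v then of_nat c ^ CARD('n) * f v else 0)"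
      proof (cases "u = v")
        case False
        then have "\<not> vcong (int c) v u" using u v vcong_rbox_eq by blast
        then show ?thesis using False by (auto simp: vcong_def)
      qed simp
    qed
    finally show ?thesis using v by simp
  qed
  have "of_nat c ^ CARD('n) * (\<Sum>v\<in>reps c H. f v) = (\<Sum>v\<in>reps c H. \<Sum>y\<in>rbox (int c). fh y * chr (int c) (vdot y v))"
    unfolding sum_distrib_left by (rule sum.cong) (auto simp: inv reps_def)
  also have "\<dots> = (\<Sum>y\<in>rbox (int c). fh y * (\<Sum>v\<in>reps c H. chr (int c) (vdot y v)))"
    unfolding sum_distrib_left by (rule sum.swap)
  also have "\<dots> = (\<Sum>y\<in>rbox (int c). if residue_class c y \<in> perp c H then of_nat (card (reps c H)) * fh y else 0)"
    unfolding sum_chr_subgroup[OF c H] by (rule sum.cong) auto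
  also have "\<dots> = of_nat (card (reps c H)) * (\<Sum>y\<in>reps c (perp c H). fh y)"
    by (simp add: sum.If_cases reps_def Int_def sum_distrib_left)
  finally show ?thesis by (simp add: fh_def)
qed

text \<open>Poisson summation for the indicator function of 0, whose transform is constantly
  1.\<close>

lemma card_perp:
  fixes H :: "(int ^ 'n) set set"
  assumes c: "c > 0" and H: "subgroup H (Zn_mod c)"
  shows "card H * card (perp c H) = c ^ CARD('n)"
proof -
  have sub: "H \<subseteq> carrier (Zn_mod c)" using H by (rule subgroup.subset)
  have rbox_0: "0 \<in> (rbox (int c) :: (int ^ 'n) set)" using c by (simp add: ibox_def)
  then have 0: "0 \<in> reps c H" using subgroup.one_closed[OF H] unfolding one_Zn_mod by (simp add: reps_def)
  have "perp c H \<subseteq> carrier (Zn_mod c)" by (auto simp: perp_def)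
  then have cards: "card (reps c H) = card H" "card (reps c (perp c H)) = card (perp c H)"
    using bij_betw_same_card[OF bij_betw_reps[OF c]] sub by auto
  let ?f = "\<lambda>v :: int ^ 'n. if v = 0 then 1 else 0 :: complex"
  have "(\<Sum>u\<in>rbox (int c). ?f u * chr (int c) (- vdot y u)) = 1" for y :: "int ^ 'n"
  proof -
    have "(\<Sum>u\<in>rbox (int c). ?f u * chr (int c) (- vdot y u)) = (\<Sum>u\<in>(rbox (int c) :: (int ^ 'n) set). if u = 0 then 1 else 0)"
      by (rule sum.cong) (auto simp: vdot_def)
    then show ?thesis using rbox_0 by simp
  qed
  then have "of_nat c ^ CARD('n) * (\<Sum>v\<in>reps c H. ?f v) = of_nat (card H) * (of_nat (card (perp c H)) :: complex)"
    unfolding poisson_subgroup[OF c H, of ?f] by (simp add: cards)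
  then have "of_nat (c ^ CARD('n)) = (of_nat (card H * card (perp c H)) :: complex)"
    using 0 by simp
  then show ?thesis by (metis of_nat_eq_iff)
qed

subsection \<open>The Fourier transform of the Gauss sum\<close>

text \<open>For \<open>c = N l\<close> these vectors are periods of \<open>q\<close> modulo
  \<open>c\<close>. They detect points off the shifted lattice and show that dual terms do not
  depend on representatives.\<close>

lemma lattice_translate:
  fixes G B :: "int ^ 'n ^ 'n"
  assumes G: "even_form G" and B: "even_form B" and GB: "G ** B = mat N"
  shows "G *v (l *s (B *v u)) = (N * l) *s u" "N * l dvd qf G (l *s (B *v u))"
proof -
  show *: "G *v (l *s (B *v u)) = (N * l) *s u"
    by (simp add: matrix_vector_scale matrix_vector_mul_assoc GB mat_mult_vector vec_eq_iff)
  have "2 * qf G (l *s (B *v u)) = 2 * (N * l * (l * qf B u))"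
    using qf_double[OF B, of u]
    by (simp add: qf_double[OF G, symmetric] * vdot_scale_left vdot_scale_right vdot_commute[of _ u])
  then show "N * l dvd qf G (l *s (B *v u))" by simp
qed

lemma multiple_inverse_left:
  fixes G B :: "int ^ 'n ^ 'n"
  assumes "transpose G = G" "transpose B = B" "G ** B = mat N"
  shows "B ** G = mat N"
  by (metis assms matrix_transpose_mul transpose_mat)

text \<open>The multiples of \<open>g\<close> cancel, and completing the square with
  \<open>u + a' z\<close> leaves \<open>a q(u) - a' q(z)\<close> modulo \<open>c\<close>, because
  \<open>a a' = 1 (mod c)\<close>.\<close>

lemma gauss_sum_lattice:
  fixes G :: "int ^ 'n ^ 'n"
  assumes G: "even_form G" and c: "c > 0" and aa: "[a * a' = 1] (mod c)"
  shows "(\<Sum>u\<in>rbox c. chr c (a * (qf G u + vdot u g)) * chr c (- vdot (a *s g + G *v z) u)) =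
    chr c (- a' * qf G z) * gsum G a c"
proof -
  define f where "f u = chr c (a * (qf G u + vdot u g)) * chr c (- vdot (a *s g + G *v z) u)" for u
  have f: "f u = chr c (a * qf G u - vdot u (G *v z))" for u
    unfolding f_def chr_add[symmetric]
    by (simp add: vdot_add_right vdot_scale_right vdot_commute[of _ u] algebra_simps)
  have per: "f u = f v" if uv: "vcong c u v" for u v
  proof -
    have "[a * qf G u - vdot u (G *v z) = a * qf G v - vdot v (G *v z)] (mod c)"
    proof (intro cong_diff cong_mult cong_refl qf_cong[OF G uv])
      obtain x where "u = v + c *s x" using uv by (auto simp: vcong_iff_scale)
      then show "[vdot u (G *v z) = vdot v (G *v z)] (mod c)"
        by (simp add: cong_iff_dvd_diff vdot_add_left vdot_scale_left)
    qed
    then show ?thesis unfolding f by (rule chr_cong)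
  qed
  have "f (u + a' *s z) = chr c (- a' * qf G z) * chr c (a * qf G u)" for u
  proof -
    have "qf G (u + a' *s z) = qf G u + a' * a' * qf G z + a' * vdot u (G *v z)"
      by (simp add: qf_add[OF G] qf_scale[OF G] matrix_vector_scale vdot_scale_right power2_eq_square)
    moreover have "vdot (u + a' *s z) (G *v z) = vdot u (G *v z) + a' * (2 * qf G z)"
      using qf_double[OF G, of z] by (simp add: vdot_add_left vdot_scale_left)
    ultimately have "a * qf G (u + a' *s z) - vdot (u + a' *s z) (G *v z) - (- a' * qf G z + a * qf G u)
        = (a * a' - 1) * (a' * qf G z + vdot u (G *v z))"
      by (simp add: algebra_simps)
    then have "[a * qf G (u + a' *s z) - vdot (u + a' *s z) (G *v z) = - a' * qf G z + a * qf G u] (mod c)"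
      using aa by (simp add: cong_iff_dvd_diff)
    then show ?thesis unfolding f chr_add[symmetric] by (rule chr_cong)
  qed
  then have "(\<Sum>u\<in>rbox c. f (u + a' *s z)) = chr c (- a' * qf G z) * gsum G a c"
    by (simp add: gsum_def sum_distrib_left)
  then show ?thesis using sum_rbox_shift[OF c, of f "a' *s z"] per by (simp add: f_def)
qed

text \<open>Translation by a period of \<open>q\<close> modulo \<open>c\<close> multiplies the sum
  by a character value at \<open>r = y - a g\<close>. For \<open>r\<close> outside
  \<open>G Z^n\<close> some period gives a value different from 1.\<close>

lemma gauss_sum_off_lattice:
  fixes G B :: "int ^ 'n ^ 'n"
  assumes G: "even_form G" and B: "even_form B" and GB: "G ** B = mat N" and N: "N > 0"
    and c: "c > 0" "N dvd c" and y: "\<nexists>z. y = a *s g + G *v z"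
  shows "(\<Sum>u\<in>rbox c. chr c (a * (qf G u + vdot u g)) * chr c (- vdot y u)) = 0"
proof -
  obtain l where l: "c = N * l" using c(2) by blast
  have l0: "l \<noteq> 0" using c(1) l by auto
  define r where "r = y - a *s g"
  define f where "f u = chr c (a * (qf G u + vdot u g)) * chr c (- vdot y u)" for u
  have "y = a *s g + r" by (simp add: r_def)
  then have f: "f u = chr c (a * qf G u - vdot u r)" for u
    unfolding f_def chr_add[symmetric]
    by (simp add: vdot_add_right vdot_scale_right vdot_commute[of _ u] algebra_simps)
  have per: "f u = f v" if uv: "vcong c u v" for u v
  proof -
    have "[a * qf G u - vdot u r = a * qf G v - vdot v r] (mod c)"
    proof (intro cong_diff cong_mult cong_refl qf_cong[OF G uv])
      obtain x where "u = v + c *s x" using uv by (auto simp: vcong_iff_scale)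
      then show "[vdot u r = vdot v r] (mod c)"
        by (simp add: cong_iff_dvd_diff vdot_add_left vdot_scale_left)
    qed
    then show ?thesis unfolding f by (rule chr_cong)
  qed
  \<comment> \<open>Otherwise \<open>B r = N z\<close>, and applying \<open>G\<close> with
    \<open>G B = N\<close> gives \<open>r = G z\<close>.\<close>
  have "\<exists>i. \<not> N dvd (B *v r) $ i"
  proof (rule ccontr)
    assume "\<not> (\<exists>i. \<not> N dvd (B *v r) $ i)"
    then have "\<forall>i. \<exists>k. (B *v r) $ i = N * k" unfolding dvd_def by blast
    then obtain z where "\<forall>i. (B *v r) $ i = N * z i" by (rule choice[THEN exE])
    then have z: "B *v r = N *s (\<chi> i. z i)"
      unfolding vec_eq_iff vector_smult_component vec_lambda_beta by blast
    have "N *s r = G *v (B *v r)" by (simp add: matrix_vector_mul_assoc GB mat_mult_vector)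
    also have "\<dots> = N *s (G *v (\<chi> i. z i))" by (simp add: z matrix_vector_scale)
    finally have "r = G *v (\<chi> i. z i)" using N by (simp add: vec_eq_iff)
    then have "y = a *s g + G *v (\<chi> i. z i)" by (simp add: r_def diff_eq_eq add.commute)
    then show False using y by blast
  qed
  then obtain i where i: "\<not> N dvd (B *v r) $ i" by blast
  define s where "s = l *s (B *v axis i 1)"
  note s = lattice_translate[OF G B GB, of l "axis i 1", folded s_def l]
  have "vdot s r = l * (B *v r) $ i"
    using vdot_symmetric[of B "axis i 1" r] B
    by (simp add: s_def vdot_scale_left vdot_axis vdot_commute[of "B *v axis i 1" r] even_form_def)
  then have ns: "\<not> c dvd vdot s r" using i l0 by (simp add: l mult.commute[of N])
  have "f (u + s) = f u * chr c (- vdot s r)" for u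
  proof -
    have q: "qf G (u + s) = qf G u + qf G s + c * vdot u (axis i 1)"
      by (simp add: qf_add[OF G] s(1) vdot_scale_right)
    have "a * qf G (u + s) - vdot (u + s) r - ((a * qf G u - vdot u r) + - vdot s r) =
        a * (qf G s + c * vdot u (axis i 1))"
      unfolding q vdot_add_left by (simp add: algebra_simps)
    then have "[a * qf G (u + s) - vdot (u + s) r = (a * qf G u - vdot u r) + - vdot s r] (mod c)"
      unfolding cong_iff_dvd_diff using s(2) by simp
    then show ?thesis unfolding f chr_add[symmetric] by (rule chr_cong)
  qed
  then have "(\<Sum>u\<in>rbox c. f u) = (\<Sum>u\<in>rbox c. f u) * chr c (- vdot s r)"
    using sum_rbox_shift[OF c(1), of f s] per by (simp add: sum_distrib_right)
  moreover have "chr c (- vdot s r) \<noteq> 1" using ns c(1) by (simp add: chr_eq_1_iff)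
  ultimately have "(\<Sum>u\<in>rbox c. f u) = 0" by simp
  then show ?thesis by (simp add: f_def)
qed

section \<open>Passage from real matrices to integral forms\<close>

lemma rvec_inner: "rvec u \<bullet> rvec v = of_int (vdot u v)"
  by (simp add: inner_vec_def vdot_def)

lemma half_form_rvec:
  assumes "even_form G" shows "half_form (rmat G) (rvec z) = of_int (qf G z)"
  using qf_double[OF assms, of z] by (simp add: half_form_def rmat_mult_rvec rvec_inner)

lemma good_form_if_pos_definite:
  fixes G :: "int ^ 'n ^ 'n"
  assumes "transpose G = G" "pos_definite (rmat G)" "even_integral (rmat G)"
  shows "good_form G"
proof -
  have "even (G $ i $ i)" for i
  proof -
    obtain k :: int where "real_of_int (G $ i $ i) = 2 * of_int k"
      using assms(3) by (auto simp: even_integral_def)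
    then have "G $ i $ i = 2 * k" by linarith
    then show ?thesis by simp
  qed
  then have even: "even_form G" using assms(1) by (simp add: even_form_def)
  have "qf G z > 0" if "z \<noteq> 0" for z
  proof -
    have "rvec z \<noteq> 0" using that by (simp add: vec_eq_iff)
    then have "rvec z \<bullet> (rmat G *v rvec z) > 0" using assms(2) by (simp add: pos_definite_def)
    then show ?thesis using qf_double[OF even, of z] by (simp add: rmat_mult_rvec rvec_inner)
  qed
  then show ?thesis using even by (simp add: good_form_def)
qed

text \<open>The level is a least element, so some even integral multiple of the inverse must be
  exhibited first; \<open>even_form_multiple_inverse\<close> provides it.\<close>

lemma level_dual_matrix:
  fixes G :: "int ^ 'n ^ 'n"
  assumes G: "good_form G"
  obtains B where "even_form B" "G ** B = mat (int (level G))" "dual_matrix G = rmat B" "level G > 0"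
proof -
  note even = good_form_even[OF G]
  have det: "det G > 0" using gsum_1_divisible[OF G] by blast
  then have "invertible (rmat G)" by (simp add: invertible_det_nz det_rmat)
  then have "rmat G ** matrix_inv (rmat G) = mat 1 \<and> matrix_inv (rmat G) ** rmat G = mat 1"
    unfolding matrix_inv_def invertible_def by (rule someI_ex)
  then have inv: "rmat G ** matrix_inv (rmat G) = mat 1" "matrix_inv (rmat G) ** rmat G = mat 1"
    by blast+
  obtain A M where A: "even_form A" "M > 0" "G ** A = mat M" by (rule even_form_multiple_inverse[OF even det])
  have "rmat A = real (nat M) *\<^sub>R matrix_inv (rmat G)"
  proof -
    have "rmat G ** rmat A = real (nat M) *\<^sub>R mat 1"
      using A(2) by (simp flip: rmat_mult add: A(3)) (simp add: vec_eq_iff mat_def)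
    then have "matrix_inv (rmat G) ** (rmat G ** rmat A) = real (nat M) *\<^sub>R matrix_inv (rmat G)"
      by (simp add: matrix_scalar_ac)
    then show ?thesis by (simp add: matrix_mul_assoc inv)
  qed
  moreover have "even_integral (rmat A)"
    unfolding even_integral_def
  proof (intro conjI allI)
    fix i
    obtain k where "A $ i $ i = 2 * k" using A(1) by (auto simp: even_form_def elim: evenE)
    then show "\<exists>k :: int. rmat A $ i $ i = 2 * of_int k" by (intro exI[of _ k]) simp
  qed simp
  ultimately have "\<exists>N. N > 0 \<and> even_integral (real N *\<^sub>R matrix_inv (rmat G))"
    using A(2) by (intro exI[of _ "nat M"]) simp
  then have lev: "level G > 0" "even_integral (dual_matrix G)"
    unfolding level_def dual_matrix_def by (metis (mono_tags, lifting) LeastI_ex)+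
  define B where "B = (\<chi> i j. \<lfloor>dual_matrix G $ i $ j\<rfloor>)"
  have "dual_matrix G $ i $ j \<in> \<int>" for i j using lev(2) by (simp add: even_integral_def)
  then have B: "dual_matrix G = rmat B" by (simp add: B_def vec_eq_iff)
  have "rmat (G ** B) = rmat (mat (int (level G)))"
    unfolding rmat_mult B[symmetric]
    by (simp add: dual_matrix_def matrix_scalar_ac scalar_matrix_assoc[symmetric] inv) (simp add: vec_eq_iff mat_def)
  then have GB: "G ** B = mat (int (level G))" by (simp add: vec_eq_iff)
  have "transpose B = B"
    using symmetric_multiple_inverse[OF _ GB] even lev(1) by (simp add: even_form_def)
  moreover have "even (B $ i $ i)" for i
  proof -
    obtain k :: int where "real_of_int (B $ i $ i) = 2 * of_int k"
      using lev(2) unfolding B by (auto simp: even_integral_def)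
    then have "B $ i $ i = 2 * k" by linarith
    then show ?thesis by simp
  qed
  ultimately have "even_form B" by (simp add: even_form_def)
  then show ?thesis using that GB B lev(1) by blast
qed

lemma shifted_lattice_eq:
  assumes "rmat G *v w = rvec g"
  shows "shifted_lattice G a w = {y. \<exists>z. y = a *s g + G *v z}"
proof -
  have "rvec y = of_int a *\<^sub>R rvec g + rvec (G *v z) \<longleftrightarrow> y = a *s g + G *v z" for y z
    unfolding vec_eq_iff by (simp flip: of_int_mult of_int_add)
  then show ?thesis by (simp add: shifted_lattice_def assms rmat_mult_rvec)
qed

text \<open>Since \<open>B G = N\<close>, the dual form takes the value \<open>N q(z)\<close> at
  \<open>G z\<close>, which cancels the level in the denominator.\<close>

lemma dual_term_eq:
  fixes G B :: "int ^ 'n ^ 'n"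
  assumes G: "even_form G" and B: "even_form B" "G ** B = mat (int (level G))"
    "dual_matrix G = rmat B" "level G > 0" and g: "rmat G *v w = rvec g"
  shows "dual_term G c a a' w (a *s g + G *v z) = chr (int c) (- a' * qf G z)"
proof -
  have "rvec (a *s g + G *v z) - of_int a *\<^sub>R (rmat G *v w) = rvec (G *v z)"
    by (simp add: g vec_eq_iff)
  moreover have "qf B (G *v z) = int (level G) * qf G z"
  proof -
    have "B ** G = mat (int (level G))"
      by (rule multiple_inverse_left[OF _ _ B(2)]) (use G B(1) in \<open>simp_all add: even_form_def\<close>)
    then have "B *v (G *v z) = int (level G) *s z" by (simp only: matrix_vector_mul_assoc mat_mult_vector)
    then have "vdot (G *v z) (B *v (G *v z)) = int (level G) * vdot z (G *v z)"
      by (simp only: vdot_scale_right vdot_commute[of z])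
    then have "2 * qf B (G *v z) = 2 * (int (level G) * qf G z)"
      by (simp add: qf_double[OF G] qf_double[OF B(1)])
    then show ?thesis by simp
  qed
  ultimately have "dual_term G c a a' w (a *s g + G *v z) =
      e (of_real (- of_int a' / (real (level G) * real c) * (real (level G) * of_int (qf G z))))"
    by (simp add: dual_term_def B(3) half_form_rvec[OF B(1)])
  also have "- of_int a' / (real (level G) * real c) * (real (level G) * of_int (qf G z)) = real_of_int (- a' * qf G z) / of_int (int c)"
    using B(4) by simp
  finally show ?thesis by (simp only: chr_def)
qed

section \<open>Assembly: independence of representatives, Poisson summation and
  normalization\<close>

theorem theorem5p2:
  fixes G :: "int ^ 'n ^ 'n" and c :: nat and a a' :: int
    and w :: "real ^ 'n" and H :: "(int ^ 'n) set set"
  assumes "transpose G = G"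
    and "pos_definite (rmat G)"
    and "even_integral (rmat G)"
    and "c > 0"
    and "level G dvd c"
    and "a \<noteq> 0"
    and "coprime a (int c)"
    and "\<forall>i. w $ i \<in> \<rat>"
    and "\<forall>i. (rmat G *v w) $ i \<in> \<int>"
    and "subgroup H (Zn_mod c)"
    and "[a * a' = 1] (mod int (c * level G))"
  shows "(\<forall>V \<in> dual_support G c a w H.
            \<forall>y \<in> V \<inter> shifted_lattice G a w. \<forall>y' \<in> V \<inter> shifted_lattice G a w.
              dual_term G c a a' w y = dual_term G c a a' w y') \<and>
         (\<forall>r. (\<forall>V \<in> dual_support G c a w H. r V \<in> V \<inter> shifted_lattice G a w) \<longrightarrow>
            1 / of_real (sqrt (real (card H))) * gauss_sum G H (of_int a / real c) w =
            gamma_factor G a c w *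
            of_real (sqrt (of_int (det G)) / sqrt (real (card (perp c H)))) *
            (\<Sum>V \<in> dual_support G c a w H. dual_term G c a a' w (r V)))"
proof -
  have good: "good_form G" using assms(1-3) by (rule good_form_if_pos_definite)
  note even = good_form_even[OF good]
  obtain B where B: "even_form B" "G ** B = mat (int (level G))" "dual_matrix G = rmat B" "level G > 0"
    by (rule level_dual_matrix[OF good])
  have N: "int (level G) > 0" "int (level G) dvd int c" using B(4) assms(5) by simp_all
  obtain l where l: "int c = int (level G) * l" using N(2) by blast
  have c: "int c > 0" using assms(4) by simp
  have aa: "[a * a' = 1] (mod int c)" using assms(11) by (rule cong_dvd_modulus) simp
  have "\<forall>i. \<exists>k. (rmat G *v w) $ i = real_of_int k" using assms(9) by (metis Ints_cases)
  then obtain k where "\<forall>i. (rmat G *v w) $ i = real_of_int (k i)" by metis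
  then have "rmat G *v w = rvec (\<chi> i. k i)" by (simp add: vec_eq_iff)
  then obtain g where g: "rmat G *v w = rvec g" by blast
  note lattice = shifted_lattice_eq[OF g, of a]
  define L where "L = shifted_lattice G a w"
  define F where "F y = (\<Sum>u\<in>rbox (int c). chr (int c) (a * (qf G u + vdot u g)) * chr (int c) (- vdot y u))" for y
  have F_on: "F y = dual_term G c a a' w y * gsum G a (int c)" if "y \<in> L" for y
    using that gauss_sum_lattice[OF even c aa, of g] dual_term_eq[OF even B g]
    by (auto simp: L_def lattice F_def)
  have F_off: "F y = 0" if "y \<notin> L" for y
    unfolding F_def by (rule gauss_sum_off_lattice[OF even B(1,2) N(1) c N(2)]) (use that in \<open>simp add: L_def lattice\<close>)

  have indep: "y' \<in> L \<and> dual_term G c a a' w y = dual_term G c a a' w y'" if y: "y \<in> L" "vcong (int c) y' y" for y y'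
  proof -
    obtain z where z: "y = a *s g + G *v z" using y(1) by (auto simp: L_def lattice)
    obtain x where x: "y' = y + int c *s x" using y(2) by (auto simp: vcong_iff_scale)
    \<comment> \<open>Moving within the class by \<open>c x\<close> means replacing \<open>z\<close>
      by \<open>z + s\<close>, as \<open>G s = c x\<close>; and \<open>s\<close> is a period of
      \<open>q\<close> modulo \<open>c\<close>.\<close>
    define s where "s = l *s (B *v x)"
    note s = lattice_translate[OF even B(1,2), of l x, folded s_def l]
    have y': "y' = a *s g + G *v (z + s)" by (simp add: x z s(1) matrix_vector_right_distrib add.assoc)
    have "int c dvd qf G (z + s) - qf G z"
      using s(2) by (simp add: qf_add[OF even] s(1) vdot_scale_right)
    then have "[- a' * qf G z = - a' * qf G (z + s)] (mod int c)"
      by (intro cong_mult cong_refl cong_sym[of "qf G (z + s)"]) (simp add: cong_iff_dvd_diff)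
    then have "dual_term G c a a' w y = dual_term G c a a' w y'"
      unfolding z y' dual_term_eq[OF even B g] by (rule chr_cong)
    then show ?thesis using y' by (auto simp: L_def lattice)
  qed
  have vcong_sym: "vcong m u v" if "vcong m v u" for m and u v :: "int ^ 'n"
    using that by (simp add: vcong_iff_vmod)
  have sub: "H \<subseteq> carrier (Zn_mod c)" using assms(10) by (rule subgroup.subset)
  have indep_class: "dual_term G c a a' w y = dual_term G c a a' w y'"
    if V: "V \<in> dual_support G c a w H" "y \<in> V" "y \<in> L" "y' \<in> V" for V y y'
  proof -
    obtain v where "V = residue_class c v" using V(1) by (auto simp: dual_support_def)
    then have "vcong (int c) y v" "vcong (int c) y' v" using V by (simp_all add: mem_residue_class)
    then have "vcong (int c) y' y" by (simp add: vcong_iff_vmod)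
    then show ?thesis using indep V by blast
  qed
  have main: "1 / of_real (sqrt (real (card H))) * gauss_sum G H (of_int a / real c) w =
      gamma_factor G a c w * of_real (sqrt (of_int (det G)) / sqrt (real (card (perp c H)))) *
      (\<Sum>V \<in> dual_support G c a w H. dual_term G c a a' w (r V))"
    if r: "\<forall>V \<in> dual_support G c a w H. r V \<in> V \<inter> L" for r
  proof -
    define S where "S = (\<Sum>V \<in> dual_support G c a w H. dual_term G c a a' w (r V))"
    \<comment> \<open>The part of the exponent depending on \<open>w\<close> alone, a constant over
      \<open>H\<close>; it becomes the last factor of \<open>gamma_factor\<close>.\<close>
    define K where "K = e (of_real (of_int a / real c * half_form (rmat G) w))"
    have "(\<Sum>y\<in>reps c (perp c H). F y) = (\<Sum>y\<in>reps c (dual_support G c a w H). F y)"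
    proof (rule sum.mono_neutral_right)
      show "reps c (dual_support G c a w H) \<subseteq> reps c (perp c H)" by (auto simp: reps_def dual_support_def)
      show "\<forall>y\<in>reps c (perp c H) - reps c (dual_support G c a w H). F y = 0"
      proof
        fix y assume "y \<in> reps c (perp c H) - reps c (dual_support G c a w H)"
        then have "y \<notin> L" by (auto simp: reps_def dual_support_def L_def)
        then show "F y = 0" by (rule F_off)
      qed
    qed simp
    also have "\<dots> = (\<Sum>y\<in>reps c (dual_support G c a w H). dual_term G c a a' w (r (residue_class c y)) * gsum G a (int c))"
    proof (rule sum.cong[OF refl])
      fix y assume "y \<in> reps c (dual_support G c a w H)"
      then have V: "residue_class c y \<in> dual_support G c a w H" by (simp add: reps_def)
      then obtain y0 where y0: "y0 \<in> L" "residue_class c y = residue_class c y0"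
        by (auto simp: dual_support_def L_def)
      then have yL: "y \<in> L" using indep by (simp add: residue_class_eq_iff)
      have "dual_term G c a a' w y = dual_term G c a a' w (r (residue_class c y))"
        using indep_class[OF V residue_class_self yL] r V by blast
      then show "F y = dual_term G c a a' w (r (residue_class c y)) * gsum G a (int c)"
        using F_on[OF yL] by simp
    qed
    also have "\<dots> = S * gsum G a (int c)"
    proof -
      have "dual_support G c a w H \<subseteq> carrier (Zn_mod c)" by (auto simp: dual_support_def perp_def)
      then show ?thesis
        using sum.reindex_bij_betw[OF bij_betw_reps[OF assms(4)], of "dual_support G c a w H" "\<lambda>V. dual_term G c a a' w (r V)"]
        by (simp add: S_def sum_distrib_right[symmetric])
    qed
    finally have SF: "(\<Sum>y\<in>reps c (perp c H). F y) = S * gsum G a (int c)" .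

    \<comment> \<open>Representatives taken from the box, so that \<open>gauss_sum\<close> becomes a
      sum over \<open>reps c H\<close> as required by \<open>poisson_subgroup\<close>.\<close>
    define rep where "rep V = inv_into (reps c H) (residue_class c) V" for V
    note bij = bij_betw_reps[OF assms(4) sub]
    have rep: "rep (residue_class c v) = v" if "v \<in> reps c H" for v
      using bij that by (simp add: rep_def bij_betw_inv_into_left)
    have "gauss_sum G H (of_int a / real c) w = (\<Sum>V\<in>H. e (of_real (of_int a / real c * half_form (rmat G) (rvec (rep V) + w))))"
    proof (rule gauss_sum_eq[OF assms(1,3,4,9) sub])
      show "\<forall>V\<in>H. rep V \<in> V"
      proof
        fix V assume "V \<in> H"
        then obtain v where v: "v \<in> reps c H" "V = residue_class c v"
          using bij by (auto simp: bij_betw_def)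
        then show "rep V \<in> V" using rep residue_class_self by simp
      qed
    qed
    also have "\<dots> = (\<Sum>v\<in>reps c H. e (of_real (of_int a / real c * half_form (rmat G) (rvec (rep (residue_class c v)) + w))))"
      by (rule sum.reindex_bij_betw[OF bij, symmetric])
    also have "\<dots> = (\<Sum>v\<in>reps c H. K * chr (int c) (a * (qf G v + vdot v g)))"
    proof (rule sum.cong[OF refl])
      fix v assume v: "v \<in> reps c H"
      have sym: "transpose (rmat G) = rmat G"
        using assms(1) by (simp add: vec_eq_iff transpose_def)
      have "half_form (rmat G) (rvec v + w) = half_form (rmat G) w + of_int (qf G v + vdot v g)"
        using half_form_add[OF sym, of w "rvec v"]
        by (simp add: add.commute g half_form_rvec[OF even] rvec_inner)
      then have "of_int a / real c * half_form (rmat G) (rvec v + w) =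
          of_int a / real c * half_form (rmat G) w + of_int (a * (qf G v + vdot v g)) / of_int (int c)"
        by (simp add: distrib_left add_divide_distrib)
      then show "e (of_real (of_int a / real c * half_form (rmat G) (rvec (rep (residue_class c v)) + w))) =
          K * chr (int c) (a * (qf G v + vdot v g))"
        unfolding rep[OF v] K_def chr_def by (simp only: of_real_add e_add)
    qed
    finally have gs: "gauss_sum G H (of_int a / real c) w = K * (\<Sum>v\<in>reps c H. chr (int c) (a * (qf G v + vdot v g)))"
      by (simp add: sum_distrib_left)
    have card: "card (reps c H) = card H" by (rule bij_betw_same_card[OF bij])
    define h p where "h = real (card H)" and "p = real (card (perp c H))"
    have hp: "h * p = real c ^ CARD('n)"
      using card_perp[OF assms(4,10)] unfolding h_def p_def by (metis of_nat_mult of_nat_power)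
    have pos: "h > 0" "p > 0"
    proof -
      have "h * p > 0" using hp assms(4) by simp
      moreover have "h \<ge> 0" "p \<ge> 0" by (simp_all add: h_def p_def)
      ultimately show "h > 0" "p > 0" by (auto simp: zero_less_mult_iff)
    qed
    \<comment> \<open>The factor \<open>c^(n/2)\<close> of \<open>gauss_const\<close>. By
      \<open>card_perp\<close> it equals \<open>sqrt h * sqrt p\<close>, which yields the symmetric
      normalization by the two cardinalities.\<close>
    define q where "q = sqrt (real c) ^ CARD('n)"
    have q: "q * q = h * p" "q > 0" using assms(4) hp by (simp_all add: q_def flip: power_mult_distrib)
    then have q': "q = sqrt h * sqrt p" using pos by (metis less_imp_le real_sqrt_mult real_sqrt_mult_self abs_of_nonneg real_sqrt_abs2)
    have "of_real (h * p) * (\<Sum>v\<in>reps c H. chr (int c) (a * (qf G v + vdot v g))) = of_real h * (S * gsum G a (int c))"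
      using poisson_subgroup[OF assms(4,10), of "\<lambda>v. chr (int c) (a * (qf G v + vdot v g))"] SF
      unfolding hp by (simp add: F_def card h_def)
    then have sum: "(\<Sum>v\<in>reps c H. chr (int c) (a * (qf G v + vdot v g))) = S * gsum G a (int c) / of_real p"
      using pos by (simp add: field_simps)
    have gsum: "gsum G a (int c) = of_real (sqrt h * sqrt p) * of_real (sqrt (of_int (det G))) * (e (of_nat CARD('n) / 8) * mu G a c)"
      using gsum_eq_mu[OF good B(1,2) N(1) assms(4) N(2) assms(6,7)]
      by (simp add: gauss_const_def chr_def q_def flip: q')
    have gam: "gamma_factor G a c w = e (of_nat CARD('n) / 8) * mu G a c * K"
    proof -
      have "of_int a / real c * half_form (rmat G) w = of_int a / (2 * real c) * (w \<bullet> (rmat G *v w))"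
        by (simp add: half_form_def)
      then show ?thesis by (simp only: gamma_factor_def K_def)
    qed
    have "1 / of_real (sqrt h) * (K * (S * (of_real (sqrt h * sqrt p) * D * M) / of_real p)) = M * K * (D / of_real (sqrt p)) * S"
      for D M :: complex
    proof -
      have "complex_of_real p = of_real (sqrt p) * of_real (sqrt p)" using pos by (simp flip: of_real_mult)
      then show ?thesis using pos by (simp add: field_simps)
    qed
    from this[of "of_real (sqrt (of_int (det G)))" "e (of_nat CARD('n) / 8) * mu G a c"]
    show ?thesis unfolding gs sum gsum gam S_def[symmetric] h_def[symmetric] p_def[symmetric] by simp
  qed
  show ?thesis using indep_class main unfolding L_def by blast
qed

end
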